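(* Let $n\ge1$ and $w_0\in B_n$ with $w_0(i)=-i$. The character \[ \sum_{C\in\mathrm{Conj}(B_n):\,C^2=\{1\}\text{ or }C^2=\{w_0\}}\psi^C|_{D_n} \] of $D_n$ is a double Gelfand model for $D_n$, i.e. every irreducible character of $D_n$ occurs in it with multiplicity exactly $2$.
   Context: $B_n$ is the group of bijections $w$ of $\{\pm1,\dots,\pm n\}$ with $w(-i)=-w(i)$; $D_n$ the subgroup with an even number of $i\in[n]$ with $w(i)<0$; $C^2=\{x^2:x\in C\}$. Cycles: if $c=(a_1,\dots,a_\ell)$ is a cycle of $w$ on $\{\pm1,\dots,\pm n\}$ so is $\bar c$ (negated entries); if $c\ne\bar c$, $c\bar c$ is a cycle of length $\ell$ and class $+1$; if $c=\bar c$, a cycle of length $\ell/2$ and class $-1$. For $x\in C$ with $a_{i,\varepsilon}$ cycles of length $i$ and class $\varepsilon$, $Z_{B_n}(x)\cong\prod_{i,\varepsilon}G_{i,\varepsilon}\wr S_{a_{i,\varepsilon}}$, where $G_{i,+}\cong\mathbb Z_2\times\mathbb Z_i$ is the centralizer in $B_i$ of one cycle of length $i$ and class $+1$ ($\mathbb Z_2$ generated by $[-1,\dots,-i]$, $\mathbb Z_i$ by the cycle) and $G_{i,-}\cong\mathbb Z_{2i}$ is generated by one cycle of class $-1$. $\omega_{i,+}$: linear character of $G_{i,+}\wr S_a$, product over base factors of (trivial on $\mathbb Z_2$)$\times$(faithful character of $\mathbb Z_i$), trivial on the complement $S_a$; $\omega_{i,-}$: product over base factors of a faithful character of $\mathbb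 Z_{2i}$, trivial on $S_a$; $\omega^x=\bigotimes\omega_{i,\varepsilon}$ and $\psi^C=\mathrm{Ind}_{Z_{B_n}(x)}^{B_n}\omega^x$. *)

theory Defs
  imports
    "HOL-Algebra.Elementary_Groups"
    "HOL-Combinatorics.Orbits"
    "Jordan_Normal_Form.VS_Connect"
begin

section \<open>Complex characters of finite groups\<close>

definition representation :: "('g, 'm) monoid_scheme \<Rightarrow> nat \<Rightarrow> ('g \<Rightarrow> complex mat) \<Rightarrow> bool" where
  "representation G d \<rho> \<longleftrightarrow>
     (\<forall>g\<in>carrier G. \<rho> g \<in> carrier_mat d d) \<and>
     \<rho> \<one>\<^bsub>G\<^esub> = 1\<^sub>m d \<and>
     (\<forall>g\<in>carrier G. \<forall>h\<in>carrier G. \<rho> (g \<otimes>\<^bsub>G\<^esub> h) = \<rho> g * \<rho> h)"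

definition irreducible_representation ::
    "('g, 'm) monoid_scheme \<Rightarrow> nat \<Rightarrow> ('g \<Rightarrow> complex mat) \<Rightarrow> bool" where
  "irreducible_representation G d \<rho> \<longleftrightarrow>
     representation G d \<rho> \<and> d > 0 \<and>
     (\<forall>W. VectorSpace.subspace class_ring W (module_vec TYPE(complex) d) \<and>
          (\<forall>g\<in>carrier G. \<forall>v\<in>W. \<rho> g *\<^sub>v v \<in> W)
        \<longrightarrow> W = {0\<^sub>v d} \<or> W = carrier_vec d)"

text \<open>Characters are kept equal to \<^const>\<open>undefined\<close> outside the carrier, so that equality of
  irreducible characters as HOL functions is equality on the group.\<close>

definition irreducible_characters :: "('g, 'm) monoid_scheme \<Rightarrow> ('g \<Rightarrow> complex) set" where
  "irreducible_characters G =
     {\<chi>. \<exists>d \<rho>. irreducible_representation G d \<rho> \<and>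
          \<chi> = (\<lambda>g\<in>carrier G. sum_list (diag_mat (\<rho> g)))}"

definition has_multiplicities ::
    "('g, 'm) monoid_scheme \<Rightarrow> ('g \<Rightarrow> complex) \<Rightarrow> (('g \<Rightarrow> complex) \<Rightarrow> nat) \<Rightarrow> bool" where
  "has_multiplicities G \<phi> m \<longleftrightarrow>
     (\<forall>g\<in>carrier G. \<phi> g = (\<Sum>\<chi>\<in>irreducible_characters G. of_nat (m \<chi>) * \<chi> g))"

definition double_gelfand_model :: "('g, 'm) monoid_scheme \<Rightarrow> ('g \<Rightarrow> complex) \<Rightarrow> bool" where
  "double_gelfand_model G \<phi> \<longleftrightarrow>
     (\<exists>m. has_multiplicities G \<phi> m \<and> (\<forall>\<chi>\<in>irreducible_characters G. m \<chi> = 2))"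

definition complex_units :: "complex monoid" where
  "complex_units = \<lparr>carrier = UNIV - {0}, monoid.mult = (*), one = 1\<rparr>"

definition linear_character :: "('g, 'm) monoid_scheme \<Rightarrow> ('g \<Rightarrow> complex) \<Rightarrow> bool" where
  "linear_character G \<chi> \<longleftrightarrow> \<chi> \<in> hom G complex_units"

definition faithful_linear_character :: "('g, 'm) monoid_scheme \<Rightarrow> ('g \<Rightarrow> complex) \<Rightarrow> bool" where
  "faithful_linear_character G \<chi> \<longleftrightarrow> linear_character G \<chi> \<and> inj_on \<chi> (carrier G)"

definition induced_character ::
    "('g, 'm) monoid_scheme \<Rightarrow> 'g set \<Rightarrow> ('g \<Rightarrow> complex) \<Rightarrow> 'g \<Rightarrow> complex" where
  "induced_character G H \<phi> g =
     (\<Sum>t | t \<in> carrier G \<and> inv\<^bsub>G\<^esub> t \<otimes>\<^bsub>G\<^esub> g \<otimes>\<^bsub>G\<^esub> t \<in> H.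
        \<phi> (inv\<^bsub>G\<^esub> t \<otimes>\<^bsub>G\<^esub> g \<otimes>\<^bsub>G\<^esub> t)) / of_nat (card H)"

definition conjugacy_classes :: "('g, 'm) monoid_scheme \<Rightarrow> 'g set set" where
  "conjugacy_classes G =
     (\<lambda>x. (\<lambda>g. g \<otimes>\<^bsub>G\<^esub> x \<otimes>\<^bsub>G\<^esub> inv\<^bsub>G\<^esub> g) ` carrier G) ` carrier G"

definition class_square :: "('g, 'm) monoid_scheme \<Rightarrow> 'g set \<Rightarrow> 'g set" where
  "class_square G C = (\<lambda>x. x \<otimes>\<^bsub>G\<^esub> x) ` C"

definition centralizer :: "('g, 'm) monoid_scheme \<Rightarrow> 'g \<Rightarrow> 'g set" where
  "centralizer G x = {z \<in> carrier G. z \<otimes>\<^bsub>G\<^esub> x = x \<otimes>\<^bsub>G\<^esub> z}"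


section \<open>Signed permutations\<close>

definition letters :: "nat \<Rightarrow> int set" where
  "letters n = {- int n..int n} - {0}"

text \<open>A signed permutation is extended by the identity to all integers.\<close>

definition B_group :: "nat \<Rightarrow> (int \<Rightarrow> int) monoid" where
  "B_group n = \<lparr>carrier = {w. w permutes letters n \<and> (\<forall>i\<in>letters n. w (- i) = - w i)},
                monoid.mult = (\<circ>), one = id\<rparr>"

definition D_group :: "nat \<Rightarrow> (int \<Rightarrow> int) monoid" where
  "D_group n = (B_group n)
     \<lparr>carrier := {w \<in> carrier (B_group n). even (card {i \<in> {1..int n}. w i < 0})}\<rparr>"

definition w0 :: "nat \<Rightarrow> int \<Rightarrow> int" where
  "w0 n i = (if i \<in> letters n then - i else i)"


section \<open>Signed cycles\<close>

text \<open>A signed cycle of \<open>x\<close> (a pair of cycles \<open>c\<close>, \<open>c\<close>-bar, or a single self-opposite \<open>c\<close>)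
  is represented by its support, a symmetric subset \<open>Q\<close> of the letters; the cycle itself is
  the restriction \<^term>\<open>perm_restrict x Q\<close>.\<close>

definition signed_cycles :: "nat \<Rightarrow> (int \<Rightarrow> int) \<Rightarrow> int set set" where
  "signed_cycles n x = (\<lambda>a. Orbits.orbit x a \<union> uminus ` Orbits.orbit x a) ` letters n"

definition negative_cycle :: "(int \<Rightarrow> int) \<Rightarrow> int set \<Rightarrow> bool" where
  "negative_cycle x Q \<longleftrightarrow> (\<exists>a\<in>Q. uminus ` Orbits.orbit x a = Orbits.orbit x a)"

text \<open>If \<open>c\<close> and \<open>c\<close>-bar are disjoint, the length is that of \<open>c\<close>; if they coincide, it is half
  of that of \<open>c\<close>. In both cases it is half the size of the support.\<close>

definition cycle_length :: "int set \<Rightarrow> nat" where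
  "cycle_length Q = card Q div 2"


section \<open>The characters \<open>\<omega>\<^sup>x\<close> and \<open>\<psi>\<^sup>C\<close>\<close>

text \<open>The complement (the product of the symmetric groups in the wreath products) depends on how
  the base factors are identified with each other. This is fixed by a choice \<open>b\<close> of a base point
  in every signed cycle of \<open>x\<close>: the complement consists of the elements of the centralizer of
  \<open>x\<close> that permute the base points. Such an element maps the \<open>k\<close>-th entry of a cycle, counted
  from its base point, to the \<open>k\<close>-th entry of the image cycle.\<close>

definition wreath_complement ::
    "nat \<Rightarrow> (int \<Rightarrow> int) \<Rightarrow> (int set \<Rightarrow> int) \<Rightarrow> (int \<Rightarrow> int) set" where
  "wreath_complement n x b =
     {s \<in> centralizer (B_group n) x. s ` (b ` signed_cycles n x) = b ` signed_cycles n x}"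

text \<open>\<open>\<kappa>pos i\<close> is a character of \<open>\<int>\<^sub>i\<close> and \<open>\<kappa>neg i\<close> a character of \<open>\<int>\<^sub>2\<^sub>i\<close>; the residue class of
  \<open>t\<close> stands for the \<open>t\<close>-th power of the generating cycle. The base factor of a positive cycle
  \<open>Q\<close> consists of the products of powers of \<^term>\<open>perm_restrict (w0 n) Q\<close> (the generator of
  \<open>\<int>\<^sub>2\<close>) and of \<^term>\<open>perm_restrict x Q\<close>.\<close>

definition is_omega ::
    "nat \<Rightarrow> (nat \<Rightarrow> int \<Rightarrow> complex) \<Rightarrow> (nat \<Rightarrow> int \<Rightarrow> complex) \<Rightarrow>
     (int \<Rightarrow> int) \<Rightarrow> (int set \<Rightarrow> int) \<Rightarrow> ((int \<Rightarrow> int) \<Rightarrow> complex) \<Rightarrow> bool" where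
  "is_omega n \<kappa>pos \<kappa>neg x b \<omega> \<longleftrightarrow>
     \<omega> \<in> extensional (centralizer (B_group n) x) \<and>
     linear_character ((B_group n)\<lparr>carrier := centralizer (B_group n) x\<rparr>) \<omega> \<and>
     (\<forall>Q\<in>signed_cycles n x. \<not> negative_cycle x Q \<longrightarrow>
        (\<forall>s t. \<omega> ((perm_restrict (w0 n) Q ^^ s) \<circ> (perm_restrict x Q ^^ t))
                 = \<kappa>pos (cycle_length Q) (int t mod int (cycle_length Q)))) \<and>
     (\<forall>Q\<in>signed_cycles n x. negative_cycle x Q \<longrightarrow>
        (\<forall>t. \<omega> (perm_restrict x Q ^^ t)
                 = \<kappa>neg (cycle_length Q) (int t mod int (2 * cycle_length Q)))) \<and>
     (\<forall>s\<in>wreath_complement n x b. \<omega> s = 1)"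

text \<open>The centralizer is generated by the base factors and the complement, so there is at most one
  such \<open>\<omega>\<close>; it exists by the semidirect product structure of the wreath products.\<close>

definition omega ::
    "nat \<Rightarrow> (nat \<Rightarrow> int \<Rightarrow> complex) \<Rightarrow> (nat \<Rightarrow> int \<Rightarrow> complex) \<Rightarrow>
     (int \<Rightarrow> int) \<Rightarrow> (int set \<Rightarrow> int) \<Rightarrow> (int \<Rightarrow> int) \<Rightarrow> complex" where
  "omega n \<kappa>pos \<kappa>neg x b = (THE \<omega>. is_omega n \<kappa>pos \<kappa>neg x b \<omega>)"

definition psi ::
    "nat \<Rightarrow> (nat \<Rightarrow> int \<Rightarrow> complex) \<Rightarrow> (nat \<Rightarrow> int \<Rightarrow> complex) \<Rightarrow>
     (int \<Rightarrow> int) \<Rightarrow> (int set \<Rightarrow> int) \<Rightarrow> (int \<Rightarrow> int) \<Rightarrow> complex" where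
  "psi n \<kappa>pos \<kappa>neg x b =
     induced_character (B_group n) (centralizer (B_group n) x) (omega n \<kappa>pos \<kappa>neg x b)"

end

theory Submission
  imports Defs "Jordan_Normal_Form.Spectral_Radius"
begin

text \<open>For \<open>g\<close> in \<open>D\<^sub>n\<close>, grouping the induction sum by conjugates gives
  \<open>\<psi>\<^sup>C(g) = \<Sum>\<^bsub>y\<in>C, yg=gy\<^esub> \<omega>\<^sup>y(g)\<close>, where the weight \<open>\<omega>\<^sup>y(g)\<close> does not depend on the chosen base points.
  Removing one signed cycle of \<open>g\<close> at a time shows, for \<open>\<eta> = 1\<close> and \<open>\<eta> = - 1\<close>, that the weights of
  all \<open>y\<close> with \<open>y\<^sup>2 = \<eta>\<close> commuting with \<open>g\<close> sum to \<open>\<Sum> \<eta>\<^bsup>neg x\<^esup>\<close> over the \<open>x\<close> with \<open>x\<^sup>2 = g\<close>. Adding both cases, the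
  character of the theorem is \<open>\<phi>(g) = 2 |{x \<in> D\<^sub>n. x\<^sup>2 = g}|\<close>, which is twice the sum of all
  irreducible characters weighted by their Frobenius-Schur indicators. Each element of \<open>D\<^sub>n\<close> is conjugate
  to its inverse, so no indicator vanishes, and none is negative because \<open>\<phi>\<close> is a genuine character.\<close>

section \<open>Traces and bases of complex matrices\<close>

text \<open>The obstacle is that \<open>g\<close> permutes the signed cycles of \<open>y\<close>, so
  the wreath product character is not a product over cycles fixed by \<open>g\<close> and seems to
  depend on how the cycles are identified. It is therefore written as a product of ratios
  \<open>p (g a) / p a\<close> over base points \<open>a\<close>, where \<open>p\<close> grows along
  each cycle of \<open>y\<close> by the chosen character of the base factor. In such a product a
  change of base points or of \<open>p\<close> cancels, the value is multiplicative in
  \<open>g\<close>, and it factorizes over disjoint invariant supports. Since \<open>y\<close>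
  squares to 1 or to \<open>w0 n\<close>, its signed cycles have length at most 2, so at the
  generators the faithful characters take only the values 1, -1 and one square root of -1. For
  \<eta> = -1 the sign attached to a square root is the character of B_n with kernel D_n; this is
  why adding the two cases doubles the roots inside D_n and cancels the others. On the side of
  representations, matrices with one-sided inverses play the role of bases, and completeness of the
  irreducible characters is drawn from a nonzero eigenvalue in the regular representation.\<close>

abbreviation tr :: "complex mat \<Rightarrow> complex" where
  "tr A \<equiv> sum_list (diag_mat A)"

lemma tr_eq_sum: "A \<in> carrier_mat n n \<Longrightarrow> tr A = (\<Sum>i<n. A $$ (i, i))"
  by (simp add: diag_mat_def sum_list_distinct_conv_sum_set atLeast0LessThan)

lemma mult_entry:
  assumes "A \<in> carrier_mat n m" "B \<in> carrier_mat m k" "i < n" "j < k"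
  shows "(A * B) $$ (i, j) = (\<Sum>l<m. A $$ (i, l) * B $$ (l, j))"
  using assms by (simp add: scalar_prod_def atLeast0LessThan)

lemma mult_vec_entry:
  assumes "A \<in> carrier_mat n m" "v \<in> carrier_vec m" "i < n"
  shows "(A *\<^sub>v v) $ i = (\<Sum>l<m. A $$ (i, l) * v $ l)"
  using assms by (simp add: scalar_prod_def atLeast0LessThan)

lemma tr_mult_commute:
  assumes A: "A \<in> carrier_mat n m" and B: "B \<in> carrier_mat m n"
  shows "tr (A * B) = tr (B * A)"
proof -
  have "tr (A * B) = (\<Sum>i<n. \<Sum>l<m. A $$ (i, l) * B $$ (l, i))"
    using A B by (subst tr_eq_sum[of _ n]) (auto simp: mult_entry[OF A B] simp del: index_mult_mat)
  also have "\<dots> = (\<Sum>l<m. \<Sum>i<n. B $$ (l, i) * A $$ (i, l))"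
    by (subst sum.swap) (simp add: mult.commute)
  also have "\<dots> = tr (B * A)"
    using A B by (subst tr_eq_sum[of _ m]) (auto simp: mult_entry[OF B A] simp del: index_mult_mat)
  finally show ?thesis .
qed

lemma similar_upper_triangular:
  assumes A: "(A :: complex mat) \<in> carrier_mat n n"
  obtains U P Q where "similar_mat_wit A U P Q" "upper_triangular U" "U \<in> carrier_mat n n"
proof -
  obtain es where "char_poly A = (\<Prod>a\<leftarrow>es. [:- a, 1:])"
    using char_poly_factorized[OF A] by blast
  from schur_decomposition_exists[OF A this] obtain U where
    "U \<in> carrier_mat n n" "upper_triangular U" "similar_mat A U" by blast
  with that show thesis unfolding similar_mat_def by blast
qed

lemma similar_mat_wit_tr:
  assumes A: "A \<in> carrier_mat n n" and "similar_mat_wit A U P Q"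
  shows "tr A = tr U"
proof -
  note s = similar_mat_witD2[OF assms]
  have "tr A = tr (P * (U * Q))" using s by (simp add: assoc_mult_mat[of _ n n _ n _ n])
  also have "\<dots> = tr (U * Q * P)" using s by (intro tr_mult_commute[of _ n n]) auto
  also have "U * Q * P = U * (Q * P)" using s by (intro assoc_mult_mat[of _ n n _ n _ n]) auto
  finally show ?thesis using s by simp
qed

lemma upper_triangular_mult_diag:
  assumes U: "(U :: complex mat) \<in> carrier_mat n n" "upper_triangular U" and i: "i < n"
  shows "(U * U) $$ (i, i) = (U $$ (i, i))\<^sup>2"
proof -
  have "(U * U) $$ (i, i) = (\<Sum>l<n. U $$ (i, l) * U $$ (l, i))"
    using U i by (intro mult_entry) auto
  also have "\<dots> = (\<Sum>l<n. if l = i then (U $$ (i, i))\<^sup>2 else 0)"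
    using U i by (intro sum.cong) (auto simp: upper_triangular_def power2_eq_square neq_iff)
  finally show ?thesis using i by simp
qed

text \<open>A triangular form of an idempotent has only 0 and 1 on its diagonal, and the trace
  counts the ones. Applied to averages over a group this makes multiplicities natural
  numbers.\<close>

lemma idempotent_trace:
  assumes P: "P \<in> carrier_mat n n" and idem: "P * P = (P :: complex mat)"
  obtains k where "k \<le> n" "tr P = of_nat k"
proof -
  obtain U S T where s: "similar_mat_wit P U S T" and U: "upper_triangular U" "U \<in> carrier_mat n n"
    using similar_upper_triangular[OF P] by blast
  note w = similar_mat_witD2[OF P s]
  have c: "U \<in> carrier_mat n n" "S \<in> carrier_mat n n" "T \<in> carrier_mat n n"
    and ST: "S * T = 1\<^sub>m n" and TS: "T * S = 1\<^sub>m n" and P_eq: "P = S * U * T"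
    using w by blast+
  have U_eq: "U = T * P * S"
  proof -
    have "T * P * S = T * (S * U * T) * S" unfolding P_eq ..
    also have "\<dots> = (T * S) * U * (T * S)"
      using c by (simp add: assoc_mult_mat[of _ n n _ n _ n])
    also have "\<dots> = U" using c TS by simp
    finally show ?thesis by simp
  qed
  have "U * U = T * P * (S * T) * P * S"
    unfolding U_eq using c P by (simp add: assoc_mult_mat[of _ n n _ n _ n])
  also have "\<dots> = T * (P * P) * S" unfolding ST using c P by (simp add: assoc_mult_mat[of _ n n _ n _ n])
  finally have "U * U = U" unfolding idem using U_eq by simp
  then have d: "U $$ (i, i) = 0 \<or> U $$ (i, i) = 1" if "i < n" for i
    using upper_triangular_mult_diag[OF U(2,1) that] by (auto simp: power2_eq_square)
  have "tr P = (\<Sum>i<n. U $$ (i, i))"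
    using similar_mat_wit_tr[OF P s] U by (simp add: tr_eq_sum)
  also have "\<dots> = (\<Sum>i<n. if U $$ (i, i) = 1 then 1 else 0)"
    using d by (intro sum.cong) fastforce+
  also have "\<dots> = of_nat (card {i \<in> {..<n}. U $$ (i, i) = 1})"
    by (subst sum.inter_filter[symmetric]) auto
  finally have "tr P = of_nat (card {i \<in> {..<n}. U $$ (i, i) = 1})" .
  moreover have "card {i \<in> {..<n}. U $$ (i, i) = 1} \<le> n"
    using card_mono[of "{..<n}" "{i \<in> {..<n}. U $$ (i, i) = 1}"] by (simp add: subset_eq)
  ultimately show thesis using that by blast
qed

text \<open>The matrix \<open>Q * L\<close> is idempotent of size \<open>n\<close>, and its trace is
  that of \<open>L * Q\<close>, namely \<open>k\<close>. This serves as the dimension bound for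
  subspaces and for the number of irreducible characters.\<close>

lemma left_inverse_dim_le:
  assumes L: "L \<in> carrier_mat k n" and Q: "Q \<in> carrier_mat n k" and LQ: "L * Q = (1\<^sub>m k :: complex mat)"
  shows "k \<le> n"
proof -
  have "(Q * L) * (Q * L) = Q * (L * Q) * L"
    using L Q by (simp add: assoc_mult_mat[of _ n k _ n _ n] assoc_mult_mat[of _ k n _ k _ n]
        assoc_mult_mat[of _ n k _ k _ n])
  then have "(Q * L) * (Q * L) = Q * L" using L Q LQ by simp
  then obtain j where "j \<le> n" "tr (Q * L) = of_nat j"
    using idempotent_trace[of "Q * L" n] L Q by auto
  moreover have "tr (Q * L) = tr (L * Q)" using tr_mult_commute L Q by blast
  moreover have "tr (L * Q) = of_nat k" unfolding LQ by (subst tr_eq_sum[of _ k]) auto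
  ultimately show ?thesis by simp
qed

text \<open>The diagonal entries of a triangular form are the eigenvalues, and they cannot all
  vanish if their sum does not.\<close>

lemma trace_nonzero_eigenvalue:
  assumes A: "(A :: complex mat) \<in> carrier_mat n n" and "tr A \<noteq> 0"
  obtains v e where "e \<noteq> 0" "v \<in> carrier_vec n" "v \<noteq> 0\<^sub>v n" "A *\<^sub>v v = e \<cdot>\<^sub>v v"
proof -
  obtain U S T where s: "similar_mat_wit A U S T" and U: "upper_triangular U" "U \<in> carrier_mat n n"
    using similar_upper_triangular[OF A] by blast
  have "(\<Sum>i<n. U $$ (i, i)) \<noteq> 0"
    using assms similar_mat_wit_tr[OF A s] U by (simp add: tr_eq_sum)
  then obtain i where i: "i < n" "U $$ (i, i) \<noteq> 0"
    by (metis (no_types, lifting) lessThan_iff sum.neutral)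
  have "char_poly A = char_poly U"
    using s by (intro char_poly_similar) (auto simp: similar_mat_def)
  also have "\<dots> = (\<Prod>a\<leftarrow>diag_mat U. [:- a, 1:])"
    by (rule char_poly_upper_triangular[OF U(2,1)])
  finally have "poly (char_poly A) (U $$ (i, i)) = 0"
    using i U by (auto simp: poly_prod_list prod_list_zero_iff diag_mat_def)
  then have "eigenvalue A (U $$ (i, i))" using eigenvalue_root_char_poly[OF A] by simp
  with i that[of "U $$ (i, i)"] A show thesis unfolding eigenvalue_def eigenvector_def by auto
qed

lemma subspace_iff:
  "VectorSpace.subspace class_ring W (module_vec TYPE(complex) d) \<longleftrightarrow>
     W \<subseteq> carrier_vec d \<and> 0\<^sub>v d \<in> W \<and> (\<forall>v\<in>W. \<forall>w\<in>W. v + w \<in> W) \<and> (\<forall>c. \<forall>v\<in>W. c \<cdot>\<^sub>v v \<in> W)"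
proof -
  have vs: "vectorspace class_ring (module_vec TYPE(complex) d)" by (rule vec_vs)
  show ?thesis
    unfolding VectorSpace.subspace_def submodule_def
    using vs vec_module[where ?'a = complex, of d] by (simp add: module_vec_simps) blast
qed

text \<open>A system of independent vectors in \<open>W\<close> is encoded by a matrix
  \<open>Q\<close> with a left inverse \<open>L\<close>. The number of columns is bounded by
  \<open>d\<close>, so a greatest one exists, and such a system must span \<open>W\<close>. The pair
  \<open>Q\<close>, \<open>L\<close> later allows a subrepresentation to be written as
  \<open>L * \<rho> g * Q\<close>.\<close>

lemma matrix_basis:
  assumes W: "VectorSpace.subspace class_ring W (module_vec TYPE(complex) d)"
  obtains k Q L where "Q \<in> carrier_mat d k" "L \<in> carrier_mat k d" "L * Q = 1\<^sub>m k"
    "W = (\<lambda>v. Q *\<^sub>v v) ` carrier_vec k"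
proof -
  note Wd = W[unfolded subspace_iff]
  define good where "good k \<longleftrightarrow> (\<exists>Q L. Q \<in> carrier_mat d k \<and> L \<in> carrier_mat k d \<and> L * Q = 1\<^sub>m k \<and>
     (\<forall>v\<in>carrier_vec k. Q *\<^sub>v v \<in> W))" for k
  have good0: "good 0"
    unfolding good_def
  proof (intro exI conjI ballI)
    show "0\<^sub>m 0 d * 0\<^sub>m d 0 = (1\<^sub>m 0 :: complex mat)" by (rule eq_matI) auto
    have "0\<^sub>m d 0 *\<^sub>v v = (0\<^sub>v d :: complex vec)" if "v \<in> carrier_vec 0" for v
      using that by (intro eq_vecI) (auto simp: scalar_prod_def)
    then show "0\<^sub>m d 0 *\<^sub>v v \<in> W" if "v \<in> carrier_vec 0" for v using that Wd by auto
  qed auto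
  have le: "k \<le> d" if "good k" for k
    using that left_inverse_dim_le unfolding good_def by blast
  define k where "k = (GREATEST k. good k)"
  have gk: "good k" and max: "good j \<Longrightarrow> j \<le> k" for j
    unfolding k_def using GreatestI_nat[of good 0 d] Greatest_le_nat[of good j d] good0 le by auto
  from gk obtain Q L where Q: "Q \<in> carrier_mat d k" and L: "L \<in> carrier_mat k d"
    and LQ: "L * Q = 1\<^sub>m k" and QW: "\<And>v. v \<in> carrier_vec k \<Longrightarrow> Q *\<^sub>v v \<in> W"
    unfolding good_def by blast
  have "W \<subseteq> (\<lambda>v. Q *\<^sub>v v) ` carrier_vec k"
  proof (rule ccontr)
    assume "\<not> ?thesis"
    then obtain w where w: "w \<in> W" "w \<notin> (\<lambda>v. Q *\<^sub>v v) ` carrier_vec k" by blast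
    have wd: "w \<in> carrier_vec d" using w Wd by auto
    \<comment> \<open>The component of \<open>w\<close> outside the image of \<open>Q\<close>: it
      lies in \<open>W\<close>, is nonzero and is killed by \<open>L\<close>, so it can be appended
      as a new column.\<close>
    define u where "u = w - Q *\<^sub>v (L *\<^sub>v w)"
    have QLw: "Q *\<^sub>v (L *\<^sub>v w) \<in> carrier_vec d" using Q L wd by auto
    have ud: "u \<in> carrier_vec d" unfolding u_def using wd QLw by auto
    have uW: "u \<in> W"
    proof -
      have "u = w + (- 1) \<cdot>\<^sub>v (Q *\<^sub>v (L *\<^sub>v w))" unfolding u_def using wd QLw by auto
      moreover have "Q *\<^sub>v (L *\<^sub>v w) \<in> W" using QW L wd by auto
      ultimately show ?thesis using Wd w by auto
    qed
    have "u \<noteq> 0\<^sub>v d"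
    proof
      assume "u = 0\<^sub>v d"
      have "w $ i = (Q *\<^sub>v (L *\<^sub>v w)) $ i" if i: "i < d" for i
      proof -
        have "u $ i = 0" using \<open>u = 0\<^sub>v d\<close> i by simp
        then show ?thesis unfolding u_def using i carrier_vecD[OF QLw]
          by (simp del: index_mult_mat_vec dim_mult_mat_vec)
      qed
      then have "w = Q *\<^sub>v (L *\<^sub>v w)" using carrier_vecD[OF wd] carrier_vecD[OF QLw]
        by (intro eq_vecI) (simp_all del: index_mult_mat_vec dim_mult_mat_vec)
      moreover have "L *\<^sub>v w \<in> carrier_vec k" using L wd by auto
      ultimately show False using w by blast
    qed
    then obtain i0 where i0: "i0 < d" "u $ i0 \<noteq> 0"
      using ud by (metis carrier_vecD eq_vecI index_zero_vec)
    have "L *\<^sub>v u = L *\<^sub>v w - L *\<^sub>v (Q *\<^sub>v (L *\<^sub>v w))"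
      unfolding u_def using L wd QLw by (intro mult_minus_distrib_mat_vec) auto
    also have "L *\<^sub>v (Q *\<^sub>v (L *\<^sub>v w)) = (L * Q) *\<^sub>v (L *\<^sub>v w)"
      using L Q wd by (intro assoc_mult_mat_vec[symmetric]) auto
    finally have Lu: "L *\<^sub>v u = 0\<^sub>v k" unfolding LQ using L wd by auto
    have QLQ: "Q * (L * Q) = Q" using LQ Q by simp
    \<comment> \<open>Row \<open>i0\<close> of the identity minus \<open>Q * L\<close>, divided by
      the nonzero entry \<open>u $ i0\<close>. It vanishes on the columns of \<open>Q\<close> and is
      1 on \<open>u\<close>, which is what the new row of the left inverse has to do.\<close>
    define \<phi> where "\<phi> j = ((if j = i0 then 1 else 0) - (Q * L) $$ (i0, j)) / u $ i0" for j
    define Q' where "Q' = mat d (Suc k) (\<lambda>(i, j). if j < k then Q $$ (i, j) else u $ i)"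
    define L' where "L' = mat (Suc k) d (\<lambda>(i, j). if i < k then L $$ (i, j) else \<phi> j)"
    have Q': "Q' \<in> carrier_mat d (Suc k)" and L': "L' \<in> carrier_mat (Suc k) d"
      unfolding Q'_def L'_def by auto
    have \<phi>Q: "(\<Sum>l<d. \<phi> l * Q $$ (l, j)) = 0" if "j < k" for j
    proof -
      have "(\<Sum>l<d. ((if l = i0 then 1 else 0) - (Q * L) $$ (i0, l)) * Q $$ (l, j))
          = (\<Sum>l<d. if l = i0 then Q $$ (l, j) else 0) - (\<Sum>l<d. (Q * L) $$ (i0, l) * Q $$ (l, j))"
        by (subst sum_subtractf[symmetric]) (intro sum.cong, auto simp: algebra_simps)
      also have "(\<Sum>l<d. (Q * L) $$ (i0, l) * Q $$ (l, j)) = (Q * L * Q) $$ (i0, j)"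
        using Q L i0 that by (subst mult_entry[of "Q * L" d d Q k]) auto
      also have "Q * L * Q = Q" using QLQ Q L by (simp add: assoc_mult_mat[of _ d k _ d _ k])
      finally have "(\<Sum>l<d. ((if l = i0 then 1 else 0) - (Q * L) $$ (i0, l)) * Q $$ (l, j)) = 0"
        using i0 by simp
      then show ?thesis
        unfolding \<phi>_def by (simp add: sum_divide_distrib[symmetric])
    qed
    have \<phi>u: "(\<Sum>l<d. \<phi> l * u $ l) = 1"
    proof -
      have "(\<Sum>l<d. ((if l = i0 then 1 else 0) - (Q * L) $$ (i0, l)) * u $ l)
          = (\<Sum>l<d. if l = i0 then u $ l else 0) - (\<Sum>l<d. (Q * L) $$ (i0, l) * u $ l)"
        by (subst sum_subtractf[symmetric]) (intro sum.cong, auto simp: algebra_simps)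
      also have "(\<Sum>l<d. (Q * L) $$ (i0, l) * u $ l) = ((Q * L) *\<^sub>v u) $ i0"
        using Q L i0 ud by (subst mult_vec_entry[of "Q * L" d d u]) auto
      also have "(Q * L) *\<^sub>v u = Q *\<^sub>v (L *\<^sub>v u)" using Q L ud by (intro assoc_mult_mat_vec) auto
      also have "(Q *\<^sub>v (L *\<^sub>v u)) $ i0 = 0" unfolding Lu using Q i0 by auto
      finally show ?thesis
        using i0 unfolding \<phi>_def by (simp add: sum_divide_distrib[symmetric])
    qed
    have "L' * Q' = 1\<^sub>m (Suc k)"
    proof (rule eq_matI)
      fix i j assume "i < dim_row (1\<^sub>m (Suc k) :: complex mat)" "j < dim_col (1\<^sub>m (Suc k) :: complex mat)"
      then have ij: "i < Suc k" "j < Suc k" by auto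
      have e: "(L' * Q') $$ (i, j) = (\<Sum>l<d. (if i < k then L $$ (i, l) else \<phi> l) *
          (if j < k then Q $$ (l, j) else u $ l))"
        using ij by (subst mult_entry[OF L' Q']) (auto simp: L'_def Q'_def intro!: sum.cong)
      have a: "(\<Sum>l<d. L $$ (i, l) * Q $$ (l, j)) = (if i = j then 1 else 0)" if "i < k" "j < k"
        using mult_entry[OF L Q that] LQ that by simp
      have b: "(\<Sum>l<d. L $$ (i, l) * u $ l) = 0" if "i < k"
        using mult_vec_entry[OF L ud that] Lu that by simp
      show "(L' * Q') $$ (i, j) = 1\<^sub>m (Suc k) $$ (i, j)"
        unfolding e using ij a b \<phi>Q \<phi>u by (cases "i < k"; cases "j < k") auto
    qed (use L' Q' in auto)
    moreover have "Q' *\<^sub>v v \<in> W" if v: "v \<in> carrier_vec (Suc k)" for v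
    proof -
      have "Q' *\<^sub>v v = Q *\<^sub>v vec k (\<lambda>i. v $ i) + (v $ k) \<cdot>\<^sub>v u"
      proof (rule eq_vecI)
        fix i assume "i < dim_vec (Q *\<^sub>v vec k (\<lambda>i. v $ i) + (v $ k) \<cdot>\<^sub>v u)"
        then have i: "i < d" using ud by auto
        have "(Q *\<^sub>v vec k (\<lambda>i. v $ i)) $ i = (\<Sum>l<k. Q $$ (i, l) * v $ l)"
          using Q i by (subst mult_vec_entry[of _ d k]) auto
        then show "(Q' *\<^sub>v v) $ i = (Q *\<^sub>v vec k (\<lambda>i. v $ i) + (v $ k) \<cdot>\<^sub>v u) $ i"
          using i v ud Q by (subst mult_vec_entry[OF Q']) (auto simp: Q'_def)
      qed (use Q Q' ud in auto)
      moreover have "Q *\<^sub>v vec k (\<lambda>i. v $ i) \<in> W" by (rule QW) auto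
      ultimately show ?thesis using uW Wd by auto
    qed
    ultimately have "good (Suc k)" unfolding good_def using Q' L' by blast
    from max[OF this] show False by simp
  qed
  with QW have "W = (\<lambda>v. Q *\<^sub>v v) ` carrier_vec k" by auto
  with that Q L LQ show thesis by blast
qed

section \<open>Irreducible matrix representations and Schur's lemma\<close>

text \<open>The dimensions are explicit arguments, so that even an empty sum is a matrix of the
  right shape.\<close>

definition msum :: "nat \<Rightarrow> nat \<Rightarrow> 'a set \<Rightarrow> ('a \<Rightarrow> complex mat) \<Rightarrow> complex mat" where
  "msum n m I A = mat n m (\<lambda>(i, j). \<Sum>x\<in>I. A x $$ (i, j))"

lemma msum_carrier [simp]: "msum n m I A \<in> carrier_mat n m"
  by (simp add: msum_def)

lemma msum_index [simp]:
  "i < n \<Longrightarrow> j < m \<Longrightarrow> msum n m I A $$ (i, j) = (\<Sum>x\<in>I. A x $$ (i, j))"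
  by (simp add: msum_def)

lemma msum_cong: "(\<And>x. x \<in> I \<Longrightarrow> A x = B x) \<Longrightarrow> msum n m I A = msum n m I B"
  by (simp add: msum_def)

lemma msum_reindex: "bij_betw f I J \<Longrightarrow> msum n m I (\<lambda>x. A (f x)) = msum n m J A"
  unfolding msum_def by (intro cong_mat refl) (simp add: sum.reindex_bij_betw[where g = "\<lambda>x. A x $$ _"])

lemma mult_msum:
  assumes "B \<in> carrier_mat k n" "\<And>x. x \<in> I \<Longrightarrow> A x \<in> carrier_mat n m"
  shows "B * msum n m I A = msum k m I (\<lambda>x. B * A x)"
proof (rule eq_matI)
  fix i j assume "i < dim_row (msum k m I (\<lambda>x. B * A x))" "j < dim_col (msum k m I (\<lambda>x. B * A x))"
  then have ij: "i < k" "j < m" by (auto simp: msum_def)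
  have "(B * msum n m I A) $$ (i, j) = (\<Sum>l<n. \<Sum>x\<in>I. B $$ (i, l) * A x $$ (l, j))"
    using ij assms by (subst mult_entry[of _ k n _ m]) (auto simp: sum_distrib_left)
  also have "\<dots> = (\<Sum>x\<in>I. (B * A x) $$ (i, j))"
    using ij assms by (subst sum.swap) (intro sum.cong refl mult_entry[of _ k n _ m, symmetric])
  finally show "(B * msum n m I A) $$ (i, j) = msum k m I (\<lambda>x. B * A x) $$ (i, j)"
    using ij by simp
qed (use assms in \<open>auto simp: msum_def\<close>)

lemma msum_mult:
  assumes "B \<in> carrier_mat m k" "\<And>x. x \<in> I \<Longrightarrow> A x \<in> carrier_mat n m"
  shows "msum n m I A * B = msum n k I (\<lambda>x. A x * B)"
proof (rule eq_matI)
  fix i j assume "i < dim_row (msum n k I (\<lambda>x. A x * B))" "j < dim_col (msum n k I (\<lambda>x. A x * B))"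
  then have ij: "i < n" "j < k" by (auto simp: msum_def)
  have "(msum n m I A * B) $$ (i, j) = (\<Sum>l<m. \<Sum>x\<in>I. A x $$ (i, l) * B $$ (l, j))"
    using ij assms by (subst mult_entry[of _ n m _ k]) (auto simp: sum_distrib_right)
  also have "\<dots> = (\<Sum>x\<in>I. (A x * B) $$ (i, j))"
    using ij assms by (subst sum.swap) (intro sum.cong refl mult_entry[of _ n m _ k, symmetric])
  finally show "(msum n m I A * B) $$ (i, j) = msum n k I (\<lambda>x. A x * B) $$ (i, j)"
    using ij by simp
qed (use assms in \<open>auto simp: msum_def\<close>)

lemma tr_msum:
  assumes "\<And>x. x \<in> I \<Longrightarrow> A x \<in> carrier_mat n n"
  shows "tr (msum n n I A) = (\<Sum>x\<in>I. tr (A x))"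
proof -
  have "tr (msum n n I A) = (\<Sum>i<n. \<Sum>x\<in>I. A x $$ (i, i))" by (subst tr_eq_sum[of _ n]) auto
  also have "\<dots> = (\<Sum>x\<in>I. \<Sum>i<n. A x $$ (i, i))" by (rule sum.swap)
  also have "\<dots> = (\<Sum>x\<in>I. tr (A x))" using assms by (intro sum.cong refl tr_eq_sum[symmetric])
  finally show ?thesis .
qed

lemma mat_eq_by_vec:
  assumes A: "A \<in> carrier_mat n m" and B: "B \<in> carrier_mat n m"
    and eq: "\<And>v. v \<in> carrier_vec m \<Longrightarrow> A *\<^sub>v v = B *\<^sub>v (v :: complex vec)"
  shows "A = B"
proof (rule eq_matI)
  fix i j assume "i < dim_row B" "j < dim_col B"
  then have ij: "i < n" "j < m" using B by auto
  have e: "(C *\<^sub>v unit_vec m j) $ i = C $$ (i, j)" if C: "C \<in> carrier_mat n m" for C :: "complex mat"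
  proof -
    have "(C *\<^sub>v unit_vec m j) $ i = (\<Sum>l<m. if l = j then C $$ (i, l) else 0)"
      using ij C by (subst mult_vec_entry[of _ n m]) (auto intro!: sum.cong simp del: sum.delta sum.delta')
    then show ?thesis using ij by simp
  qed
  show "A $$ (i, j) = B $$ (i, j)" using eq[of "unit_vec m j"] e[OF A] e[OF B] by simp
qed (use A B in auto)

lemma zero_mat_mult_vec: "v \<in> carrier_vec m \<Longrightarrow> 0\<^sub>m n m *\<^sub>v v = (0\<^sub>v n :: complex vec)"
  by (intro eq_vecI) auto

lemma mult_mat_vec_cong2:
  assumes "A \<in> carrier_mat n m" "B \<in> carrier_mat m k" "C \<in> carrier_mat n l" "D \<in> carrier_mat l k"
    "v \<in> carrier_vec k" "A * B = C * D"
  shows "A *\<^sub>v (B *\<^sub>v v) = C *\<^sub>v (D *\<^sub>v (v :: complex vec))"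
  using assms assoc_mult_mat_vec[of A n m B k v] assoc_mult_mat_vec[of C n l D k v] by simp

section \<open>Invariant subspaces and Schur's lemma\<close>

lemma representationD:
  assumes "representation G d \<rho>"
  shows "g \<in> carrier G \<Longrightarrow> \<rho> g \<in> carrier_mat d d" "\<rho> \<one>\<^bsub>G\<^esub> = 1\<^sub>m d"
    "g \<in> carrier G \<Longrightarrow> h \<in> carrier G \<Longrightarrow> \<rho> (g \<otimes>\<^bsub>G\<^esub> h) = \<rho> g * \<rho> h"
  using assms unfolding representation_def by auto

lemma irreducibleD:
  assumes "irreducible_representation G d \<rho>"
  shows "representation G d \<rho>" "d > 0"
  using assms unfolding irreducible_representation_def by auto

lemma irreducible_subspace:
  assumes "irreducible_representation G d \<rho>"
    and "W \<subseteq> carrier_vec d" "0\<^sub>v d \<in> W" "\<And>v w. v \<in> W \<Longrightarrow> w \<in> W \<Longrightarrow> v + w \<in> W"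
    and "\<And>c v. v \<in> W \<Longrightarrow> c \<cdot>\<^sub>v v \<in> W" "\<And>g v. g \<in> carrier G \<Longrightarrow> v \<in> W \<Longrightarrow> \<rho> g *\<^sub>v v \<in> W"
  shows "W = {0\<^sub>v d} \<or> W = carrier_vec d"
  by (rule assms(1)[unfolded irreducible_representation_def subspace_iff,
        THEN conjunct2, THEN conjunct2, THEN spec, THEN mp]) (use assms in simp)

text \<open>The kernel of \<open>T\<close> is an invariant subspace containing a nonzero vector.
  Invariance of the kernel is assumed in place of commutation, so that bilinear forms, which obey
  only a twisted commutation rule, are covered as well.\<close>

lemma irreducible_kernel:
  assumes irr: "irreducible_representation G d \<rho>" and T: "T \<in> carrier_mat m d"
    and inv: "\<And>g v. g \<in> carrier G \<Longrightarrow> v \<in> carrier_vec d \<Longrightarrow> T *\<^sub>v v = 0\<^sub>v m \<Longrightarrow> T *\<^sub>v (\<rho> g *\<^sub>v v) = 0\<^sub>v m"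
    and v: "v \<in> carrier_vec d" "v \<noteq> 0\<^sub>v d" "T *\<^sub>v v = 0\<^sub>v m"
  shows "T = 0\<^sub>m m d"
proof -
  note rep = representationD[OF irreducibleD(1)[OF irr]]
  define W where "W = {v \<in> carrier_vec d. T *\<^sub>v v = 0\<^sub>v m}"
  have "W = {0\<^sub>v d} \<or> W = carrier_vec d"
  proof (rule irreducible_subspace[OF irr])
    show "\<rho> g *\<^sub>v v \<in> W" if "g \<in> carrier G" "v \<in> W" for g v
      using that rep(1)[OF that(1)] inv unfolding W_def by auto
    show "v + w \<in> W" if "v \<in> W" "w \<in> W" for v w
      using that T unfolding W_def by (auto simp: mult_add_distrib_mat_vec[of _ m d])
    show "c \<cdot>\<^sub>v v \<in> W" if "v \<in> W" for c v
      using that T unfolding W_def by (auto simp: mult_mat_vec[of _ m d])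
  qed (use T in \<open>auto simp: W_def\<close>)
  moreover have "v \<in> W" using v unfolding W_def by simp
  ultimately have "W = carrier_vec d" using v by auto
  then have "T *\<^sub>v w = 0\<^sub>m m d *\<^sub>v w" if "w \<in> carrier_vec d" for w
  proof -
    have "w \<in> W" using that \<open>W = carrier_vec d\<close> by simp
    then show ?thesis using that unfolding W_def by (simp add: zero_mat_mult_vec)
  qed
  then show ?thesis using T by (intro mat_eq_by_vec[of _ m d]) auto
qed

text \<open>With \<open>B\<close> the identity this is used for eigenvectors in Schur's lemma, and
  with \<open>B\<close> an invariant form for a pencil of two forms.\<close>

lemma eigenvector_kernel:
  fixes A :: "complex mat"
  assumes "A \<in> carrier_mat n d" "B \<in> carrier_mat n d" "v \<in> carrier_vec d"
    "A *\<^sub>v v = c \<cdot>\<^sub>v (B *\<^sub>v v)"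
  shows "(A - c \<cdot>\<^sub>m B) *\<^sub>v v = 0\<^sub>v n"
proof (rule eq_vecI)
  fix i assume "i < dim_vec (0\<^sub>v n :: complex vec)"
  then have i: "i < n" by simp
  have "((A - c \<cdot>\<^sub>m B) *\<^sub>v v) $ i = (A *\<^sub>v v) $ i - c * (B *\<^sub>v v) $ i"
    using assms(1-3) i
    by (simp add: mult_vec_entry[of _ n d] sum_subtractf sum_distrib_left algebra_simps
        del: index_mult_mat_vec)
  then show "((A - c \<cdot>\<^sub>m B) *\<^sub>v v) $ i = 0\<^sub>v n $ i" using assms i by simp
qed (use assms in auto)

text \<open>A complex matrix has an eigenvalue \<open>c\<close>; subtracting \<open>c\<close> keeps
  the commutation and creates a nonzero kernel, which irreducibility enlarges to the whole
  space.\<close>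

lemma schur_scalar:
  assumes irr: "irreducible_representation G d \<rho>" and T: "T \<in> carrier_mat d d"
    and comm: "\<And>g. g \<in> carrier G \<Longrightarrow> T * \<rho> g = \<rho> g * T"
  obtains c where "T = c \<cdot>\<^sub>m 1\<^sub>m d"
proof -
  note rep = representationD[OF irreducibleD(1)[OF irr]]
  obtain c where "eigenvalue T c"
    using spectrum_non_empty[OF T irreducibleD(2)[OF irr]] unfolding spectrum_def by auto
  then obtain v where v: "v \<in> carrier_vec d" "v \<noteq> 0\<^sub>v d" "T *\<^sub>v v = c \<cdot>\<^sub>v v"
    unfolding eigenvalue_def eigenvector_def using T by auto
  let ?K = "T - c \<cdot>\<^sub>m 1\<^sub>m d"
  have K: "?K \<in> carrier_mat d d" using T by auto
  have Kcomm: "?K * \<rho> g = \<rho> g * ?K" if g: "g \<in> carrier G" for g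
    using T rep(1)[OF g] comm[OF g]
    by (simp add: minus_mult_distrib_mat[of _ d d] mult_minus_distrib_mat[of _ d d]
        mult_smult_assoc_mat[of _ d d] mult_smult_distrib[of _ d d _ d])
  have "?K = 0\<^sub>m d d"
  proof (rule irreducible_kernel[OF irr K])
    fix g v assume a: "g \<in> carrier G" "v \<in> carrier_vec d" "?K *\<^sub>v v = 0\<^sub>v d"
    have "?K *\<^sub>v (\<rho> g *\<^sub>v v) = (?K * \<rho> g) *\<^sub>v v"
      using K rep(1)[OF a(1)] a by (intro assoc_mult_mat_vec[symmetric]) auto
    also have "\<dots> = \<rho> g *\<^sub>v (?K *\<^sub>v v)"
      unfolding Kcomm[OF a(1)] using K rep(1)[OF a(1)] a by (intro assoc_mult_mat_vec) auto
    finally show "?K *\<^sub>v (\<rho> g *\<^sub>v v) = 0\<^sub>v d" using rep(1)[OF a(1)] a by auto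
  next
    show "?K *\<^sub>v v = 0\<^sub>v d" using T v by (intro eigenvector_kernel[of _ d d]) auto
  qed (use v in auto)
  have "T = c \<cdot>\<^sub>m 1\<^sub>m d"
  proof (rule eq_matI)
    fix i j assume "i < dim_row (c \<cdot>\<^sub>m 1\<^sub>m d)" "j < dim_col (c \<cdot>\<^sub>m 1\<^sub>m d)"
    then have ij: "i < d" "j < d" by auto
    have "?K $$ (i, j) = 0" unfolding \<open>?K = 0\<^sub>m d d\<close> using ij by simp
    then show "T $$ (i, j) = (c \<cdot>\<^sub>m 1\<^sub>m d) $$ (i, j)" using ij T by simp
  qed (use T in auto)
  with that show thesis .
qed

text \<open>Irreducibility of \<open>\<sigma>\<close> makes \<open>T\<close> injective and
  irreducibility of \<open>\<rho>\<close> makes it surjective, so \<open>T\<close> conjugates one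
  representation into the other.\<close>

lemma intertwiner_same_trace:
  assumes irr: "irreducible_representation G d \<rho>" and irr': "irreducible_representation G e \<sigma>"
    and T: "T \<in> carrier_mat d e" "T \<noteq> 0\<^sub>m d e"
    and int: "\<And>g. g \<in> carrier G \<Longrightarrow> T * \<sigma> g = \<rho> g * T" and g: "g \<in> carrier G"
  shows "tr (\<rho> g) = tr (\<sigma> g)"
proof -
  note rep = representationD[OF irreducibleD(1)[OF irr]]
  note rep' = representationD[OF irreducibleD(1)[OF irr']]
  have Tv: "T *\<^sub>v (\<sigma> g *\<^sub>v v) = \<rho> g *\<^sub>v (T *\<^sub>v v)" if "g \<in> carrier G" "v \<in> carrier_vec e" for g v
    using T rep(1)[OF that(1)] rep'(1)[OF that(1)] that int[OF that(1)]
    by (intro mult_mat_vec_cong2[of _ d e _ e _ d]) auto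
  have inj: "v = 0\<^sub>v e" if "v \<in> carrier_vec e" "T *\<^sub>v v = 0\<^sub>v d" for v
  proof (rule ccontr)
    assume "v \<noteq> 0\<^sub>v e"
    have "T = 0\<^sub>m d e"
    proof (rule irreducible_kernel[OF irr' T(1) _ that(1) \<open>v \<noteq> 0\<^sub>v e\<close> that(2)])
      fix g v assume g: "g \<in> carrier G" and "v \<in> carrier_vec e" "T *\<^sub>v v = 0\<^sub>v d"
      then show "T *\<^sub>v (\<sigma> g *\<^sub>v v) = 0\<^sub>v d" using Tv[OF g] rep(1)[OF g] by auto
    qed
    with T show False by simp
  qed
  define W where "W = (\<lambda>v. T *\<^sub>v v) ` carrier_vec e"
  have W: "W = {0\<^sub>v d} \<or> W = carrier_vec d"
  proof (rule irreducible_subspace[OF irr])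
    show "W \<subseteq> carrier_vec d" using T unfolding W_def by auto
    show "0\<^sub>v d \<in> W" unfolding W_def using T by (intro image_eqI[of _ _ "0\<^sub>v e"]) auto
    show "v + w \<in> W" if "v \<in> W" "w \<in> W" for v w
    proof -
      from that obtain a b where "a \<in> carrier_vec e" "b \<in> carrier_vec e" "v = T *\<^sub>v a" "w = T *\<^sub>v b"
        unfolding W_def by auto
      then show ?thesis unfolding W_def using T
        by (intro image_eqI[of _ _ "a + b"]) (auto simp: mult_add_distrib_mat_vec[of _ d e])
    qed
    show "c \<cdot>\<^sub>v v \<in> W" if "v \<in> W" for c v
    proof -
      from that obtain a where "a \<in> carrier_vec e" "v = T *\<^sub>v a"
        unfolding W_def by auto
      then show ?thesis unfolding W_def using T
        by (intro image_eqI[of _ _ "c \<cdot>\<^sub>v a"]) (auto simp: mult_mat_vec[of _ d e])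
    qed
    show "\<rho> g *\<^sub>v v \<in> W" if g: "g \<in> carrier G" and "v \<in> W" for g v
    proof -
      from that obtain a where "a \<in> carrier_vec e" "v = T *\<^sub>v a"
        unfolding W_def by auto
      then show ?thesis unfolding W_def using Tv[OF g] rep'(1)[OF g]
        by (intro image_eqI[of _ _ "\<sigma> g *\<^sub>v a"]) auto
    qed
  qed
  have "W \<noteq> {0\<^sub>v d}"
  proof
    assume "W = {0\<^sub>v d}"
    then have "T *\<^sub>v v = 0\<^sub>m d e *\<^sub>v v" if "v \<in> carrier_vec e" for v
      using that unfolding W_def by (auto simp: zero_mat_mult_vec)
    then have "T = 0\<^sub>m d e" using T(1) by (intro mat_eq_by_vec[of _ d e]) auto
    with T show False by simp
  qed
  with W have "\<forall>w\<in>carrier_vec d. \<exists>v\<in>carrier_vec e. T *\<^sub>v v = w" unfolding W_def by (metis imageE)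
  then have "\<forall>j. \<exists>v\<in>carrier_vec e. T *\<^sub>v v = unit_vec d j" by simp
  then obtain q where q: "\<And>j. q j \<in> carrier_vec e" "\<And>j. T *\<^sub>v q j = unit_vec d j" by metis
  \<comment> \<open>The columns are preimages of the unit vectors. Injectivity of \<open>T\<close>
    turns this right inverse into a two-sided one.\<close>
  define Q where "Q = mat e d (\<lambda>(i, j). q j $ i)"
  have Q: "Q \<in> carrier_mat e d" unfolding Q_def by simp
  have TQ: "T * Q = 1\<^sub>m d"
  proof (rule eq_matI)
    fix i j assume "i < dim_row (1\<^sub>m d :: complex mat)" "j < dim_col (1\<^sub>m d :: complex mat)"
    then have ij: "i < d" "j < d" by auto
    have "(T * Q) $$ (i, j) = (T *\<^sub>v q j) $ i"
      using ij by (subst mult_entry[OF T(1) Q], simp, simp, subst mult_vec_entry[OF T(1) q(1)])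
        (auto simp: Q_def)
    then show "(T * Q) $$ (i, j) = 1\<^sub>m d $$ (i, j)" using q ij by simp
  qed (use T Q in auto)
  have QT: "Q * T = 1\<^sub>m e"
  proof (rule mat_eq_by_vec[of _ e e])
    fix v :: "complex vec" assume v: "v \<in> carrier_vec e"
    have "T *\<^sub>v (Q * T *\<^sub>v v) = (T * Q) *\<^sub>v (T *\<^sub>v v)"
      using T Q v by (simp add: assoc_mult_mat_vec[of _ e d _ e] assoc_mult_mat_vec[of _ d e _ d])
    then have "T *\<^sub>v (Q * T *\<^sub>v v) = T *\<^sub>v v" unfolding TQ using T v by simp
    then have "T *\<^sub>v (Q * T *\<^sub>v v - v) = 0\<^sub>v d"
      using T Q v by (subst mult_minus_distrib_mat_vec[of _ d e]) auto
    moreover have "Q * T *\<^sub>v v - v \<in> carrier_vec e" using T Q v by auto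
    ultimately have z: "Q * T *\<^sub>v v - v = 0\<^sub>v e" using inj by blast
    show "Q * T *\<^sub>v v = 1\<^sub>m e *\<^sub>v v"
    proof (rule eq_vecI)
      fix i assume "i < dim_vec (1\<^sub>m e *\<^sub>v v)"
      then have i: "i < e" by simp
      have "(Q * T *\<^sub>v v - v) $ i = 0" unfolding z using i by simp
      then show "(Q * T *\<^sub>v v) $ i = (1\<^sub>m e *\<^sub>v v) $ i" using i v T Q by simp
    qed (use T Q in auto)
  qed (use T Q in auto)
  have "tr (\<rho> g) = tr (\<rho> g * (T * Q))" unfolding TQ using rep(1)[OF g] by simp
  also have "\<rho> g * (T * Q) = T * (\<sigma> g * Q)"
    using assoc_mult_mat[OF rep(1)[OF g] T(1) Q] assoc_mult_mat[OF T(1) rep'(1)[OF g] Q] int[OF g]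
    by simp
  also have "tr (T * (\<sigma> g * Q)) = tr (\<sigma> g * Q * T)"
    using T Q rep'(1)[OF g] by (intro tr_mult_commute) auto
  also have "\<sigma> g * Q * T = \<sigma> g * (Q * T)" using T Q rep'(1)[OF g] by (intro assoc_mult_mat) auto
  finally show ?thesis unfolding QT using rep'(1)[OF g] by simp
qed

section \<open>Orthogonality and the Frobenius-Schur indicator\<close>

definition unit_mat :: "nat \<Rightarrow> nat \<Rightarrow> nat \<Rightarrow> nat \<Rightarrow> complex mat" where
  "unit_mat n m k l = mat n m (\<lambda>(i, j). if i = k \<and> j = l then 1 else 0)"

lemma unit_mat_carrier [simp]: "unit_mat n m k l \<in> carrier_mat n m"
  by (simp add: unit_mat_def)

text \<open>Inserting a matrix unit turns a product of two matrix coefficients into one entry of a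
  matrix. Sums of products of characters thereby become entries of averages, to which Schur's lemma
  applies.\<close>

lemma mult_unit_mat_mult:
  assumes A: "A \<in> carrier_mat d n" and B: "B \<in> carrier_mat m e"
    and "k < n" "l < m" "i < d" "j < e"
  shows "(A * unit_mat n m k l * B) $$ (i, j) = A $$ (i, k) * B $$ (l, j)"
proof -
  have AU: "A * unit_mat n m k l \<in> carrier_mat d m" using A by simp
  have 1: "(A * unit_mat n m k l) $$ (i, b) = (if b = l then A $$ (i, k) else 0)" if "b < m" for b
  proof -
    have "(A * unit_mat n m k l) $$ (i, b) = (\<Sum>a<n. A $$ (i, a) * unit_mat n m k l $$ (a, b))"
      using assms that by (intro mult_entry[of _ d n _ m]) auto
    also have "\<dots> = (\<Sum>a<n. if a = k then (if b = l then A $$ (i, k) else 0) else 0)"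
      using that by (intro sum.cong refl) (auto simp: unit_mat_def)
    finally have "(A * unit_mat n m k l) $$ (i, b) = \<dots>" .
    then show ?thesis using assms by simp
  qed
  have "(A * unit_mat n m k l * B) $$ (i, j) = (\<Sum>b<m. (A * unit_mat n m k l) $$ (i, b) * B $$ (b, j))"
    using assms by (intro mult_entry[OF AU B])
  also have "\<dots> = (\<Sum>b<m. if b = l then A $$ (i, k) * B $$ (l, j) else 0)"
    by (intro sum.cong refl) (simp add: 1 del: index_mult_mat)
  finally have "(A * unit_mat n m k l * B) $$ (i, j) = \<dots>" .
  then show ?thesis using assms by simp
qed

lemma tr_unit_mat: "k < n \<Longrightarrow> l < n \<Longrightarrow> tr (unit_mat n n k l) = (if k = l then 1 else 0)"
  by (subst tr_eq_sum[of _ n]) (auto simp: unit_mat_def)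

lemma (in group) representation_inv:
  assumes "representation G d \<rho>" "g \<in> carrier G"
  shows "\<rho> (inv g) * \<rho> g = 1\<^sub>m d" "\<rho> g * \<rho> (inv g) = 1\<^sub>m d"
  using representationD[OF assms(1)] assms(2) by (metis inv_closed l_inv, metis inv_closed r_inv)

lemma (in group) inv_mult_left: "h \<in> carrier G \<Longrightarrow> a \<in> carrier G \<Longrightarrow> inv h \<otimes> (h \<otimes> a) = a"
  and mult_inv_left: "h \<in> carrier G \<Longrightarrow> a \<in> carrier G \<Longrightarrow> h \<otimes> (inv h \<otimes> a) = a"
  by (metis inv_closed l_inv l_one m_assoc, metis inv_closed r_inv l_one m_assoc)

lemma (in group) bij_betw_lmult: "h \<in> carrier G \<Longrightarrow> bij_betw (\<lambda>g. h \<otimes> g) (carrier G) (carrier G)"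
  by (rule bij_betw_byWitness[where f' = "\<lambda>g. inv h \<otimes> g"]) (auto simp: inv_mult_left mult_inv_left)

lemma (in group) bij_betw_rmult: "h \<in> carrier G \<Longrightarrow> bij_betw (\<lambda>g. g \<otimes> h) (carrier G) (carrier G)"
  by (rule bij_betw_byWitness[where f' = "\<lambda>g. g \<otimes> inv h"]) (auto simp: m_assoc)

lemma (in group) bij_betw_conj:
  "h \<in> carrier G \<Longrightarrow> bij_betw (\<lambda>g. h \<otimes> g \<otimes> inv h) (carrier G) (carrier G)"
  by (rule bij_betw_byWitness[where f' = "\<lambda>g. inv h \<otimes> g \<otimes> h"])
     (auto simp: m_assoc inv_mult_left mult_inv_left)

context group
begin

text \<open>Replacing the summation variable \<open>g\<close> by \<open>h \<otimes> g\<close> moves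
  \<open>\<rho> h\<close> out on the left and leaves \<open>\<sigma> (inv h)\<close> on the right,
  where it cancels \<open>\<sigma> h\<close>.\<close>

lemma average_intertwines:
  assumes rep: "representation G d \<rho>" and rep': "representation G e \<sigma>"
    and E: "E \<in> carrier_mat d e" and h: "h \<in> carrier G"
  defines "T \<equiv> msum d e (carrier G) (\<lambda>g. \<rho> g * E * \<sigma> (inv g))"
  shows "T * \<sigma> h = \<rho> h * T"
proof -
  note r = representationD[OF rep] and r' = representationD[OF rep']
  have c: "\<rho> g * E * \<sigma> (inv g) \<in> carrier_mat d e" if "g \<in> carrier G" for g
    using r(1)[OF that] r'(1)[of "inv g"] that E by auto
  have "T * \<sigma> h = msum d e (carrier G) (\<lambda>g. \<rho> g * E * \<sigma> (inv g) * \<sigma> h)"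
    unfolding T_def using r'(1)[OF h] c by (rule msum_mult)
  also have "\<dots> = msum d e (carrier G) (\<lambda>g. \<rho> (h \<otimes> g) * E * \<sigma> (inv (h \<otimes> g)) * \<sigma> h)"
    by (rule msum_reindex[OF bij_betw_lmult[OF h], symmetric])
  also have "\<dots> = msum d e (carrier G) (\<lambda>g. \<rho> h * (\<rho> g * E * \<sigma> (inv g)))"
  proof (rule msum_cong)
    fix g assume g: "g \<in> carrier G"
    have ig: "\<sigma> (inv g) \<in> carrier_mat e e" "\<sigma> (inv h) \<in> carrier_mat e e" using g h r'(1) by auto
    have "\<rho> (h \<otimes> g) * E * \<sigma> (inv (h \<otimes> g)) * \<sigma> h
        = \<rho> h * \<rho> g * E * (\<sigma> (inv g) * \<sigma> (inv h)) * \<sigma> h"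
      using g h r(3) r'(3) by (simp add: inv_mult_group)
    also have "\<dots> = \<rho> h * (\<rho> g * E * \<sigma> (inv g)) * (\<sigma> (inv h) * \<sigma> h)"
      using ig r(1)[OF g] r(1)[OF h] r'(1)[OF h] E
      by (simp add: assoc_mult_mat[of _ d d _ d _ e] assoc_mult_mat[of _ d d _ e _ e]
          assoc_mult_mat[of _ d e _ e _ e] assoc_mult_mat[of _ e e _ e _ e])
    also have "\<dots> = \<rho> h * (\<rho> g * E * \<sigma> (inv g))"
      unfolding representation_inv[OF rep' h] using ig r(1)[OF g] r(1)[OF h] E by simp
    finally show "\<rho> (h \<otimes> g) * E * \<sigma> (inv (h \<otimes> g)) * \<sigma> h = \<rho> h * (\<rho> g * E * \<sigma> (inv g))" .
  qed
  also have "\<dots> = \<rho> h * T" unfolding T_def using r(1)[OF h] c by (rule mult_msum[symmetric])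
  finally show ?thesis .
qed

lemma sum_tr_mult_tr:
  assumes rep: "representation G d \<rho>" and rep': "representation G e \<sigma>"
  shows "(\<Sum>g\<in>carrier G. tr (\<rho> g) * tr (\<sigma> (inv g))) =
    (\<Sum>i<d. \<Sum>l<e. msum d e (carrier G) (\<lambda>g. \<rho> g * unit_mat d e i l * \<sigma> (inv g)) $$ (i, l))"
proof -
  note r = representationD[OF rep] and r' = representationD[OF rep']
  have "(\<Sum>g\<in>carrier G. tr (\<rho> g) * tr (\<sigma> (inv g))) =
      (\<Sum>g\<in>carrier G. \<Sum>i<d. \<Sum>l<e. (\<rho> g * unit_mat d e i l * \<sigma> (inv g)) $$ (i, l))"
  proof (rule sum.cong[OF refl])
    fix g assume g: "g \<in> carrier G"
    have "tr (\<rho> g) * tr (\<sigma> (inv g)) = (\<Sum>i<d. \<rho> g $$ (i, i)) * (\<Sum>l<e. \<sigma> (inv g) $$ (l, l))"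
      using g r(1)[of g] r'(1)[of "inv g"] by (simp add: tr_eq_sum)
    also have "\<dots> = (\<Sum>i<d. \<Sum>l<e. (\<rho> g * unit_mat d e i l * \<sigma> (inv g)) $$ (i, l))"
      using g r(1) r'(1) unfolding sum_product
      by (intro sum.cong refl) (subst mult_unit_mat_mult, auto)
    finally show "tr (\<rho> g) * tr (\<sigma> (inv g)) =
      (\<Sum>i<d. \<Sum>l<e. (\<rho> g * unit_mat d e i l * \<sigma> (inv g)) $$ (i, l))" .
  qed
  also have "\<dots> = (\<Sum>i<d. \<Sum>g\<in>carrier G. \<Sum>l<e. (\<rho> g * unit_mat d e i l * \<sigma> (inv g)) $$ (i, l))"
    by (rule sum.swap)
  also have "\<dots> = (\<Sum>i<d. \<Sum>l<e. \<Sum>g\<in>carrier G. (\<rho> g * unit_mat d e i l * \<sigma> (inv g)) $$ (i, l))"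
    by (intro sum.cong refl sum.swap)
  finally show ?thesis by simp
qed

lemma orthogonality_different:
  assumes irr: "irreducible_representation G d \<rho>" and irr': "irreducible_representation G e \<sigma>"
    and h: "h \<in> carrier G" "tr (\<rho> h) \<noteq> tr (\<sigma> h)"
  shows "(\<Sum>g\<in>carrier G. tr (\<rho> g) * tr (\<sigma> (inv g))) = 0"
proof -
  have "msum d e (carrier G) (\<lambda>g. \<rho> g * unit_mat d e i l * \<sigma> (inv g)) = 0\<^sub>m d e" (is "?T = _") for i l
  proof (rule ccontr)
    assume "?T \<noteq> 0\<^sub>m d e"
    then have "tr (\<rho> h) = tr (\<sigma> h)"
      by (rule intertwiner_same_trace[OF irr irr' msum_carrier])
        (use average_intertwines[OF irreducibleD(1)[OF irr] irreducibleD(1)[OF irr']] h in auto)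
    with h show False by simp
  qed
  then show ?thesis
    unfolding sum_tr_mult_tr[OF irreducibleD(1)[OF irr] irreducibleD(1)[OF irr']] by simp
qed

text \<open>By Schur's lemma the average of the matrix unit with indices \<open>i\<close>,
  \<open>l\<close> is a scalar matrix. Each summand has the trace of the matrix unit itself, and
  this determines the scalar.\<close>

lemma orthogonality_same:
  assumes irr: "irreducible_representation G d \<rho>"
  shows "(\<Sum>g\<in>carrier G. tr (\<rho> g) * tr (\<rho> (inv g))) = of_nat (card (carrier G))"
proof -
  note rep = irreducibleD(1)[OF irr] and d = irreducibleD(2)[OF irr]
  note r = representationD[OF rep]
  let ?T = "\<lambda>i l. msum d d (carrier G) (\<lambda>g. \<rho> g * unit_mat d d i l * \<rho> (inv g))"
  have T: "?T i l $$ (i, l) = (if i = l then of_nat (card (carrier G)) / of_nat d else 0)"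
    if il: "i < d" "l < d" for i l
  proof -
    obtain c where c: "?T i l = c \<cdot>\<^sub>m 1\<^sub>m d"
      by (rule schur_scalar[OF irr, of "?T i l"])
        (use average_intertwines[OF rep rep] in auto)
    have "tr (?T i l) = (\<Sum>g\<in>carrier G. tr (\<rho> g * unit_mat d d i l * \<rho> (inv g)))"
      using r(1) by (intro tr_msum mult_carrier_mat[of _ d d]) auto
    also have "\<dots> = (\<Sum>g\<in>carrier G. if i = l then 1 else 0)"
    proof (rule sum.cong[OF refl])
      fix g assume g: "g \<in> carrier G"
      have "tr (\<rho> g * unit_mat d d i l * \<rho> (inv g)) = tr (\<rho> (inv g) * (\<rho> g * unit_mat d d i l))"
        using r(1)[OF g] r(1)[of "inv g"] g by (intro tr_mult_commute[of _ d d] mult_carrier_mat[of _ d d]) auto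
      also have "\<rho> (inv g) * (\<rho> g * unit_mat d d i l) = \<rho> (inv g) * \<rho> g * unit_mat d d i l"
        using r(1)[OF g] r(1)[of "inv g"] g by (intro assoc_mult_mat[symmetric, of _ d d _ d _ d]) auto
      finally show "tr (\<rho> g * unit_mat d d i l * \<rho> (inv g)) = (if i = l then 1 else 0)"
        using il by (simp add: representation_inv[OF rep g] tr_unit_mat left_mult_one_mat[OF unit_mat_carrier])
    qed
    also have "tr (?T i l) = of_nat d * c"
      unfolding c by (subst tr_eq_sum[of _ d]) auto
    finally have "of_nat d * c = (if i = l then of_nat (card (carrier G)) else 0)" by auto
    then have "c = (if i = l then of_nat (card (carrier G)) / of_nat d else 0)"
      using d by (auto simp: field_simps split: if_splits)
    then show ?thesis unfolding c using il by auto
  qed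
  have "(\<Sum>g\<in>carrier G. tr (\<rho> g) * tr (\<rho> (inv g))) = (\<Sum>i<d. \<Sum>l<d. ?T i l $$ (i, l))"
    by (rule sum_tr_mult_tr[OF rep rep])
  also have "\<dots> = (\<Sum>i<d. \<Sum>l<d. if i = l then of_nat (card (carrier G)) / of_nat d else 0)"
    by (intro sum.cong refl) (subst T, auto)
  also have "\<dots> = of_nat (card (carrier G))" using d by simp
  finally show ?thesis .
qed

text \<open>Schur's lemma for bilinear forms. An invariant form \<open>M\<close> satisfies
  \<open>M * \<rho> h = transpose_mat (\<rho> (inv h)) * M\<close>, so its kernel is an invariant
  subspace. Hence \<open>J\<close> has an inverse \<open>L\<close>, and for an eigenvalue
  \<open>c\<close> of \<open>L * K\<close> the invariant form \<open>K - c \<cdot>\<^sub>m J\<close>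
  is degenerate and therefore zero.\<close>

lemma invariant_form_unique:
  assumes irr: "irreducible_representation G d \<rho>"
    and J: "J \<in> carrier_mat d d" "J \<noteq> 0\<^sub>m d d" and K: "K \<in> carrier_mat d d"
    and invJ: "\<And>g. g \<in> carrier G \<Longrightarrow> transpose_mat (\<rho> g) * J * \<rho> g = J"
    and invK: "\<And>g. g \<in> carrier G \<Longrightarrow> transpose_mat (\<rho> g) * K * \<rho> g = K"
  obtains c where "K = c \<cdot>\<^sub>m J"
proof -
  note rep = irreducibleD(1)[OF irr]
  note r = representationD[OF rep]
  have comm: "M * \<rho> h = transpose_mat (\<rho> (inv h)) * M"
    if M: "M \<in> carrier_mat d d" "\<And>g. g \<in> carrier G \<Longrightarrow> transpose_mat (\<rho> g) * M * \<rho> g = M"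
      and h: "h \<in> carrier G" for M h
  proof -
    have c: "\<rho> h \<in> carrier_mat d d" "\<rho> (inv h) \<in> carrier_mat d d" using h r(1) by auto
    have "M * \<rho> h = transpose_mat (\<rho> (inv h)) * M * \<rho> (inv h) * \<rho> h"
      using M(2)[of "inv h"] h by simp
    also have "\<dots> = transpose_mat (\<rho> (inv h)) * M * (\<rho> (inv h) * \<rho> h)"
      using c M by (intro assoc_mult_mat[of _ d d _ d _ d]) auto
    finally show ?thesis unfolding representation_inv[OF rep h] using c M by simp
  qed
  have ker: "M *\<^sub>v (\<rho> g *\<^sub>v v) = 0\<^sub>v d"
    if M: "M \<in> carrier_mat d d" and cm: "\<And>h. h \<in> carrier G \<Longrightarrow> M * \<rho> h = transpose_mat (\<rho> (inv h)) * M"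
      and g: "g \<in> carrier G" and v: "v \<in> carrier_vec d" "M *\<^sub>v v = 0\<^sub>v d" for M g v
  proof -
    have "M *\<^sub>v (\<rho> g *\<^sub>v v) = transpose_mat (\<rho> (inv g)) *\<^sub>v (M *\<^sub>v v)"
      using M g v r(1)[of g] r(1)[of "inv g"] cm[OF g] by (intro mult_mat_vec_cong2[of _ d d _ d _ d]) auto
    then show ?thesis using v r(1)[of "inv g"] g by auto
  qed
  have "det J \<noteq> 0"
  proof
    assume "det J = 0"
    then obtain v where v: "v \<in> carrier_vec d" "v \<noteq> 0\<^sub>v d" "J *\<^sub>v v = 0\<^sub>v d"
      using det_0_iff_vec_prod_zero[OF J(1)] by auto
    have "J = 0\<^sub>m d d"
      by (rule irreducible_kernel[OF irr J(1) _ v]) (rule ker[OF J(1) comm[OF J(1) invJ]])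
    with J show False by simp
  qed
  from det_non_zero_imp_unit[OF J(1) this] obtain L where L: "L \<in> carrier_mat d d" "J * L = 1\<^sub>m d"
    unfolding Units_def by (auto simp: ring_mat_simps)
  obtain c where "eigenvalue (L * K) c"
    using spectrum_non_empty[of "L * K" d] L K irreducibleD(2)[OF irr] unfolding spectrum_def by auto
  then obtain v where v: "v \<in> carrier_vec d" "v \<noteq> 0\<^sub>v d" "(L * K) *\<^sub>v v = c \<cdot>\<^sub>v v"
    unfolding eigenvalue_def eigenvector_def using L K by auto
  have "K *\<^sub>v v = J *\<^sub>v ((L * K) *\<^sub>v v)"
  proof -
    have "J *\<^sub>v ((L * K) *\<^sub>v v) = (J * (L * K)) *\<^sub>v v" using J L K v by (intro assoc_mult_mat_vec[symmetric]) auto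
    also have "J * (L * K) = J * L * K" using J L K by (intro assoc_mult_mat[symmetric]) auto
    finally show ?thesis using K L by simp
  qed
  then have Kv: "K *\<^sub>v v = c \<cdot>\<^sub>v (J *\<^sub>v v)" unfolding v(3) using J v by (simp add: mult_mat_vec[of _ d d])
  let ?D = "K - c \<cdot>\<^sub>m J"
  have D: "?D \<in> carrier_mat d d" using J by auto
  have "?D = 0\<^sub>m d d"
  proof (rule irreducible_kernel[OF irr D _ v(1,2) eigenvector_kernel[OF K J(1) v(1) Kv]], rule ker[OF D])
    fix h assume h: "h \<in> carrier G"
    then have c: "\<rho> h \<in> carrier_mat d d" "\<rho> (inv h) \<in> carrier_mat d d" using r(1) by auto
    show "?D * \<rho> h = transpose_mat (\<rho> (inv h)) * ?D"
      using c J K comm[OF J(1) invJ h] comm[OF K invK h]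
      by (simp add: minus_mult_distrib_mat[of _ d d] mult_minus_distrib_mat[of _ d d]
          mult_smult_assoc_mat[of _ d d] mult_smult_distrib[of _ d d _ d])
  qed
  have "K = c \<cdot>\<^sub>m J"
  proof (rule eq_matI)
    fix i j assume "i < dim_row (c \<cdot>\<^sub>m J)" "j < dim_col (c \<cdot>\<^sub>m J)"
    then have ij: "i < d" "j < d" using J by auto
    have "?D $$ (i, j) = 0" unfolding \<open>?D = 0\<^sub>m d d\<close> using ij by simp
    then show "K $$ (i, j) = (c \<cdot>\<^sub>m J) $$ (i, j)" using ij K J by simp
  qed (use K J in auto)
  with that show thesis .
qed

lemma average_form_invariant:
  assumes rep: "representation G d \<rho>" and M: "M \<in> carrier_mat d d" and h: "h \<in> carrier G"
  defines "B \<equiv> msum d d (carrier G) (\<lambda>g. transpose_mat (\<rho> g) * M * \<rho> g)"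
  shows "transpose_mat (\<rho> h) * B * \<rho> h = B"
proof -
  note r = representationD[OF rep]
  have c: "transpose_mat (\<rho> g) * M * \<rho> g \<in> carrier_mat d d" if "g \<in> carrier G" for g
    using r(1)[OF that] M by auto
  have th: "transpose_mat (\<rho> h) \<in> carrier_mat d d" using r(1)[OF h] by auto
  have "transpose_mat (\<rho> h) * B * \<rho> h
      = msum d d (carrier G) (\<lambda>g. transpose_mat (\<rho> h) * (transpose_mat (\<rho> g) * M * \<rho> g)) * \<rho> h"
    unfolding B_def by (subst mult_msum[OF th c]) auto
  also have "\<dots> = msum d d (carrier G) (\<lambda>g. transpose_mat (\<rho> h) * (transpose_mat (\<rho> g) * M * \<rho> g) * \<rho> h)"
    using c th by (intro msum_mult[OF r(1)[OF h]]) auto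
  also have "\<dots> = msum d d (carrier G) (\<lambda>g. transpose_mat (\<rho> (g \<otimes> h)) * M * \<rho> (g \<otimes> h))"
  proof (rule msum_cong)
    fix g assume g: "g \<in> carrier G"
    show "transpose_mat (\<rho> h) * (transpose_mat (\<rho> g) * M * \<rho> g) * \<rho> h =
        transpose_mat (\<rho> (g \<otimes> h)) * M * \<rho> (g \<otimes> h)"
      using r(1)[OF g] r(1)[OF h] M g h
      by (simp add: r(3) transpose_mult[of _ d d] assoc_mult_mat[of _ d d _ d _ d])
  qed
  also have "\<dots> = B" unfolding B_def by (rule msum_reindex[OF bij_betw_rmult[OF h]])
  finally show ?thesis .
qed

text \<open>The sum of the squared traces and the sum of the traces of squares both add entries of
  the averaged forms \<open>B k l\<close>, taken at \<open>(k, l)\<close> in the first case and at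
  \<open>(l, k)\<close> in the second. All these forms are multiples of one form \<open>J\<close>,
  and transposing \<open>J\<close> multiplies it by some \<open>c\<close> with
  \<open>c * c = 1\<close>, so the two sums differ by the factor \<open>c\<close>. Reality of the
  character identifies the first sum with the group order.\<close>

lemma frobenius_schur_real:
  assumes irr: "irreducible_representation G d \<rho>" and fin: "finite (carrier G)"
    and real: "\<And>g. g \<in> carrier G \<Longrightarrow> tr (\<rho> (inv g)) = tr (\<rho> g)"
  obtains "(\<Sum>g\<in>carrier G. tr (\<rho> (g \<otimes> g))) = of_nat (card (carrier G))"
  | "(\<Sum>g\<in>carrier G. tr (\<rho> (g \<otimes> g))) = - of_nat (card (carrier G))"
proof -
  note rep = irreducibleD(1)[OF irr]
  note r = representationD[OF rep]
  define N where "N = (of_nat (card (carrier G)) :: complex)"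
  have N: "N \<noteq> 0" unfolding N_def using fin one_closed by auto
  define B where "B k l = msum d d (carrier G) (\<lambda>g. transpose_mat (\<rho> g) * unit_mat d d k l * \<rho> g)" for k l
  have B: "B k l \<in> carrier_mat d d" for k l unfolding B_def by simp
  have Binv: "transpose_mat (\<rho> g) * B k l * \<rho> g = B k l" if "g \<in> carrier G" for g k l
    unfolding B_def by (rule average_form_invariant[OF rep unit_mat_carrier that])
  have Bij: "B k l $$ (i, j) = (\<Sum>g\<in>carrier G. \<rho> g $$ (k, i) * \<rho> g $$ (l, j))"
    if "k < d" "l < d" "i < d" "j < d" for k l i j
  proof -
    have "(transpose_mat (\<rho> g) * unit_mat d d k l * \<rho> g) $$ (i, j) = \<rho> g $$ (k, i) * \<rho> g $$ (l, j)"
      if g: "g \<in> carrier G" for g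
      using r(1)[OF g] \<open>k < d\<close> \<open>l < d\<close> \<open>i < d\<close> \<open>j < d\<close>
      by (subst mult_unit_mat_mult[of _ d d _ d d]) auto
    then show ?thesis unfolding B_def using that by simp
  qed
  have "N = (\<Sum>g\<in>carrier G. tr (\<rho> g) * tr (\<rho> g))"
    unfolding N_def orthogonality_same[OF irr, symmetric] using real by (intro sum.cong refl) simp
  also have "\<dots> = (\<Sum>g\<in>carrier G. \<Sum>k<d. \<Sum>l<d. \<rho> g $$ (k, k) * \<rho> g $$ (l, l))"
    by (intro sum.cong refl) (simp add: tr_eq_sum[OF r(1)] sum_product)
  also have "\<dots> = (\<Sum>k<d. \<Sum>l<d. \<Sum>g\<in>carrier G. \<rho> g $$ (k, k) * \<rho> g $$ (l, l))"
    by (subst sum.swap, intro sum.cong refl, rule sum.swap)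
  finally have N_eq: "N = (\<Sum>k<d. \<Sum>l<d. B k l $$ (k, l))"
    by (simp add: Bij)
  have "(\<Sum>g\<in>carrier G. tr (\<rho> (g \<otimes> g))) = (\<Sum>g\<in>carrier G. \<Sum>k<d. \<Sum>l<d. \<rho> g $$ (k, l) * \<rho> g $$ (l, k))"
  proof (rule sum.cong[OF refl])
    fix g assume g: "g \<in> carrier G"
    have "tr (\<rho> (g \<otimes> g)) = (\<Sum>k<d. (\<rho> g * \<rho> g) $$ (k, k))"
      using g r(1)[OF g] by (simp add: r(3)) (subst tr_eq_sum[of _ d], auto)
    then show "tr (\<rho> (g \<otimes> g)) = (\<Sum>k<d. \<Sum>l<d. \<rho> g $$ (k, l) * \<rho> g $$ (l, k))"
      using r(1)[OF g] by (simp add: mult_entry[of _ d d _ d] del: index_mult_mat)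
  qed
  also have "\<dots> = (\<Sum>k<d. \<Sum>l<d. \<Sum>g\<in>carrier G. \<rho> g $$ (k, l) * \<rho> g $$ (l, k))"
    by (subst sum.swap, intro sum.cong refl, rule sum.swap)
  finally have S_eq: "(\<Sum>g\<in>carrier G. tr (\<rho> (g \<otimes> g))) = (\<Sum>k<d. \<Sum>l<d. B k l $$ (l, k))"
    by (simp add: Bij)
  \<comment> \<open>The entries in \<open>N_eq\<close> add up to the group order, so one of them is
    nonzero; its form is the reference form \<open>J\<close>.\<close>
  from N N_eq obtain k0 l0 where kl: "k0 < d" "l0 < d" "B k0 l0 $$ (k0, l0) \<noteq> 0"
    by (metis (no_types, lifting) lessThan_iff sum.neutral)
  define J where "J = B k0 l0"
  have J: "J \<in> carrier_mat d d" "J \<noteq> 0\<^sub>m d d" using kl B unfolding J_def by auto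
  have Jinv: "transpose_mat (\<rho> g) * J * \<rho> g = J" if "g \<in> carrier G" for g
    unfolding J_def by (rule Binv[OF that])
  have "\<exists>c. B k l = c \<cdot>\<^sub>m J" for k l
    by (rule invariant_form_unique[OF irr J B[of k l] Jinv Binv]) auto
  then obtain b where b: "\<And>k l. B k l = b k l \<cdot>\<^sub>m J" by metis
  have "transpose_mat (\<rho> g) * transpose_mat J * \<rho> g = transpose_mat J" if g: "g \<in> carrier G" for g
  proof -
    have "transpose_mat J = transpose_mat (transpose_mat (\<rho> g) * J * \<rho> g)" using Jinv[OF g] by simp
    also have "\<dots> = transpose_mat (\<rho> g) * (transpose_mat J * \<rho> g)"
      using r(1)[OF g] J by (simp add: transpose_mult[of _ d d _ d])
    finally show ?thesis using r(1)[OF g] J by (simp add: assoc_mult_mat[of _ d d _ d _ d])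
  qed
  then obtain c where c: "transpose_mat J = c \<cdot>\<^sub>m J"
    using invariant_form_unique[OF irr J, of "transpose_mat J"] J Jinv by auto
  have Jt: "J $$ (l, k) = c * J $$ (k, l)" if "k < d" "l < d" for k l
    using arg_cong[OF c, of "\<lambda>M. M $$ (k, l)"] J that by auto
  have "(\<Sum>k<d. \<Sum>l<d. B k l $$ (l, k)) = (\<Sum>k<d. \<Sum>l<d. c * B k l $$ (k, l))"
  proof (intro sum.cong refl)
    fix k l assume "k \<in> {..<d}" "l \<in> {..<d}"
    then show "B k l $$ (l, k) = c * B k l $$ (k, l)"
      unfolding b using J Jt[of k l] by simp
  qed
  then have S: "(\<Sum>g\<in>carrier G. tr (\<rho> (g \<otimes> g))) = c * N"
    unfolding S_eq N_eq by (simp add: sum_distrib_left)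
  have "J $$ (k0, l0) = c * (c * J $$ (k0, l0))"
    using Jt[OF kl(1,2)] Jt[OF kl(2,1)] by simp
  then have "c * c = 1" using kl unfolding J_def by auto
  then have "c = 1 \<or> c = - 1" by (simp add: square_eq_1_iff)
  with S that show thesis unfolding N_def by auto
qed

end

section \<open>Characters and square roots\<close>

context group
begin

lemma class_function_sum_commutes:
  assumes rep: "representation G d \<rho>" and h: "h \<in> carrier G"
    and cls: "\<And>g h. g \<in> carrier G \<Longrightarrow> h \<in> carrier G \<Longrightarrow> f (h \<otimes> g \<otimes> inv h) = f g"
  defines "M \<equiv> msum d d (carrier G) (\<lambda>g. f g \<cdot>\<^sub>m \<rho> g)"
  shows "M * \<rho> h = \<rho> h * M"
proof -
  note r = representationD[OF rep]
  have "M * \<rho> h = msum d d (carrier G) (\<lambda>g. f g \<cdot>\<^sub>m \<rho> g * \<rho> h)"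
    unfolding M_def using r(1)[OF h] r(1) by (intro msum_mult) auto
  also have "\<dots> = msum d d (carrier G) (\<lambda>g. f (h \<otimes> g \<otimes> inv h) \<cdot>\<^sub>m \<rho> (h \<otimes> g \<otimes> inv h) * \<rho> h)"
    by (rule msum_reindex[OF bij_betw_conj[OF h], symmetric])
  also have "\<dots> = msum d d (carrier G) (\<lambda>g. \<rho> h * (f g \<cdot>\<^sub>m \<rho> g))"
  proof (rule msum_cong)
    fix g assume g: "g \<in> carrier G"
    have c: "\<rho> g \<in> carrier_mat d d" "\<rho> h \<in> carrier_mat d d" "\<rho> (inv h) \<in> carrier_mat d d"
      using g h r(1) by auto
    have "\<rho> (h \<otimes> g \<otimes> inv h) * \<rho> h = \<rho> (h \<otimes> g \<otimes> inv h \<otimes> h)"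
      using g h by (intro r(3)[symmetric]) auto
    also have "h \<otimes> g \<otimes> inv h \<otimes> h = h \<otimes> g" using g h by (simp add: m_assoc)
    finally have "\<rho> (h \<otimes> g \<otimes> inv h) * \<rho> h = \<rho> h * \<rho> g" using g h r(3) by simp
    moreover have "\<rho> (h \<otimes> g \<otimes> inv h) \<in> carrier_mat d d" using g h r(1) by auto
    ultimately show "f (h \<otimes> g \<otimes> inv h) \<cdot>\<^sub>m \<rho> (h \<otimes> g \<otimes> inv h) * \<rho> h = \<rho> h * (f g \<cdot>\<^sub>m \<rho> g)"
      using c cls[OF g h] by (simp add: mult_smult_assoc_mat[of _ d d] mult_smult_distrib[of _ d d _ d])
  qed
  also have "\<dots> = \<rho> h * M"
    unfolding M_def using r(1)[OF h] r(1) by (intro mult_msum[symmetric]) auto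
  finally show ?thesis .
qed

text \<open>The columns of \<open>Q\<close> span an invariant subspace and \<open>L\<close> reads
  off coordinates in it. The rule \<open>\<rho> g * Q = Q * (L * \<rho> g * Q)\<close> is what makes
  the compressed matrices multiplicative.\<close>

lemma subrepresentation:
  assumes rep: "representation G n \<rho>" and Q: "Q \<in> carrier_mat n k" and L: "L \<in> carrier_mat k n"
    and LQ: "L * Q = 1\<^sub>m k"
    and inv: "\<And>g v. g \<in> carrier G \<Longrightarrow> v \<in> carrier_vec k \<Longrightarrow> \<exists>w\<in>carrier_vec k. \<rho> g *\<^sub>v (Q *\<^sub>v v) = Q *\<^sub>v w"
  shows "representation G k (\<lambda>g. L * \<rho> g * Q)"
    "\<And>g. g \<in> carrier G \<Longrightarrow> \<rho> g * Q = Q * (L * \<rho> g * Q)"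
proof -
  note r = representationD[OF rep]
  have *: "\<rho> g * Q = Q * (L * \<rho> g * Q)" if g: "g \<in> carrier G" for g
  proof (rule mat_eq_by_vec[of _ n k])
    fix v :: "complex vec" assume v: "v \<in> carrier_vec k"
    obtain w where w: "w \<in> carrier_vec k" "\<rho> g *\<^sub>v (Q *\<^sub>v v) = Q *\<^sub>v w" using inv[OF g v] by blast
    have rQ: "\<rho> g * Q *\<^sub>v v = Q *\<^sub>v w" using w assoc_mult_mat_vec[OF r(1)[OF g] Q v] by simp
    have "Q * (L * \<rho> g * Q) *\<^sub>v v = Q *\<^sub>v (L * \<rho> g * Q *\<^sub>v v)"
      using Q L r(1)[OF g] v by (intro assoc_mult_mat_vec) auto
    also have "L * \<rho> g * Q = L * (\<rho> g * Q)" using assoc_mult_mat[OF L r(1)[OF g] Q] by simp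
    also have "L * (\<rho> g * Q) *\<^sub>v v = L *\<^sub>v (\<rho> g * Q *\<^sub>v v)"
      using Q L r(1)[OF g] v by (intro assoc_mult_mat_vec) auto
    also have "\<dots> = L * Q *\<^sub>v w" unfolding rQ using L Q w by (intro assoc_mult_mat_vec[symmetric]) auto
    finally have "Q * (L * (\<rho> g * Q)) *\<^sub>v v = Q *\<^sub>v w" unfolding LQ using w by simp
    then show "\<rho> g * Q *\<^sub>v v = Q * (L * \<rho> g * Q) *\<^sub>v v"
      using rQ assoc_mult_mat[OF L r(1)[OF g] Q] by simp
  qed (use r(1)[OF g] Q L in auto)
  then show "\<And>g. g \<in> carrier G \<Longrightarrow> \<rho> g * Q = Q * (L * \<rho> g * Q)" .
  show "representation G k (\<lambda>g. L * \<rho> g * Q)"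
    unfolding representation_def
  proof (intro conjI ballI)
    show "L * \<rho> g * Q \<in> carrier_mat k k" if "g \<in> carrier G" for g using r(1)[OF that] L Q by auto
    show "L * \<rho> \<one> * Q = 1\<^sub>m k" unfolding r(2) using L Q LQ by simp
    fix g h assume g: "g \<in> carrier G" and h: "h \<in> carrier G"
    have "L * \<rho> (g \<otimes> h) * Q = L * \<rho> g * (\<rho> h * Q)"
      using r(1)[OF g] r(1)[OF h] L Q
      by (simp add: r(3)[OF g h] assoc_mult_mat[of _ k n _ n _ k] assoc_mult_mat[of _ n n _ n _ k]
          assoc_mult_mat[of _ k n _ n _ n])
    also have "\<dots> = L * \<rho> g * (Q * (L * \<rho> h * Q))" using *[OF h] by simp
    also have "\<dots> = L * \<rho> g * Q * (L * \<rho> h * Q)"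
      using r(1)[OF g] r(1)[OF h] L Q by (intro assoc_mult_mat[symmetric]) auto
    finally show "L * \<rho> (g \<otimes> h) * Q = L * \<rho> g * Q * (L * \<rho> h * Q)" .
  qed
qed

text \<open>An eigenspace of a matrix commuting with the group is invariant, and an invariant
  subspace of least positive dimension inside it is irreducible. This provides an irreducible
  constituent together with control of \<open>E\<close> on it.\<close>

lemma irreducible_in_eigenspace:
  assumes rep: "representation G n \<rho>" and E: "E \<in> carrier_mat n n"
    and comm: "\<And>g. g \<in> carrier G \<Longrightarrow> E * \<rho> g = \<rho> g * E"
    and v: "v \<in> carrier_vec n" "v \<noteq> 0\<^sub>v n" "E *\<^sub>v v = c \<cdot>\<^sub>v v"
  obtains d \<sigma> P L where "irreducible_representation G d \<sigma>" "P \<in> carrier_mat n d" "L \<in> carrier_mat d n"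
    "L * P = 1\<^sub>m d" "\<And>g. g \<in> carrier G \<Longrightarrow> \<rho> g * P = P * \<sigma> g" "E * P = c \<cdot>\<^sub>m P"
proof -
  note r = representationD[OF rep]
  define good where "good d \<longleftrightarrow> d > 0 \<and> (\<exists>\<sigma> P L. representation G d \<sigma> \<and> P \<in> carrier_mat n d \<and>
    L \<in> carrier_mat d n \<and> L * P = 1\<^sub>m d \<and> (\<forall>g\<in>carrier G. \<rho> g * P = P * \<sigma> g) \<and> E * P = c \<cdot>\<^sub>m P)" for d
  have ex: "\<exists>d. good d"
  proof -
    define W where "W = {w \<in> carrier_vec n. E *\<^sub>v w = c \<cdot>\<^sub>v w}"
    have "VectorSpace.subspace class_ring W (module_vec TYPE(complex) n)"
      unfolding subspace_iff W_def using E
      by (auto simp: mult_add_distrib_mat_vec[of _ n n] mult_mat_vec[of _ n n] smult_add_distrib_vec[of _ n]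
          smult_smult_assoc mult.commute zero_mat_mult_vec intro!: eq_vecI)
    then obtain k Q L where Q: "Q \<in> carrier_mat n k" and L: "L \<in> carrier_mat k n" and LQ: "L * Q = 1\<^sub>m k"
      and W: "W = (\<lambda>v. Q *\<^sub>v v) ` carrier_vec k" by (rule matrix_basis)
    have inv: "\<exists>w\<in>carrier_vec k. \<rho> g *\<^sub>v (Q *\<^sub>v v) = Q *\<^sub>v w" if g: "g \<in> carrier G" and "v \<in> carrier_vec k" for g v
    proof -
      have w: "Q *\<^sub>v v \<in> carrier_vec n" "E *\<^sub>v (Q *\<^sub>v v) = c \<cdot>\<^sub>v (Q *\<^sub>v v)"
        using that W unfolding W_def by blast+
      have "E *\<^sub>v (\<rho> g *\<^sub>v (Q *\<^sub>v v)) = \<rho> g *\<^sub>v (E *\<^sub>v (Q *\<^sub>v v))"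
        using E r(1)[OF g] w comm[OF g] by (intro mult_mat_vec_cong2[of _ n n _ n _ n]) auto
      also have "\<dots> = c \<cdot>\<^sub>v (\<rho> g *\<^sub>v (Q *\<^sub>v v))"
        unfolding w(2) using r(1)[OF g] w(1) by (rule mult_mat_vec)
      finally have "\<rho> g *\<^sub>v (Q *\<^sub>v v) \<in> W" unfolding W_def using r(1)[OF g] w by auto
      then show ?thesis unfolding W by blast
    qed
    have "k > 0"
    proof (rule ccontr)
      assume "\<not> k > 0"
      then have "Q *\<^sub>v u = 0\<^sub>v n" if "u \<in> carrier_vec k" for u
        using that Q by (intro eq_vecI) (auto simp: scalar_prod_def)
      moreover have "v \<in> W" using v unfolding W_def by simp
      ultimately show False using v(2) W by auto
    qed
    moreover have "E * Q = c \<cdot>\<^sub>m Q"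
    proof (rule mat_eq_by_vec[of _ n k])
      fix u :: "complex vec" assume u: "u \<in> carrier_vec k"
      have "E *\<^sub>v (Q *\<^sub>v u) = c \<cdot>\<^sub>v (Q *\<^sub>v u)"
        using u W unfolding W_def by blast
      moreover have "(c \<cdot>\<^sub>m Q) *\<^sub>v u = c \<cdot>\<^sub>v (Q *\<^sub>v u)" using Q u
        by (intro eq_vecI) (auto simp: mult_vec_entry[of _ n k] sum_distrib_left mult.assoc simp del: index_mult_mat_vec)
      ultimately show "E * Q *\<^sub>v u = c \<cdot>\<^sub>m Q *\<^sub>v u" using assoc_mult_mat_vec[OF E Q u] by simp
    qed (use E Q in auto)
    ultimately have "good k" unfolding good_def
      using subrepresentation[OF rep Q L LQ inv] Q L LQ by blast
    then show ?thesis by blast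
  qed
  define d where "d = (LEAST d. good d)"
  have gd: "good d" and min: "\<And>k. good k \<Longrightarrow> d \<le> k"
    unfolding d_def using LeastI_ex[OF ex] Least_le by auto
  from gd obtain \<sigma> P L where d: "d > 0" and s: "representation G d \<sigma>" and P: "P \<in> carrier_mat n d"
    and L: "L \<in> carrier_mat d n" and LP: "L * P = 1\<^sub>m d"
    and rP: "\<And>g. g \<in> carrier G \<Longrightarrow> \<rho> g * P = P * \<sigma> g" and EP: "E * P = c \<cdot>\<^sub>m P"
    unfolding good_def by blast
  note s' = representationD[OF s]
  have "irreducible_representation G d \<sigma>"
    unfolding irreducible_representation_def
  proof (intro conjI allI impI s d)
    fix W assume a: "VectorSpace.subspace class_ring W (module_vec TYPE(complex) d) \<and>
      (\<forall>g\<in>carrier G. \<forall>v\<in>W. \<sigma> g *\<^sub>v v \<in> W)"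
    obtain k Q M where Q: "Q \<in> carrier_mat d k" and M: "M \<in> carrier_mat k d" and MQ: "M * Q = 1\<^sub>m k"
      and W: "W = (\<lambda>v. Q *\<^sub>v v) ` carrier_vec k" by (rule matrix_basis[OF a[THEN conjunct1]])
    have inv: "\<exists>w\<in>carrier_vec k. \<sigma> g *\<^sub>v (Q *\<^sub>v v) = Q *\<^sub>v w" if "g \<in> carrier G" "v \<in> carrier_vec k" for g v
    proof -
      have "\<sigma> g *\<^sub>v (Q *\<^sub>v v) \<in> W" using a that W by blast
      then show ?thesis unfolding W by blast
    qed
    have sub: "representation G k (\<lambda>g. M * \<sigma> g * Q)"
      "\<And>g. g \<in> carrier G \<Longrightarrow> \<sigma> g * Q = Q * (M * \<sigma> g * Q)"
      using subrepresentation[OF s Q M MQ] inv by blast+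
    show "W = {0\<^sub>v d} \<or> W = carrier_vec d"
    proof (cases "k = 0")
      case True
      then have "Q *\<^sub>v u = 0\<^sub>v d" if "u \<in> carrier_vec k" for u
        using that Q by (intro eq_vecI) (auto simp: scalar_prod_def)
      then have "W \<subseteq> {0\<^sub>v d}" unfolding W by auto
      moreover have "0\<^sub>v d \<in> W" using a[unfolded subspace_iff] by blast
      ultimately show ?thesis by blast
    next
      case False
      have "good k" unfolding good_def
      proof (intro conjI exI ballI)
        show "0 < k" using False by simp
        show "representation G k (\<lambda>g. M * \<sigma> g * Q)" by (rule sub(1))
        show "P * Q \<in> carrier_mat n k" "M * L \<in> carrier_mat k n" using P Q M L by auto
        have "M * L * (P * Q) = M * (L * P) * Q"
          using P Q M L by (simp add: assoc_mult_mat[of _ k d _ n _ k] assoc_mult_mat[of _ d n _ d _ k]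
              assoc_mult_mat[of _ k d _ d _ k])
        then show "M * L * (P * Q) = 1\<^sub>m k" using LP M MQ by simp
        have "E * (P * Q) = E * P * Q" using E P Q by (intro assoc_mult_mat[symmetric]) auto
        also have "\<dots> = c \<cdot>\<^sub>m (P * Q)" unfolding EP using P Q by (intro mult_smult_assoc_mat) auto
        finally show "E * (P * Q) = c \<cdot>\<^sub>m (P * Q)" .
        fix g assume g: "g \<in> carrier G"
        have "\<rho> g * (P * Q) = \<rho> g * P * Q" using r(1)[OF g] P Q by (intro assoc_mult_mat[symmetric]) auto
        also have "\<dots> = P * (\<sigma> g * Q)" unfolding rP[OF g] using s'(1)[OF g] P Q by (intro assoc_mult_mat) auto
        also have "\<dots> = P * (Q * (M * \<sigma> g * Q))" using sub(2)[OF g] by simp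
        also have "\<dots> = P * Q * (M * \<sigma> g * Q)" using s'(1)[OF g] P Q M by (intro assoc_mult_mat[symmetric]) auto
        finally show "\<rho> g * (P * Q) = P * Q * (M * \<sigma> g * Q)" .
      qed
      then have "d \<le> k" by (rule min)
      moreover have "k \<le> d" using left_inverse_dim_le[OF M Q MQ] .
      ultimately have "k = d" by simp
      then have QM: "Q * M = 1\<^sub>m d" using mat_mult_left_right_inverse[of M d Q] M Q MQ by simp
      have "v \<in> W" if v: "v \<in> carrier_vec d" for v
      proof -
        have "Q *\<^sub>v (M *\<^sub>v v) = v" using assoc_mult_mat_vec[OF Q M v] QM v by simp
        moreover have "M *\<^sub>v v \<in> carrier_vec k" using M v by auto
        ultimately show ?thesis unfolding W by (metis imageI)
      qed
      moreover have "W \<subseteq> carrier_vec d" using a[unfolded subspace_iff] by blast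
      ultimately show ?thesis by blast
    qed
  qed
  from that[OF this P L LP rP EP] show thesis .
qed

text \<open>If \<open>f\<close> is nonzero, the product \<open>E\<close> of the adjoint of
  \<open>F f\<close> with \<open>F f\<close> in the regular representation has a positive sum of
  squares as its trace, hence a nonzero eigenvalue. On an irreducible constituent of that eigenspace
  the operator given by \<open>f\<close> is a scalar, by Schur's lemma, and its trace vanishes by
  assumption. So \<open>E\<close> is zero there, a contradiction.\<close>

lemma class_function_eq_0:
  fixes f :: "'a \<Rightarrow> complex"
  assumes fin: "finite (carrier G)"
    and cls: "\<And>g h. g \<in> carrier G \<Longrightarrow> h \<in> carrier G \<Longrightarrow> f (h \<otimes> g \<otimes> inv h) = f g"
    and orth: "\<And>d \<rho>. irreducible_representation G d \<rho> \<Longrightarrow> (\<Sum>g\<in>carrier G. f g * tr (\<rho> g)) = 0"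
    and a: "a \<in> carrier G"
  shows "f a = 0"
proof (rule ccontr)
  assume fa: "f a \<noteq> 0"
  define N where "N = card (carrier G)"
  obtain e where e: "bij_betw e {..<N} (carrier G)"
    using ex_bij_betw_nat_finite[OF fin] unfolding N_def atLeast0LessThan by blast
  have eG: "e i \<in> carrier G" if "i < N" for i using e that bij_betwE by blast
  have einj: "e i = e j \<longleftrightarrow> i = j" if "i < N" "j < N" for i j
    using e that unfolding bij_betw_def inj_on_def by blast
  have esurj: "\<exists>i<N. e i = g" if "g \<in> carrier G" for g
    using e that unfolding bij_betw_def by (metis imageE lessThan_iff)
  \<comment> \<open>The regular representation by permutation matrices, with rows and columns
    indexed through the enumeration \<open>e\<close>.\<close>
  define R :: "'a \<Rightarrow> complex mat" where
    "R g = mat N N (\<lambda>(i, j). if e i = g \<otimes> e j then 1 else 0)" for g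
  have rep: "representation G N R"
    unfolding representation_def
  proof (intro conjI ballI)
    show "R g \<in> carrier_mat N N" for g unfolding R_def by simp
    show "R \<one> = 1\<^sub>m N" unfolding R_def using eG einj by (intro eq_matI) auto
    fix g h assume g: "g \<in> carrier G" and h: "h \<in> carrier G"
    show "R (g \<otimes> h) = R g * R h"
    proof (rule eq_matI)
      fix i j assume "i < dim_row (R g * R h)" "j < dim_col (R g * R h)"
      then have ij: "i < N" "j < N" unfolding R_def by auto
      obtain l where l: "l < N" "e l = h \<otimes> e j" using esurj[of "h \<otimes> e j"] h eG ij by auto
      have "(R g * R h) $$ (i, j) = (\<Sum>k<N. R g $$ (i, k) * R h $$ (k, j))"
        using ij by (intro mult_entry[of _ N N _ N]) (auto simp: R_def)
      also have "\<dots> = (\<Sum>k<N. if k = l then R g $$ (i, l) else 0)"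
        using ij l einj by (intro sum.cong refl) (auto simp: R_def l(2)[symmetric])
      also have "\<dots> = R (g \<otimes> h) $$ (i, j)"
        using l ij g h eG by (simp add: R_def m_assoc)
      finally show "R (g \<otimes> h) $$ (i, j) = (R g * R h) $$ (i, j)" by simp
    qed (auto simp: R_def)
  qed
  define F where "F k = msum N N (carrier G) (\<lambda>g. k g \<cdot>\<^sub>m R g)" for k :: "'a \<Rightarrow> complex"
  have F: "F k \<in> carrier_mat N N" for k unfolding F_def by simp
  have F_entry: "F k $$ (i, j) = k (e i \<otimes> inv (e j))" if ij: "i < N" "j < N" for k i j
  proof -
    have "F k $$ (i, j) = (\<Sum>g\<in>carrier G. if g = e i \<otimes> inv (e j) then k g else 0)"
      unfolding F_def using ij eG
      by (simp, intro sum.cong refl) (auto simp: R_def inv_solve_right m_assoc)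
    then show ?thesis using fin eG ij by simp
  qed
  \<comment> \<open>Chosen so that \<open>F f'\<close> is the conjugate transpose of
    \<open>F f\<close>.\<close>
  define f' where "f' g = cnj (f (inv g))" for g
  have cls': "f' (h \<otimes> g \<otimes> inv h) = f' g" if "g \<in> carrier G" "h \<in> carrier G" for g h
    using cls[of "inv g" h] that unfolding f'_def by (simp add: inv_mult_group m_assoc)
  define E where "E = F f' * F f"
  have E: "E \<in> carrier_mat N N" unfolding E_def using F[of f'] F[of f] by auto
  have comm: "E * R g = R g * E" if g: "g \<in> carrier G" for g
  proof -
    have c: "F f * R g = R g * F f" "F f' * R g = R g * F f'"
      unfolding F_def by (rule class_function_sum_commutes[OF rep g], rule cls cls', assumption+)+
    have R: "R g \<in> carrier_mat N N" unfolding R_def by simp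
    have "E * R g = F f' * (F f * R g)" unfolding E_def by (rule assoc_mult_mat[OF F F R])
    also have "\<dots> = F f' * R g * F f" unfolding c(1) by (rule assoc_mult_mat[OF F R F, symmetric])
    also have "\<dots> = R g * E" unfolding c(2) E_def by (rule assoc_mult_mat[OF R F F])
    finally show ?thesis .
  qed
  have "tr E = of_real (\<Sum>i<N. \<Sum>l<N. (cmod (f (e l \<otimes> inv (e i))))\<^sup>2)"
  proof -
    have "tr E = (\<Sum>i<N. \<Sum>l<N. F f' $$ (i, l) * F f $$ (l, i))"
      unfolding tr_eq_sum[OF E] by (intro sum.cong refl) (simp add: E_def mult_entry[OF F F] del: index_mult_mat)
    also have "\<dots> = (\<Sum>i<N. \<Sum>l<N. of_real ((cmod (f (e l \<otimes> inv (e i))))\<^sup>2))"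
    proof (intro sum.cong refl)
      fix i l assume il: "i \<in> {..<N}" "l \<in> {..<N}"
      then have "f' (e i \<otimes> inv (e l)) = cnj (f (e l \<otimes> inv (e i)))"
        unfolding f'_def using eG by (simp add: inv_mult_group)
      then show "F f' $$ (i, l) * F f $$ (l, i) = of_real ((cmod (f (e l \<otimes> inv (e i))))\<^sup>2)"
        using il complex_norm_square[of "f (e l \<otimes> inv (e i))"]
        by (simp add: F_entry mult.commute del: of_real_power)
    qed
    finally show ?thesis by simp
  qed
  moreover have "(\<Sum>i<N. \<Sum>l<N. (cmod (f (e l \<otimes> inv (e i))))\<^sup>2) \<noteq> 0"
  proof -
    obtain i l where il: "i < N" "e i = \<one>" "l < N" "e l = a" using esurj a one_closed by metis
    have "f (e l \<otimes> inv (e i)) = f a" using il a by simp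
    then have "0 < (\<Sum>l<N. (cmod (f (e l \<otimes> inv (e i))))\<^sup>2)"
      using il fa by (intro sum_pos2[of _ l]) auto
    note pos = this
    have "0 < (\<Sum>i<N. \<Sum>l<N. (cmod (f (e l \<otimes> inv (e i))))\<^sup>2)"
      by (intro sum_pos2[of "{..<N}" i "\<lambda>i. \<Sum>l<N. (cmod (f (e l \<otimes> inv (e i))))\<^sup>2"])
        (simp, simp add: il(1), rule pos, simp add: sum_nonneg)
    then show ?thesis by simp
  qed
  ultimately have "tr E \<noteq> 0" by (metis of_real_eq_0_iff)
  then obtain v c where c: "c \<noteq> 0" and v: "v \<in> carrier_vec N" "v \<noteq> 0\<^sub>v N" "E *\<^sub>v v = c \<cdot>\<^sub>v v"
    using trace_nonzero_eigenvalue[OF E] by metis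
  obtain d \<sigma> P L where irr: "irreducible_representation G d \<sigma>" and P: "P \<in> carrier_mat N d"
    and L: "L \<in> carrier_mat d N" "L * P = 1\<^sub>m d"
    and rP: "\<And>g. g \<in> carrier G \<Longrightarrow> R g * P = P * \<sigma> g" and EP: "E * P = c \<cdot>\<^sub>m P"
    using irreducible_in_eigenspace[OF rep E comm v] by metis
  note s = representationD[OF irreducibleD(1)[OF irr]]
  have d: "d > 0" using irreducibleD(2)[OF irr] .
  let ?M = "msum d d (carrier G) (\<lambda>g. f g \<cdot>\<^sub>m \<sigma> g)"
  have "?M = 0\<^sub>m d d"
  proof -
    obtain b where b: "?M = b \<cdot>\<^sub>m 1\<^sub>m d"
      using schur_scalar[OF irr msum_carrier class_function_sum_commutes[OF irreducibleD(1)[OF irr] _ cls]]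
      by metis
    have "tr ?M = (\<Sum>g\<in>carrier G. tr (f g \<cdot>\<^sub>m \<sigma> g))" using s(1) by (intro tr_msum) auto
    also have "\<dots> = (\<Sum>g\<in>carrier G. f g * tr (\<sigma> g))"
    proof (intro sum.cong refl)
      fix g assume g: "g \<in> carrier G"
      show "tr (f g \<cdot>\<^sub>m \<sigma> g) = f g * tr (\<sigma> g)"
        unfolding tr_eq_sum[OF s(1)[OF g]] tr_eq_sum[OF smult_carrier_mat[OF s(1)[OF g]]]
        using s(1)[OF g] by (simp add: sum_distrib_left)
    qed
    also have "\<dots> = 0" by (rule orth[OF irr])
    also have "tr ?M = of_nat d * b" unfolding b by (subst tr_eq_sum[of _ d]) auto
    finally have "b = 0" using d by simp
    then show ?thesis unfolding b by (intro eq_matI) auto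
  qed
  moreover have "F f * P = P * ?M"
  proof -
    have "F f * P = msum N d (carrier G) (\<lambda>g. f g \<cdot>\<^sub>m R g * P)"
      unfolding F_def using P by (intro msum_mult) (auto simp: R_def)
    also have "\<dots> = msum N d (carrier G) (\<lambda>g. P * (f g \<cdot>\<^sub>m \<sigma> g))"
    proof (rule msum_cong)
      fix g assume g: "g \<in> carrier G"
      have "R g \<in> carrier_mat N N" unfolding R_def by simp
      then show "f g \<cdot>\<^sub>m R g * P = P * (f g \<cdot>\<^sub>m \<sigma> g)"
        using rP[OF g] mult_smult_assoc_mat[of "R g" N N P d "f g"] mult_smult_distrib[OF P s(1)[OF g]] P by simp
    qed
    also have "\<dots> = P * ?M" using P s(1) by (intro mult_msum[symmetric]) auto
    finally show ?thesis .
  qed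
  ultimately have "F f * P = 0\<^sub>m N d" using P by simp
  then have "E * P = 0\<^sub>m N d" unfolding E_def using assoc_mult_mat[OF F F P] F[of f'] by simp
  then have cP: "c \<cdot>\<^sub>m P = 0\<^sub>m N d" using EP by simp
  have "P = 0\<^sub>m N d"
  proof (rule eq_matI)
    fix i j assume "i < dim_row (0\<^sub>m N d :: complex mat)" "j < dim_col (0\<^sub>m N d :: complex mat)"
    then have ij: "i < N" "j < d" by auto
    have "(c \<cdot>\<^sub>m P) $$ (i, j) = 0" unfolding cP using ij by simp
    then show "P $$ (i, j) = 0\<^sub>m N d $$ (i, j)" using ij P c by simp
  qed (use P in auto)
  then have "1\<^sub>m d = (0\<^sub>m d d :: complex mat)" using L by simp
  then have "(1\<^sub>m d :: complex mat) $$ (0, 0) = 0\<^sub>m d d $$ (0, 0)" by simp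
  with d show False by simp
qed

text \<open>The average of \<open>c g \<cdot>\<^sub>m \<rho> g\<close> over \<open>K\<close> is
  idempotent, so its trace is a natural number. Idempotence rests on left multiplication by an
  element of \<open>K\<close> permuting \<open>K\<close>, which holds because \<open>K\<close> is
  finite and closed under products. Later \<open>K\<close> is a centralizer inside D_n.\<close>

lemma linear_character_sum_nonneg:
  assumes rep: "representation G d \<rho>" and fin: "finite (carrier G)"
    and K: "K \<subseteq> carrier G" "K \<noteq> {}" "\<And>g h. g \<in> K \<Longrightarrow> h \<in> K \<Longrightarrow> g \<otimes> h \<in> K"
    and hom: "\<And>g h. g \<in> K \<Longrightarrow> h \<in> K \<Longrightarrow> c (g \<otimes> h) = c g * c h"
  obtains x where "x \<ge> 0" "(\<Sum>g\<in>K. c g * tr (\<rho> g)) = of_real x"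
proof -
  note r = representationD[OF rep]
  have finK: "finite K" using fin K finite_subset by blast
  define N where "N = (of_nat (card K) :: complex)"
  have N: "N \<noteq> 0" unfolding N_def using finK K by simp
  define M where "M = msum d d K (\<lambda>g. c g / N \<cdot>\<^sub>m \<rho> g)"
  have M: "M \<in> carrier_mat d d" unfolding M_def by simp
  have car: "\<rho> g \<in> carrier_mat d d" if "g \<in> K" for g using r(1) K that by blast
  have bij: "bij_betw (\<lambda>g. h \<otimes> g) K K" if h: "h \<in> K" for h
  proof -
    have inj: "inj_on (\<lambda>g. h \<otimes> g) K" using bij_betw_lmult[of h] h K(1) inj_on_subset unfolding bij_betw_def by blast
    moreover have "(\<lambda>g. h \<otimes> g) ` K \<subseteq> K" using K(3) h by auto
    ultimately show ?thesis using endo_inj_surj[OF finK] unfolding bij_betw_def by blast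
  qed
  have abs: "c h \<cdot>\<^sub>m \<rho> h * M = M" if h: "h \<in> K" for h
  proof -
    have "c h \<cdot>\<^sub>m \<rho> h * M = msum d d K (\<lambda>g. c h \<cdot>\<^sub>m \<rho> h * (c g / N \<cdot>\<^sub>m \<rho> g))"
      unfolding M_def using car h by (intro mult_msum) auto
    also have "\<dots> = msum d d K (\<lambda>g. c (h \<otimes> g) / N \<cdot>\<^sub>m \<rho> (h \<otimes> g))"
    proof (rule msum_cong)
      fix g assume g: "g \<in> K"
      have gh: "g \<in> carrier G" "h \<in> carrier G" using g h K by auto
      show "c h \<cdot>\<^sub>m \<rho> h * (c g / N \<cdot>\<^sub>m \<rho> g) = c (h \<otimes> g) / N \<cdot>\<^sub>m \<rho> (h \<otimes> g)"
        using hom[OF h g] r(3)[OF gh(2,1)] car[OF g] car[OF h]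
        by (intro eq_matI) (auto simp: mult_smult_assoc_mat[of _ d d _ d] mult_smult_distrib[of _ d d _ d])
    qed
    also have "\<dots> = M" unfolding M_def by (rule msum_reindex[OF bij[OF h]])
    finally show ?thesis .
  qed
  have "M * M = msum d d K (\<lambda>h. c h / N \<cdot>\<^sub>m \<rho> h * M)"
    using car by (subst (1) M_def, intro msum_mult M) auto
  also have "\<dots> = msum d d K (\<lambda>h. 1 / N \<cdot>\<^sub>m M)"
  proof (rule msum_cong)
    fix h assume h: "h \<in> K"
    have "c h / N \<cdot>\<^sub>m \<rho> h = (1 / N) \<cdot>\<^sub>m (c h \<cdot>\<^sub>m \<rho> h)" by (intro eq_matI) auto
    then have "c h / N \<cdot>\<^sub>m \<rho> h * M = (1 / N) \<cdot>\<^sub>m (c h \<cdot>\<^sub>m \<rho> h * M)"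
      using car[OF h] M by (simp add: mult_smult_assoc_mat[of _ d d])
    then show "c h / N \<cdot>\<^sub>m \<rho> h * M = 1 / N \<cdot>\<^sub>m M" using abs[OF h] by simp
  qed
  also have "\<dots> = M"
    using M N by (intro eq_matI) (auto simp: msum_def N_def)
  finally obtain k where k: "tr M = of_nat k" using idempotent_trace[OF M] by metis
  have "tr M = (\<Sum>g\<in>K. tr (c g / N \<cdot>\<^sub>m \<rho> g))" unfolding M_def using car by (intro tr_msum) auto
  also have "\<dots> = (\<Sum>g\<in>K. c g * tr (\<rho> g) / N)"
  proof (intro sum.cong refl)
    fix g assume g: "g \<in> K"
    show "tr (c g / N \<cdot>\<^sub>m \<rho> g) = c g * tr (\<rho> g) / N"
      unfolding tr_eq_sum[OF car[OF g]] tr_eq_sum[OF smult_carrier_mat[OF car[OF g]]]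
      using car[OF g] by (simp add: sum_distrib_left sum_divide_distrib)
  qed
  finally have "(\<Sum>g\<in>K. c g * tr (\<rho> g)) = N * of_nat k"
    using N k by (simp add: sum_divide_distrib[symmetric] field_simps)
  then have "(\<Sum>g\<in>K. c g * tr (\<rho> g)) = of_real (real (card K * k))" unfolding N_def by simp
  then show thesis by (intro that[of "real (card K * k)"]) auto
qed

lemma irreducible_characters_orthogonal:
  assumes "\<chi> \<in> irreducible_characters G" "\<eta> \<in> irreducible_characters G"
  shows "(\<Sum>g\<in>carrier G. \<chi> g * \<eta> (inv g)) = (if \<chi> = \<eta> then of_nat (card (carrier G)) else 0)"
proof -
  from assms obtain d \<rho> e \<sigma> where irr: "irreducible_representation G d \<rho>" "irreducible_representation G e \<sigma>"
    and eq: "\<chi> = (\<lambda>g\<in>carrier G. tr (\<rho> g))" "\<eta> = (\<lambda>g\<in>carrier G. tr (\<sigma> g))"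
    unfolding irreducible_characters_def by blast
  show ?thesis
  proof (cases "\<chi> = \<eta>")
    case True
    then have "(\<Sum>g\<in>carrier G. \<chi> g * \<eta> (inv g)) = (\<Sum>g\<in>carrier G. tr (\<rho> g) * tr (\<rho> (inv g)))"
      unfolding True[symmetric] eq(1) by (intro sum.cong refl) simp
    with True show ?thesis using orthogonality_same[OF irr(1)] by simp
  next
    case False
    then obtain h where "\<chi> h \<noteq> \<eta> h" by blast
    then have "h \<in> carrier G" "tr (\<rho> h) \<noteq> tr (\<sigma> h)" unfolding eq by (auto simp: restrict_def split: if_splits)
    from orthogonality_different[OF irr this] False show ?thesis unfolding eq by simp
  qed
qed

text \<open>The orthogonality relations say that a matrix with one row per chosen character and one
  column per group element has a right inverse. More characters than group elements would contradict
  \<open>left_inverse_dim_le\<close>.\<close>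

lemma finite_irreducible_characters:
  assumes fin: "finite (carrier G)"
  shows "finite (irreducible_characters G)"
proof (rule ccontr)
  define N where "N = card (carrier G)"
  have N: "N > 0" unfolding N_def using fin one_closed card_gt_0_iff by blast
  assume "infinite (irreducible_characters G)"
  then obtain I where I: "finite I" "card I = Suc N" "I \<subseteq> irreducible_characters G"
    using infinite_arbitrarily_large by blast
  obtain e where e: "bij_betw e {..<N} (carrier G)"
    using ex_bij_betw_nat_finite[OF fin] unfolding N_def atLeast0LessThan by blast
  obtain \<chi> where \<chi>: "bij_betw \<chi> {..<Suc N} I"
    using ex_bij_betw_nat_finite[OF I(1)] I(2) unfolding atLeast0LessThan by metis
  have \<chi>I: "\<chi> i \<in> irreducible_characters G" if "i < Suc N" for i using \<chi> I that bij_betwE by blast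
  have \<chi>inj: "\<chi> i = \<chi> j \<longleftrightarrow> i = j" if "i < Suc N" "j < Suc N" for i j
    using \<chi> that unfolding bij_betw_def inj_on_def by blast
  define Q where "Q = mat N (Suc N) (\<lambda>(a, i). \<chi> i (inv (e a)))"
  define L where "L = mat (Suc N) N (\<lambda>(i, a). \<chi> i (e a) / of_nat N)"
  have c: "L \<in> carrier_mat (Suc N) N" "Q \<in> carrier_mat N (Suc N)" unfolding L_def Q_def by auto
  have "L * Q = 1\<^sub>m (Suc N)"
  proof (rule eq_matI)
    fix i j assume "i < dim_row (1\<^sub>m (Suc N) :: complex mat)" "j < dim_col (1\<^sub>m (Suc N) :: complex mat)"
    then have ij: "i < Suc N" "j < Suc N" by auto
    have "(L * Q) $$ (i, j) = (\<Sum>a<N. L $$ (i, a) * Q $$ (a, j))" using ij by (intro mult_entry[OF c])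
    also have "\<dots> = (\<Sum>a<N. \<chi> i (e a) * \<chi> j (inv (e a))) / of_nat N"
      using ij unfolding sum_divide_distrib by (intro sum.cong refl) (auto simp: L_def Q_def)
    also have "(\<Sum>a<N. \<chi> i (e a) * \<chi> j (inv (e a))) = (\<Sum>g\<in>carrier G. \<chi> i g * \<chi> j (inv g))"
      using sum.reindex_bij_betw[OF e, of "\<lambda>g. \<chi> i g * \<chi> j (inv g)"] .
    also have "\<dots> = (if i = j then of_nat N else 0)"
      using irreducible_characters_orthogonal[OF \<chi>I \<chi>I] ij \<chi>inj N_def by simp
    finally show "(L * Q) $$ (i, j) = 1\<^sub>m (Suc N) $$ (i, j)" using ij N by simp
  qed (use c in auto)
  from left_inverse_dim_le[OF c this] show False by simp
qed

text \<open>Paired with an irreducible character, the root count gives plus or minus the group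
  order; pairing with \<open>\<phi>\<close>, a positive multiple of it, rules out the minus sign.
  The root count and the sum of all irreducible characters are then class functions with the same
  pairings, so they agree.\<close>

lemma multiple_of_square_root_count:
  fixes \<phi> :: "'a \<Rightarrow> complex"
  assumes fin: "finite (carrier G)"
    and ambivalent: "\<And>g. g \<in> carrier G \<Longrightarrow> \<exists>h\<in>carrier G. inv g = h \<otimes> g \<otimes> inv h"
    and nonneg: "\<And>d \<rho>. irreducible_representation G d \<rho> \<Longrightarrow>
      \<exists>x\<ge>0. (\<Sum>g\<in>carrier G. \<phi> g * tr (\<rho> g)) = of_real x"
    and count: "\<And>g. g \<in> carrier G \<Longrightarrow> \<phi> g = of_nat k * of_nat (card {x \<in> carrier G. x \<otimes> x = g})"
    and k: "k > 0"
  shows "has_multiplicities G \<phi> (\<lambda>_. k)"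
proof -
  define S :: "'a \<Rightarrow> complex" where "S g = of_nat (card {x \<in> carrier G. x \<otimes> x = g})" for g
  define N :: complex where "N = of_nat (card (carrier G))"
  have N0: "card (carrier G) > 0" using fin one_closed card_gt_0_iff by blast
  have real: "tr (\<rho> (inv g)) = tr (\<rho> g)" if rep: "representation G d \<rho>" and g: "g \<in> carrier G" for d \<rho> g
  proof -
    note r = representationD[OF rep]
    obtain h where h: "h \<in> carrier G" "inv g = h \<otimes> g \<otimes> inv h" using ambivalent[OF g] by blast
    have c: "\<rho> g \<in> carrier_mat d d" "\<rho> h \<in> carrier_mat d d" "\<rho> (inv h) \<in> carrier_mat d d"
      using g h r(1) by auto
    have "\<rho> (inv g) = \<rho> h * \<rho> g * \<rho> (inv h)" unfolding h(2) using g h r(3) by simp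
    then have "tr (\<rho> (inv g)) = tr (\<rho> (inv h) * (\<rho> h * \<rho> g))" 
      using c tr_mult_commute[of "\<rho> h * \<rho> g" d d "\<rho> (inv h)"] by (metis mult_carrier_mat)
    also have "\<rho> (inv h) * (\<rho> h * \<rho> g) = \<rho> (inv h) * \<rho> h * \<rho> g" using c by (intro assoc_mult_mat[symmetric]) auto
    finally show ?thesis unfolding representation_inv[OF rep h(1)] using c by simp
  qed
  have S_sum: "(\<Sum>g\<in>carrier G. S g * tr (\<rho> g)) = (\<Sum>x\<in>carrier G. tr (\<rho> (x \<otimes> x)))" for \<rho> :: "'a \<Rightarrow> complex mat"
  proof -
    have "(\<Sum>x\<in>carrier G. tr (\<rho> (x \<otimes> x))) = (\<Sum>g\<in>carrier G. \<Sum>x\<in>{x \<in> carrier G. x \<otimes> x = g}. tr (\<rho> (x \<otimes> x)))"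
      by (rule sum.group[symmetric]) (use fin in auto)
    also have "\<dots> = (\<Sum>g\<in>carrier G. S g * tr (\<rho> g))"
      unfolding S_def by (intro sum.cong refl) simp
    finally show ?thesis by simp
  qed
  have S_irr: "(\<Sum>g\<in>carrier G. S g * tr (\<rho> g)) = N" if irr: "irreducible_representation G d \<rho>" for d \<rho>
  proof -
    obtain x where x: "x \<ge> 0" "(\<Sum>g\<in>carrier G. \<phi> g * tr (\<rho> g)) = of_real x" using nonneg[OF irr] by blast
    have "(\<Sum>g\<in>carrier G. \<phi> g * tr (\<rho> g)) = of_nat k * (\<Sum>g\<in>carrier G. S g * tr (\<rho> g))"
      unfolding sum_distrib_left by (intro sum.cong refl) (simp add: count S_def)
    with x have kx: "of_nat k * (\<Sum>g\<in>carrier G. S g * tr (\<rho> g)) = of_real x" by simp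
    show ?thesis
    proof (rule frobenius_schur_real[OF irr fin real[OF irreducibleD(1)[OF irr]]])
      assume "(\<Sum>g\<in>carrier G. tr (\<rho> (g \<otimes> g))) = - of_nat (card (carrier G))"
      then have "of_real (- real (k * card (carrier G))) = (of_real x :: complex)"
        using kx unfolding S_sum by simp
      then have "x = - real (k * card (carrier G))" unfolding of_real_eq_iff by simp
      moreover have "0 < real (k * card (carrier G))" using k N0 by simp
      ultimately show ?thesis using x by linarith
    qed (auto simp: S_sum N_def)
  qed
  have inv_char: "\<chi> (inv g) = \<chi> g" if "\<chi> \<in> irreducible_characters G" "g \<in> carrier G" for \<chi> g
    using that real irreducibleD(1) unfolding irreducible_characters_def by fastforce
  have cls_char: "\<chi> (h \<otimes> g \<otimes> inv h) = \<chi> g"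
    if chi: "\<chi> \<in> irreducible_characters G" and g: "g \<in> carrier G" and h: "h \<in> carrier G" for \<chi> g h
  proof -
    obtain d \<rho> where irr: "irreducible_representation G d \<rho>" and eq: "\<chi> = (\<lambda>g\<in>carrier G. tr (\<rho> g))"
      using chi unfolding irreducible_characters_def by blast
    note rep = irreducibleD(1)[OF irr]
    note r = representationD[OF rep]
    have c: "\<rho> g \<in> carrier_mat d d" "\<rho> h \<in> carrier_mat d d" "\<rho> (inv h) \<in> carrier_mat d d"
      using g h r(1) by auto
    have "\<rho> (h \<otimes> g \<otimes> inv h) = \<rho> h * \<rho> g * \<rho> (inv h)" using g h r(3) by simp
    then have "tr (\<rho> (h \<otimes> g \<otimes> inv h)) = tr (\<rho> (inv h) * (\<rho> h * \<rho> g))" 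
      using c tr_mult_commute[of "\<rho> h * \<rho> g" d d "\<rho> (inv h)"] by (metis mult_carrier_mat)
    also have "\<rho> (inv h) * (\<rho> h * \<rho> g) = \<rho> (inv h) * \<rho> h * \<rho> g" using c by (intro assoc_mult_mat[symmetric]) auto
    finally show ?thesis unfolding representation_inv[OF rep h] eq using c g h by simp
  qed
  have S_cls: "S (h \<otimes> g \<otimes> inv h) = S g" if g: "g \<in> carrier G" and h: "h \<in> carrier G" for g h
  proof -
    have sq: "(h \<otimes> x \<otimes> inv h) \<otimes> (h \<otimes> x \<otimes> inv h) = h \<otimes> (x \<otimes> x) \<otimes> inv h" if "x \<in> carrier G" for x
      using that h by (simp add: m_assoc inv_mult_left)
    have "bij_betw (\<lambda>x. h \<otimes> x \<otimes> inv h) {x \<in> carrier G. x \<otimes> x = g} {x \<in> carrier G. x \<otimes> x = h \<otimes> g \<otimes> inv h}"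
    proof (rule bij_betw_subset[OF bij_betw_conj[OF h]])
      show "(\<lambda>x. h \<otimes> x \<otimes> inv h) ` {x \<in> carrier G. x \<otimes> x = g} = {x \<in> carrier G. x \<otimes> x = h \<otimes> g \<otimes> inv h}"
      proof (intro equalityI subsetI)
        fix y assume y: "y \<in> {x \<in> carrier G. x \<otimes> x = h \<otimes> g \<otimes> inv h}"
        then obtain x where x: "x \<in> carrier G" "y = h \<otimes> x \<otimes> inv h"
          using bij_betw_conj[OF h] unfolding bij_betw_def by (metis (no_types, lifting) CollectD imageE)
        then have "h \<otimes> (x \<otimes> x) \<otimes> inv h = h \<otimes> g \<otimes> inv h" using y sq by simp
        then have "x \<otimes> x = g" using x g h by simp
        with x show "y \<in> (\<lambda>x. h \<otimes> x \<otimes> inv h) ` {x \<in> carrier G. x \<otimes> x = g}" by blast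
      qed (use sq h in auto)
    qed auto
    then show ?thesis unfolding S_def by (simp add: bij_betw_same_card)
  qed
  have finI: "finite (irreducible_characters G)" by (rule finite_irreducible_characters[OF fin])
  have "S a - (\<Sum>\<chi>\<in>irreducible_characters G. \<chi> a) = 0" if "a \<in> carrier G" for a
  proof (rule class_function_eq_0[OF fin, of "\<lambda>g. S g - (\<Sum>\<chi>\<in>irreducible_characters G. \<chi> g)", OF _ _ that])
    show "S (h \<otimes> g \<otimes> inv h) - (\<Sum>\<chi>\<in>irreducible_characters G. \<chi> (h \<otimes> g \<otimes> inv h)) =
        S g - (\<Sum>\<chi>\<in>irreducible_characters G. \<chi> g)" if "g \<in> carrier G" "h \<in> carrier G" for g h
      using that by (intro arg_cong2[where f = minus] S_cls sum.cong refl cls_char)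
    fix d \<rho> assume irr: "irreducible_representation G d \<rho>"
    define \<eta> where "\<eta> = (\<lambda>g\<in>carrier G. tr (\<rho> g))"
    have \<eta>: "\<eta> \<in> irreducible_characters G" unfolding irreducible_characters_def \<eta>_def using irr by blast
    \<comment> \<open>Since \<open>g\<close> is conjugate to its inverse, \<open>\<eta> g\<close>
      may be rewritten as \<open>\<eta> (inv g)\<close>, the form in which orthogonality is
      stated.\<close>
    have "(\<Sum>g\<in>carrier G. (\<Sum>\<chi>\<in>irreducible_characters G. \<chi> g) * tr (\<rho> g))
        = (\<Sum>g\<in>carrier G. \<Sum>\<chi>\<in>irreducible_characters G. \<chi> g * \<eta> (inv g))"
      by (intro sum.cong refl) (simp add: sum_distrib_right inv_char[OF \<eta>], simp add: \<eta>_def)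
    also have "\<dots> = (\<Sum>\<chi>\<in>irreducible_characters G. \<Sum>g\<in>carrier G. \<chi> g * \<eta> (inv g))" by (rule sum.swap)
    also have "\<dots> = (\<Sum>\<chi>\<in>irreducible_characters G. if \<chi> = \<eta> then N else 0)"
      unfolding N_def using \<eta> by (intro sum.cong refl irreducible_characters_orthogonal)
    also have "\<dots> = N" using finI \<eta> by simp
    finally show "(\<Sum>g\<in>carrier G. (S g - (\<Sum>\<chi>\<in>irreducible_characters G. \<chi> g)) * tr (\<rho> g)) = 0"
      using S_irr[OF irr] by (simp add: left_diff_distrib sum_subtractf)
  qed
  then show ?thesis unfolding has_multiplicities_def
    using count by (simp add: S_def sum_distrib_left[symmetric])
qed

end

section \<open>Weights of commuting signed permutations\<close>

definition symmetric :: "int set \<Rightarrow> bool" where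
  "symmetric X \<longleftrightarrow> finite X \<and> 0 \<notin> X \<and> (\<forall>a\<in>X. - a \<in> X)"

lemma symmetricD:
  assumes "symmetric X"
  shows "finite X" "0 \<notin> X" "a \<in> X \<Longrightarrow> - a \<in> X" "a \<in> X \<Longrightarrow> a \<noteq> 0" "a \<in> X \<Longrightarrow> - a \<noteq> a" "a \<in> X \<Longrightarrow> a \<noteq> - a"
  using assms unfolding symmetric_def by fastforce+

text \<open>Stated on all integers, so that the same \<open>g\<close> can be studied on any
  invariant support without being restricted first.\<close>

definition odd_bij :: "(int \<Rightarrow> int) \<Rightarrow> bool" where
  "odd_bij g \<longleftrightarrow> bij g \<and> (\<forall>a. g (- a) = - g a)"

lemma odd_bijD:
  assumes "odd_bij g"
  shows "bij g" "inj g" "g (- a) = - g a" "g a = g b \<longleftrightarrow> a = b"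
  using assms unfolding odd_bij_def by (auto simp: bij_is_inj inj_eq)

lemma odd_bij_inj_on: "odd_bij g \<Longrightarrow> inj_on g S"
  unfolding inj_on_def using odd_bijD(4) by simp

lemma odd_bij_comp: "odd_bij g \<Longrightarrow> odd_bij h \<Longrightarrow> odd_bij (g \<circ> h)"
  unfolding odd_bij_def by (auto simp: bij_comp)

definition odd_perms :: "int set \<Rightarrow> (int \<Rightarrow> int) set" where
  "odd_perms X = {w. w permutes X \<and> (\<forall>a. w (- a) = - w a)}"

lemma odd_permsD:
  assumes "w \<in> odd_perms X"
  shows "w permutes X" "w (- a) = - w a" "odd_bij w" "w ` X = X" "a \<in> X \<Longrightarrow> w a \<in> X" "a \<notin> X \<Longrightarrow> w a = a"
  using assms unfolding odd_perms_def odd_bij_def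
  by (auto simp: permutes_bij permutes_image permutes_in_image permutes_not_in)

lemma odd_permsI:
  assumes X: "symmetric X" and f: "\<And>a. a \<in> X \<Longrightarrow> f a \<in> X" "\<And>a. a \<notin> X \<Longrightarrow> f a = a"
    "\<And>a. a \<in> X \<Longrightarrow> f (- a) = - f a" and inj: "inj_on f X"
  shows "f \<in> odd_perms X"
proof -
  have "f ` X = X" using endo_inj_surj[OF symmetricD(1)[OF X]] f(1) inj by blast
  then have "f permutes X" using inj f(2) by (intro bij_imp_permutes) (auto simp: bij_betw_def)
  moreover have "f (- a) = - f a" for a
    using f(2,3)[of a] f(2)[of "- a"] symmetricD(3)[OF X, of a] symmetricD(3)[OF X, of "- a"]
    by (cases "a \<in> X") auto
  ultimately show ?thesis unfolding odd_perms_def by blast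
qed

lemma finite_odd_perms: "symmetric X \<Longrightarrow> finite (odd_perms X)"
  unfolding odd_perms_def using finite_permutations[OF symmetricD(1)]
  by (rule rev_finite_subset) auto

text \<open>\<open>unit_square \<eta> X y\<close> with \<open>\<eta> = 1\<close> or \<open>\<eta> = - 1\<close> says that all signed cycles of \<open>y\<close> on \<open>X\<close> have
  length at most two, and exactly two with class \<open>- 1\<close> if \<open>\<eta> = - 1\<close>.\<close>

definition unit_square :: "int \<Rightarrow> int set \<Rightarrow> (int \<Rightarrow> int) \<Rightarrow> bool" where
  "unit_square \<eta> X y \<longleftrightarrow> (\<eta> = 1 \<or> \<eta> = - 1) \<and> symmetric X \<and>
     (\<forall>a\<in>X. y a \<in> X \<and> y (- a) = - y a \<and> y (y a) = \<eta> * a)"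

lemma unit_squareD:
  assumes "unit_square \<eta> X y"
  shows "\<eta> = 1 \<or> \<eta> = - 1" "symmetric X" "a \<in> X \<Longrightarrow> y a \<in> X" "a \<in> X \<Longrightarrow> y (- a) = - y a"
    "a \<in> X \<Longrightarrow> y (y a) = \<eta> * a" "a \<in> X \<Longrightarrow> - a \<in> X" "a \<in> X \<Longrightarrow> a \<noteq> 0"
  using assms symmetricD unfolding unit_square_def by blast+

section \<open>Supports of signed cycles of length at most two, and base points in them\<close>

definition cyc :: "(int \<Rightarrow> int) \<Rightarrow> int \<Rightarrow> int set" where
  "cyc y a = {a, - a, y a, - y a}"

lemma cyc_eqs:
  assumes y: "unit_square \<eta> X y" and a: "a \<in> X"
  shows "cyc y (- a) = cyc y a" "cyc y (y a) = cyc y a" "cyc y a \<subseteq> X"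
  using unit_squareD(1)[OF y] unit_squareD(3-6)[OF y a] unit_squareD(6)[OF y, of "y a"] a
  unfolding cyc_def by auto

lemma cyc_mem_eq:
  assumes y: "unit_square \<eta> X y" and a: "a \<in> X" and c: "c \<in> cyc y a"
  shows "cyc y c = cyc y a"
proof -
  have ya: "y a \<in> X" using unit_squareD(3)[OF y a] .
  consider "c = a" | "c = - a" | "c = y a" | "c = - y a" using c unfolding cyc_def by auto
  then show ?thesis
    using cyc_eqs[OF y a] cyc_eqs(1)[OF y ya] by cases auto
qed

text \<open>The value of the character of the base factor at negation on the signed cycle of
  \<open>a\<close>. It is 1 on positive cycles. On a negative cycle, of length 1 in the first
  disjunct and of length 2 in the second, negation is the power of order 2 of the generator, where a
  faithful character is -1.\<close>

definition mu :: "(int \<Rightarrow> int) \<Rightarrow> int \<Rightarrow> complex" where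
  "mu y a = (if y a = - a \<or> y (y a) = - a then - 1 else 1)"

definition transversal :: "(int \<Rightarrow> int) \<Rightarrow> int set \<Rightarrow> int set \<Rightarrow> bool" where
  "transversal y X T \<longleftrightarrow> T \<subseteq> X \<and> inj_on (cyc y) T \<and> cyc y ` T = cyc y ` X"

text \<open>A function constant on each signed cycle descends to the set of signed cycles, where the
  choice of base points is no longer visible.\<close>

lemma prod_transversal:
  fixes f :: "int \<Rightarrow> complex"
  assumes y: "unit_square \<eta> X y" and T: "transversal y X T" and T': "transversal y X T'"
    and f: "\<And>a. a \<in> X \<Longrightarrow> f (- a) = f a" "\<And>a. a \<in> X \<Longrightarrow> f (y a) = f a"
  shows "prod f T = prod f T'"
proof -
  have f_cyc: "f c = f a" if "a \<in> X" "c \<in> cyc y a" for a c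
    using that f unit_squareD(3)[OF y that(1)] unfolding cyc_def by auto
  define F where "F Q = f (SOME a. a \<in> X \<and> cyc y a = Q)" for Q
  have F: "F (cyc y a) = f a" if a: "a \<in> X" for a
  proof -
    define b where "b = (SOME b. b \<in> X \<and> cyc y b = cyc y a)"
    have "b \<in> X \<and> cyc y b = cyc y a" unfolding b_def by (rule someI[of _ a]) (use a in auto)
    then have "b \<in> cyc y a" "b \<in> X" by (auto simp: cyc_def)
    then show ?thesis unfolding F_def b_def[symmetric] using f_cyc[OF a] by simp
  qed
  have "prod f S = prod F (cyc y ` X)" if S: "transversal y X S" for S
  proof -
    have "prod F (cyc y ` X) = prod F (cyc y ` S)" using S unfolding transversal_def by simp
    also have "\<dots> = prod (F \<circ> cyc y) S" using S unfolding transversal_def by (intro prod.reindex) auto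
    also have "\<dots> = prod f S" using S F unfolding transversal_def by (intro prod.cong) auto
    finally show ?thesis by simp
  qed
  then show ?thesis using T T' by simp
qed

lemma transversal_choice:
  assumes y: "unit_square \<eta> X y" and b: "\<And>Q. Q \<in> cyc y ` X \<Longrightarrow> b Q \<in> Q"
  shows "transversal y X (b ` cyc y ` X)"
    and "\<And>a. a \<in> X \<Longrightarrow> b (cyc y a) \<in> X \<and> cyc y (b (cyc y a)) = cyc y a"
proof -
  show *: "b (cyc y a) \<in> X \<and> cyc y (b (cyc y a)) = cyc y a" if "a \<in> X" for a
    using cyc_mem_eq[OF y that] b[of "cyc y a"] cyc_eqs(3)[OF y that] that by blast
  show "transversal y X (b ` cyc y ` X)" unfolding transversal_def
  proof (intro conjI)
    show "b ` cyc y ` X \<subseteq> X" using * by auto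
    show "inj_on (cyc y) (b ` cyc y ` X)" using * by (auto simp: inj_on_def)
    show "cyc y ` b ` cyc y ` X = cyc y ` X" using * by (auto simp: image_iff)
  qed
qed

definition commutes_on :: "int set \<Rightarrow> (int \<Rightarrow> int) \<Rightarrow> (int \<Rightarrow> int) \<Rightarrow> bool" where
  "commutes_on X g y \<longleftrightarrow> odd_bij g \<and> g ` X = X \<and> (\<forall>a\<in>X. y (g a) = g (y a))"

lemma commutes_onD:
  assumes "commutes_on X g y"
  shows "odd_bij g" "g ` X = X" "a \<in> X \<Longrightarrow> y (g a) = g (y a)" "a \<in> X \<Longrightarrow> g a \<in> X"
    "g (- a) = - g a" "g a = g b \<longleftrightarrow> a = b"
  using assms odd_bijD[of g] unfolding commutes_on_def by auto

lemma commutes_on_comp: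
  assumes g: "commutes_on X g y" and h: "commutes_on X h y"
  shows "commutes_on X (g \<circ> h) y"
  unfolding commutes_on_def
proof (intro conjI ballI)
  show "odd_bij (g \<circ> h)" using g h by (intro odd_bij_comp) (auto dest: commutes_onD)
  show "(g \<circ> h) ` X = X" using commutes_onD(2)[OF g] commutes_onD(2)[OF h] by (metis image_comp)
  fix a assume a: "a \<in> X"
  show "y ((g \<circ> h) a) = (g \<circ> h) (y a)"
    using commutes_onD(3)[OF h a] commutes_onD(3)[OF g commutes_onD(4)[OF h a]] by simp
qed

lemma cyc_commutes:
  assumes "commutes_on X g y" "a \<in> X"
  shows "cyc y (g a) = g ` cyc y a"
  using commutes_onD[OF assms(1)] assms(2) unfolding cyc_def by auto

lemma mu_commutes:
  assumes y: "unit_square \<eta> X y" and g: "commutes_on X g y" and a: "a \<in> X"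
  shows "mu y (g a) = mu y a"
proof -
  have "y (g a) = - g a \<longleftrightarrow> y a = - a"
    using commutes_onD(3)[OF g a] commutes_onD(5,6)[OF g] by metis
  moreover have "y (y (g a)) = - g a \<longleftrightarrow> y (y a) = - a"
    using commutes_onD(3)[OF g a] commutes_onD(3)[OF g, of "y a"] unit_squareD(3)[OF y a] commutes_onD(5,6)[OF g] by metis
  ultimately show ?thesis unfolding mu_def by simp
qed

text \<open>An element commuting with \<open>y\<close> permutes the signed cycles of
  \<open>y\<close>, so it turns one choice of base points into another.\<close>

lemma transversal_image:
  assumes y: "unit_square \<eta> X y" and g: "commutes_on X g y" and T: "transversal y X T"
  shows "transversal y X (g ` T)"
proof -
  have TX: "T \<subseteq> X" and inj: "inj_on (cyc y) T" and im: "cyc y ` T = cyc y ` X"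
    using T unfolding transversal_def by auto
  have ginj: "inj g" using odd_bijD(2)[OF commutes_onD(1)[OF g]] .
  have cg: "cyc y ` g ` S = image g ` cyc y ` S" if "S \<subseteq> X" for S
    unfolding image_image using that cyc_commutes[OF g] by (intro image_cong) auto
  show ?thesis unfolding transversal_def
  proof (intro conjI)
    show "g ` T \<subseteq> X" using TX commutes_onD(2)[OF g] by blast
    show "inj_on (cyc y) (g ` T)"
    proof (rule inj_onI)
      fix u v assume "u \<in> g ` T" "v \<in> g ` T" "cyc y u = cyc y v"
      then obtain a b where ab: "a \<in> T" "b \<in> T" "u = g a" "v = g b" "cyc y (g a) = cyc y (g b)" by auto
      then have "g ` cyc y a = g ` cyc y b" using cyc_commutes[OF g] TX by (metis subsetD)
      then have "cyc y a = cyc y b" using ginj by (simp add: inj_image_eq_iff)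
      then show "u = v" using inj ab by (simp add: inj_on_eq_iff)
    qed
    show "cyc y ` g ` T = cyc y ` X"
      using cg[OF TX] cg[of X] im commutes_onD(2)[OF g] by simp
  qed
qed

text \<open>\<open>\<iota>\<close> stands for the value of a faithful character of the cyclic group
  of order 4 at its generator. Either square root of -1 may occur.\<close>

locale quartic_root =
  fixes \<iota> :: complex
  assumes iota: "\<iota> * \<iota> = - 1"
begin

lemma iota_nonzero [simp]: "\<iota> \<noteq> 0"
  using iota by auto

text \<open>The value of the character of the base factor at the cycle itself. The middle case
  covers both generators of order 2: a positive cycle of length 2 and a negative cycle of length
  1.\<close>

definition kap :: "(int \<Rightarrow> int) \<Rightarrow> int \<Rightarrow> complex" where
  "kap y a = (if y a = a then 1 else if y (y a) = a then - 1 else \<iota>)"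

text \<open>On a signed cycle, a potential is a nonzero multiple of the chosen character of the base factor, read off
  along the cycle.\<close>

definition potential :: "(int \<Rightarrow> int) \<Rightarrow> int set \<Rightarrow> (int \<Rightarrow> complex) \<Rightarrow> bool" where
  "potential y X p \<longleftrightarrow>
     (\<forall>a\<in>X. p a \<noteq> 0 \<and> p (- a) = mu y a * p a \<and> p (y a) = kap y a * p a)"

lemma potentialD:
  assumes "potential y X p" "a \<in> X"
  shows "p a \<noteq> 0" "p (- a) = mu y a * p a" "p (y a) = kap y a * p a"
  using assms unfolding potential_def by auto

lemma mu_kap_nonzero [simp]: "mu y a \<noteq> 0" "kap y a \<noteq> 0"
  unfolding mu_def kap_def by auto

lemma kap_commutes:
  assumes y: "unit_square \<eta> X y" and g: "commutes_on X g y" and a: "a \<in> X"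
  shows "kap y (g a) = kap y a"
proof -
  have "y (g a) = g a \<longleftrightarrow> y a = a"
    using commutes_onD(3)[OF g a] commutes_onD(5,6)[OF g] by metis
  moreover have "y (y (g a)) = g a \<longleftrightarrow> y (y a) = a"
    using commutes_onD(3)[OF g a] commutes_onD(3)[OF g, of "y a"] unit_squareD(3)[OF y a] commutes_onD(5,6)[OF g] by metis
  ultimately show ?thesis unfolding kap_def by simp
qed

text \<open>If \<open>p\<close> is 1 at all base points in \<open>T\<close>, the factor at
  \<open>a\<close> is the base character of the element taking the base point of the target cycle to
  \<open>g a\<close>; the product is then the wreath product character, trivial on elements that
  permute the base points. Keeping \<open>T\<close> and \<open>p\<close> arbitrary removes the base
  points from the notation, and \<open>weight_unique\<close> shows that the choice has only one
  possible value.\<close>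

definition weight :: "int set \<Rightarrow> (int \<Rightarrow> int) \<Rightarrow> (int \<Rightarrow> int) \<Rightarrow> complex" where
  "weight X y g = (SOME v. \<exists>T p. transversal y X T \<and> potential y X p \<and> v = (\<Prod>a\<in>T. p (g a) / p a))"

text \<open>As \<open>g\<close> preserves the multipliers \<open>mu\<close> and \<open>kap\<close>,
  the ratio \<open>p (g a) / p a\<close> is constant on signed cycles, so base points may be
  exchanged. Two potentials differ by a factor that is constant on signed cycles; \<open>g\<close>
  only permutes its values, so it cancels in the product.\<close>

lemma weight_unique:
  assumes y: "unit_square \<eta> X y" and g: "commutes_on X g y"
    and T: "transversal y X T" "transversal y X T'" and p: "potential y X p" "potential y X p'"
  shows "(\<Prod>a\<in>T. p (g a) / p a) = (\<Prod>a\<in>T'. p' (g a) / p' a)"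
proof -
  have ratio: "p (g (- a)) / p (- a) = p (g a) / p a" "p (g (y a)) / p (y a) = p (g a) / p a" if a: "a \<in> X" for a
  proof -
    have ga: "g a \<in> X" using commutes_onD(4)[OF g a] .
    show "p (g (- a)) / p (- a) = p (g a) / p a"
      using potentialD[OF p(1) a] potentialD[OF p(1) ga] mu_commutes[OF y g a] commutes_onD(5)[OF g]
      by simp
    show "p (g (y a)) / p (y a) = p (g a) / p a"
      using potentialD[OF p(1) a] potentialD[OF p(1) ga] kap_commutes[OF y g a]
      by (simp add: commutes_onD(3)[OF g a, symmetric])
  qed
  define c where "c a = p' a / p a" for a
  have c: "c a \<noteq> 0" "c (- a) = c a" "c (y a) = c a" if "a \<in> X" for a
    unfolding c_def using potentialD[OF p(1) that] potentialD[OF p(2) that] by auto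
  have T'X: "T' \<subseteq> X" and fin: "finite T'"
    using T(2) symmetricD(1)[OF unit_squareD(2)[OF y]] finite_subset unfolding transversal_def by auto
  have ginj: "inj_on g T'" using odd_bijD(2)[OF commutes_onD(1)[OF g]] by (rule inj_on_subset) simp
  have "(\<Prod>a\<in>T'. c (g a)) = prod c (g ` T')" using ginj by (simp add: prod.reindex)
  also have "\<dots> = prod c T'"
    using c by (intro prod_transversal[OF y transversal_image[OF y g T(2)] T(2)]) auto
  finally have cc: "(\<Prod>a\<in>T'. c (g a)) = prod c T'" .
  have cnz: "prod c T' \<noteq> 0" using c fin T'X by auto
  have "(\<Prod>a\<in>T. p (g a) / p a) = (\<Prod>a\<in>T'. p (g a) / p a)"
    by (rule prod_transversal[OF y T]) (use ratio in auto)
  also have "\<dots> = (\<Prod>a\<in>T'. p (g a) / p a) * ((\<Prod>a\<in>T'. c (g a)) / prod c T')" using cc cnz by simp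
  also have "\<dots> = (\<Prod>a\<in>T'. p (g a) / p a * (c (g a) / c a))" by (simp add: prod.distrib prod_dividef)
  also have "\<dots> = (\<Prod>a\<in>T'. p' (g a) / p' a)"
  proof (intro prod.cong refl)
    fix a assume "a \<in> T'"
    then have a: "a \<in> X" and ga: "g a \<in> X" using T'X commutes_onD(4)[OF g] by auto
    show "p (g a) / p a * (c (g a) / c a) = p' (g a) / p' a"
      unfolding c_def using potentialD(1)[OF p(1) a] potentialD(1)[OF p(1) ga] potentialD(1)[OF p(2) a] by (simp add: field_simps)
  qed
  finally show ?thesis .
qed

lemma weight_eq:
  assumes "unit_square \<eta> X y" "commutes_on X g y" "transversal y X T" "potential y X p"
  shows "weight X y g = (\<Prod>a\<in>T. p (g a) / p a)"
proof -
  have "\<exists>T p. transversal y X T \<and> potential y X p \<and> weight X y g = (\<Prod>a\<in>T. p (g a) / p a)"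
    unfolding weight_def by (rule someI_ex) (use assms in blast)
  then obtain T' p' where "transversal y X T'" "potential y X p'" "weight X y g = (\<Prod>a\<in>T'. p' (g a) / p' a)"
    by blast
  then show ?thesis using weight_unique[OF assms(1,2) _ assms(3) _ assms(4)] by simp
qed

text \<open>The potential normalized to 1 at the base points. When entries of a cycle coincide the
  first matching test decides, consistently with the others: both multipliers are 1 if
  \<open>y a = a\<close> and both are -1 if \<open>y a = - a\<close>.\<close>

definition base_potential :: "(int \<Rightarrow> int) \<Rightarrow> (int set \<Rightarrow> int) \<Rightarrow> int \<Rightarrow> complex" where
  "base_potential y b c = (let a = b (cyc y c) in
     if c = a then 1 else if c = - a then mu y a else if c = y a then kap y a else mu y a * kap y a)"

lemma base_potential:
  assumes y: "unit_square \<eta> X y" and b: "\<And>Q. Q \<in> cyc y ` X \<Longrightarrow> b Q \<in> Q"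
  shows "potential y X (base_potential y b)"
    and "\<And>a. a \<in> b ` cyc y ` X \<Longrightarrow> base_potential y b a = 1"
proof -
  have ch: "b (cyc y a) \<in> X \<and> cyc y (b (cyc y a)) = cyc y a" if "a \<in> X" for a
    using transversal_choice(2)[OF y _ that] b by blast
  show "base_potential y b a = 1" if "a \<in> b ` cyc y ` X" for a
    using that ch unfolding base_potential_def Let_def by fastforce
  show "potential y X (base_potential y b)" unfolding potential_def
  proof (intro ballI)
    fix c assume c: "c \<in> X"
    define a where "a = b (cyc y c)"
    have a: "a \<in> X" "cyc y a = cyc y c" using ch[OF c] unfolding a_def by auto
    have n: "a \<noteq> 0" "y a \<in> X" "y (- a) = - y a" "y (y a) = \<eta> * a" "y (- y a) = - (\<eta> * a)"
      using unit_squareD(3-7)[OF y a(1)] unit_squareD(4)[OF y, of "y a"] by auto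
    have yc: "y c \<in> X" and mc: "- c \<in> X" using unit_squareD(3-7)[OF y c] by auto
    have bc: "b (cyc y (- c)) = a" "b (cyc y (y c)) = a" unfolding a_def using cyc_eqs[OF y c] by simp_all
    have "c \<in> cyc y a" unfolding a(2) by (simp add: cyc_def)
    then consider "c = a" | "c = - a" | "c = y a" | "c = - y a" unfolding cyc_def by auto
    note c_cases = this
    define M K where "M = mu y a" and "K = kap y a"
    have eta: "\<eta> = 1 \<or> \<eta> = - 1" using unit_squareD(1)[OF y] .
    have neg: "y a \<noteq> a \<and> y a \<noteq> - a \<and> M = - 1" if "\<eta> = - 1"
      using that n unfolding M_def mu_def by auto
    have MK: "M * M = 1" "K * K = of_int \<eta>" "M \<noteq> 0" "K \<noteq> 0"
      using n eta iota unfolding M_def K_def mu_def kap_def by auto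
    have fx: "K = 1 \<and> M = 1" if "y a = a"
      using that n unfolding M_def K_def mu_def kap_def by auto
    have neg1: "K = - 1 \<and> M = - 1" if "y a = - a"
      using that n unfolding M_def K_def mu_def kap_def by auto
    have flip: "a = y a \<longleftrightarrow> y a = a" "a = - y a \<longleftrightarrow> y a = - a" "- a = y a \<longleftrightarrow> y a = - a" by auto
    have ya0: "y a \<noteq> 0" using symmetricD(4)[OF unit_squareD(2)[OF y] n(2)] .
    have rot: "mu y (y a) = M \<and> kap y (y a) = K"
      using eta
    proof
      assume "\<eta> = 1"
      then have e: "y (y a) = a" using n(4) by simp
      show ?thesis unfolding M_def K_def mu_def kap_def e using ya0 n(1) by (simp add: flip)
    next
      assume "\<eta> = - 1"
      then have e: "y (y a) = - a" and e': "y (- a) = - y a" using n(3,4) by simp_all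
      show ?thesis unfolding M_def K_def mu_def kap_def e e' using ya0 n(1) e neg[OF \<open>\<eta> = - 1\<close>] by (simp add: flip)
    qed
    have opp: "mu y (- d) = mu y d \<and> kap y (- d) = kap y d" if d: "d \<in> X" for d
      using unit_squareD(3-7)[OF y d] unit_squareD(4)[OF y, of "y d"] unfolding mu_def kap_def by auto
    have "mu y c = M \<and> kap y c = K"
      using c_cases
    proof cases
      case 1
      then show ?thesis unfolding M_def K_def by simp
    next
      case 2
      then show ?thesis using opp[OF a(1)] unfolding M_def K_def by simp
    next
      case 3
      then show ?thesis using rot by simp
    next
      case 4
      then show ?thesis using opp[OF n(2)] rot by simp
    qed
    then have mk: "mu y c = M" "kap y c = K" by auto
    define B where "B z = (if z = a then 1 else if z = - a then M else if z = y a then K else M * K)" for z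
    have B: "base_potential y b c = B c" "base_potential y b (- c) = B (- c)" "base_potential y b (y c) = B (y c)"
      unfolding base_potential_def Let_def bc a_def[symmetric] B_def M_def K_def by auto
    have Ba: "B a = 1" "B (- a) = M" "B (y a) = K" "B (- y a) = M * K"
      using n fx neg1 MK unfolding B_def by auto
    have "B c \<noteq> 0 \<and> B (- c) = M * B c \<and> B (y c) = K * B c"
      using c_cases
    proof cases
      case 1
      then show ?thesis using Ba MK by simp
    next
      case 2
      then show ?thesis using Ba MK n by simp
    next
      case 3
      have "B (\<eta> * a) = of_int \<eta>" using eta Ba neg by auto
      with 3 show ?thesis using Ba MK n by simp
    next
      case 4
      have "B (- (\<eta> * a)) = M * of_int \<eta>" using eta Ba neg by auto
      with 4 show ?thesis using Ba MK n by (simp add: algebra_simps)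
    qed
    then show "base_potential y b c \<noteq> 0 \<and> base_potential y b (- c) = mu y c * base_potential y b c \<and>
        base_potential y b (y c) = kap y c * base_potential y b c"
      unfolding B mk .
  qed
qed

lemma ex_transversal_potential:
  assumes y: "unit_square \<eta> X y"
  obtains T p where "transversal y X T" "potential y X p"
proof -
  have "(SOME a. a \<in> Q) \<in> Q" if "Q \<in> cyc y ` X" for Q
  proof (rule someI_ex[of "\<lambda>a. a \<in> Q"])
    show "\<exists>a. a \<in> Q" using that unfolding cyc_def by blast
  qed
  from transversal_choice(1)[OF y this] base_potential(1)[OF y this] that show thesis by blast
qed

lemma weight_cong:
  assumes y: "unit_square \<eta> X y" and g: "commutes_on X g y" and eq: "\<And>a. a \<in> X \<Longrightarrow> y' a = y a"
  shows "weight X y' g = weight X y g"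
proof -
  obtain T p where Tp: "transversal y X T" "potential y X p" using ex_transversal_potential[OF y] by blast
  have c: "cyc y' a = cyc y a" if "a \<in> X" for a using eq that unfolding cyc_def by simp
  have y': "unit_square \<eta> X y'" using y eq symmetricD(3)[OF unit_squareD(2)[OF y]] unfolding unit_square_def by auto
  have g': "commutes_on X g y'" using g eq commutes_onD(4)[OF g] unfolding commutes_on_def by auto
  have T: "transversal y' X T"
    using Tp(1) c unfolding transversal_def by (auto simp: inj_on_def image_iff subset_eq)
  have p: "potential y' X p" using Tp(2) eq unit_squareD(3)[OF y] unfolding potential_def mu_def kap_def by auto
  show ?thesis unfolding weight_eq[OF y g Tp] weight_eq[OF y' g' T p] ..
qed

text \<open>Computing the weight of \<open>g\<close> on the images under \<open>h\<close> of the
  base points in \<open>T\<close> makes the values of \<open>p\<close> at \<open>h a\<close>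
  cancel.\<close>

lemma weight_comp:
  assumes y: "unit_square \<eta> X y" and g: "commutes_on X g y" and h: "commutes_on X h y"
  shows "weight X y (g \<circ> h) = weight X y g * weight X y h"
proof -
  obtain T p where Tp: "transversal y X T" "potential y X p" using ex_transversal_potential[OF y] by blast
  have TX: "T \<subseteq> X" using Tp unfolding transversal_def by simp
  have "weight X y g = (\<Prod>a\<in>h ` T. p (g a) / p a)"
    by (rule weight_eq[OF y g transversal_image[OF y h Tp(1)] Tp(2)])
  also have "\<dots> = (\<Prod>a\<in>T. p (g (h a)) / p (h a))"
    by (subst prod.reindex[OF odd_bij_inj_on[OF commutes_onD(1)[OF h]]]) simp
  finally have "weight X y g * weight X y h = (\<Prod>a\<in>T. p (g (h a)) / p (h a) * (p (h a) / p a))"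
    unfolding weight_eq[OF y h Tp] prod.distrib by simp
  also have "\<dots> = (\<Prod>a\<in>T. p ((g \<circ> h) a) / p a)"
    using TX potentialD(1)[OF Tp(2)] commutes_onD(4)[OF h] by (intro prod.cong refl) (auto simp: subset_eq)
  also have "\<dots> = weight X y (g \<circ> h)" by (rule weight_eq[OF y commutes_on_comp[OF g h] Tp, symmetric])
  finally show ?thesis ..
qed

lemma weight_nonzero:
  assumes y: "unit_square \<eta> X y" and g: "commutes_on X g y"
  shows "weight X y g \<noteq> 0"
proof -
  obtain T p where Tp: "transversal y X T" "potential y X p" using ex_transversal_potential[OF y] by blast
  have TX: "T \<subseteq> X" "finite T" using Tp symmetricD(1)[OF unit_squareD(2)[OF y]] finite_subset unfolding transversal_def by auto
  then show ?thesis unfolding weight_eq[OF y g Tp]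
    using potentialD(1)[OF Tp(2)] commutes_onD(4)[OF g] by auto
qed

text \<open>Relabelling by \<open>t\<close> carries base points and potentials of \<open>y\<close>
  to those of \<open>y'\<close>. With \<open>t\<close> in B_n this turns the sum defining an induced
  character into a sum over a conjugacy class.\<close>

lemma weight_transport:
  assumes y: "unit_square \<eta> X y" and g: "commutes_on X g y"
    and t: "odd_bij t" "t ` X = X"
    and y': "\<And>a. a \<in> X \<Longrightarrow> y' (t a) = t (y a)" and g': "odd_bij g'" "\<And>a. a \<in> X \<Longrightarrow> g' (t a) = t (g a)"
  shows "unit_square \<eta> X y'" "commutes_on X g' y'" "weight X y' g' = weight X y g"
proof -
  obtain T p where Tp: "transversal y X T" "potential y X p" using ex_transversal_potential[OF y] by blast
  have TX: "T \<subseteq> X" using Tp unfolding transversal_def by simp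
  have tX: "t a \<in> X" if "a \<in> X" for a using t(2) that by auto
  have inv_t: "inv_into UNIV t (t a) = a" for a using odd_bijD(2)[OF t(1)] by simp
  note tD = odd_bijD(3,4)[OF t(1)]
  have ex: "\<exists>a\<in>X. u = t a" if "u \<in> X" for u using t(2) that by auto
  have tX0: "symmetric X" using unit_squareD(2)[OF y] .
  show y'': "unit_square \<eta> X y'" unfolding unit_square_def
  proof (intro conjI ballI)
    fix u assume "u \<in> X"
    then obtain a where a: "a \<in> X" "u = t a" using ex by blast
    note ya = unit_squareD(3-7)[OF y a(1)]
    show "y' u \<in> X" using y'[OF a(1)] tX ya a by auto
    have "y' (t (- a)) = t (y (- a))" using y' ya by blast
    then show "y' (- u) = - y' u" using a y' ya tD by simp
    have "t (\<eta> * a) = \<eta> * t a" using unit_squareD(1)[OF y] tD by auto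
    then show "y' (y' u) = \<eta> * u" using a y'[OF a(1)] y'[of "y a"] ya by simp
  qed (use unit_squareD(1)[OF y] tX0 in auto)
  have g'X: "g' ` X = X"
  proof -
    have "g' ` X = g' ` t ` X" using t(2) by simp
    also have "\<dots> = t ` g ` X" unfolding image_image using g'(2) by (intro image_cong) auto
    finally show ?thesis using commutes_onD(2)[OF g] t(2) by simp
  qed
  show g'': "commutes_on X g' y'" unfolding commutes_on_def
  proof (intro conjI ballI g'X g'(1))
    fix u assume "u \<in> X"
    then obtain a where a: "a \<in> X" "u = t a" using ex by blast
    show "y' (g' u) = g' (y' u)"
      using a g'(2) y' commutes_onD(3,4)[OF g a(1)] unit_squareD(3)[OF y a(1)] by simp
  qed
  have cyc_t: "cyc y' (t a) = t ` cyc y a" if "a \<in> X" for a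
    using y'[OF that] tD unfolding cyc_def by auto
  have T': "transversal y' X (t ` T)" unfolding transversal_def
  proof (intro conjI)
    show "t ` T \<subseteq> X" using TX tX by auto
    show "inj_on (cyc y') (t ` T)"
    proof (rule inj_onI)
      fix u v assume "u \<in> t ` T" "v \<in> t ` T" "cyc y' u = cyc y' v"
      then obtain a b where ab: "a \<in> T" "b \<in> T" "u = t a" "v = t b" "cyc y' (t a) = cyc y' (t b)" by auto
      then have "t ` cyc y a = t ` cyc y b" using cyc_t TX by (metis subsetD)
      then have "cyc y a = cyc y b" using odd_bijD(2)[OF t(1)] by (simp add: inj_image_eq_iff)
      moreover have "inj_on (cyc y) T" using Tp(1) unfolding transversal_def by simp
      ultimately show "u = v" using ab inj_onD by metis
    qed
    have *: "cyc y' ` t ` S = image t ` cyc y ` S" if "S \<subseteq> X" for S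
      unfolding image_image using cyc_t that by (intro image_cong) auto
    show "cyc y' ` t ` T = cyc y' ` X"
      using *[OF TX] *[of X] Tp(1) t(2) unfolding transversal_def by simp
  qed
  have p': "potential y' X (p \<circ> inv_into UNIV t)" unfolding potential_def
  proof (intro ballI)
    fix u assume "u \<in> X"
    then obtain a where a: "a \<in> X" "u = t a" using ex by blast
    note ya = unit_squareD(3-7)[OF y a(1)]
    have "y' (y' u) = t (y (y a))" using a y' ya by simp
    then have "y' u = u \<longleftrightarrow> y a = a" "y' u = - u \<longleftrightarrow> y a = - a" "y' (y' u) = u \<longleftrightarrow> y (y a) = a"
      "y' (y' u) = - u \<longleftrightarrow> y (y a) = - a"
      unfolding a(2) y'[OF a(1)] tD(1)[of a, symmetric] using tD(2) by simp_all
    then have "mu y' u = mu y a" "kap y' u = kap y a" unfolding mu_def kap_def by simp_all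
    moreover have "inv_into UNIV t (- u) = - a" "inv_into UNIV t (y' u) = y a" "inv_into UNIV t u = a"
      using a inv_t y'[OF a(1)] tD(1)[of a, symmetric] by simp_all
    ultimately show "(p \<circ> inv_into UNIV t) u \<noteq> 0 \<and> (p \<circ> inv_into UNIV t) (- u) = mu y' u * (p \<circ> inv_into UNIV t) u \<and>
      (p \<circ> inv_into UNIV t) (y' u) = kap y' u * (p \<circ> inv_into UNIV t) u"
      using potentialD[OF Tp(2) a(1)] by simp
  qed
  have "weight X y' g' = (\<Prod>a\<in>T. (p \<circ> inv_into UNIV t) (g' (t a)) / (p \<circ> inv_into UNIV t) (t a))"
    unfolding weight_eq[OF y'' g'' T' p'] by (subst prod.reindex[OF odd_bij_inj_on[OF t(1)]]) simp
  also have "\<dots> = weight X y g" unfolding weight_eq[OF y g Tp]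
    using TX g'(2) inv_t by (intro prod.cong refl) (auto simp: subset_eq)
  finally show "weight X y' g' = weight X y g" .
qed

text \<open>Base points and potentials on disjoint invariant supports can be chosen independently
  and then united.\<close>

lemma weight_split:
  assumes U: "unit_square \<eta> U y" and V: "unit_square \<eta> V y" and d: "U \<inter> V = {}"
    and gU: "commutes_on U g y" and gV: "commutes_on V g y"
  shows "weight (U \<union> V) y g = weight U y g * weight V y g"
proof -
  obtain T p where Tp: "transversal y U T" "potential y U p" using ex_transversal_potential[OF U] by blast
  obtain S q where Sq: "transversal y V S" "potential y V q" using ex_transversal_potential[OF V] by blast
  have y: "unit_square \<eta> (U \<union> V) y" using U V unfolding unit_square_def symmetric_def by auto
  have g: "commutes_on (U \<union> V) g y" using gU gV unfolding commutes_on_def by auto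
  have TU: "T \<subseteq> U" and SV: "S \<subseteq> V" using Tp Sq unfolding transversal_def by auto
  define r where "r a = (if a \<in> U then p a else q a)" for a
  have rU: "r a = p a" if "a \<in> U" for a using that unfolding r_def by simp
  have rV: "r a = q a" if "a \<in> V" for a using that d unfolding r_def by auto
  have r: "potential y (U \<union> V) r" unfolding potential_def
  proof
    fix a assume "a \<in> U \<union> V"
    then show "r a \<noteq> 0 \<and> r (- a) = mu y a * r a \<and> r (y a) = kap y a * r a"
      using rU rV unit_squareD(3,6)[OF U, of a] unit_squareD(3,6)[OF V, of a]
        potentialD[OF Tp(2), of a] potentialD[OF Sq(2), of a] by auto
  qed
  have TS: "transversal y (U \<union> V) (T \<union> S)" unfolding transversal_def
  proof (intro conjI)
    have "cyc y a \<noteq> cyc y b" if "a \<in> U" "b \<in> V" for a b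
      using cyc_eqs(3)[OF U that(1)] cyc_eqs(3)[OF V that(2)] d unfolding cyc_def by blast
    then have ne: "cyc y a \<noteq> cyc y b" if "a \<in> T" "b \<in> S" for a b using that TU SV by auto
    have "inj_on (cyc y) T" "inj_on (cyc y) S" using Tp(1) Sq(1) unfolding transversal_def by auto
    then show "inj_on (cyc y) (T \<union> S)"
      unfolding inj_on_def using ne by (metis Un_iff)
  qed (use Tp Sq in \<open>auto simp: transversal_def image_Un\<close>)
  have fin: "finite T" "finite S"
    using TU SV finite_subset symmetricD(1)[OF unit_squareD(2)[OF U]] symmetricD(1)[OF unit_squareD(2)[OF V]] by auto
  have "weight (U \<union> V) y g = (\<Prod>a\<in>T. r (g a) / r a) * (\<Prod>a\<in>S. r (g a) / r a)"
    unfolding weight_eq[OF y g TS r] using fin TU SV d by (intro prod.union_disjoint) auto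
  also have "(\<Prod>a\<in>T. r (g a) / r a) = (\<Prod>a\<in>T. p (g a) / p a)"
    using TU rU commutes_onD(4)[OF gU] by (intro prod.cong refl) (auto simp: subset_eq)
  also have "(\<Prod>a\<in>S. r (g a) / r a) = (\<Prod>a\<in>S. q (g a) / q a)"
    using SV rV commutes_onD(4)[OF gV] by (intro prod.cong refl) (auto simp: subset_eq)
  finally show ?thesis unfolding weight_eq[OF U gU Tp] weight_eq[OF V gV Sq] .
qed

end

section \<open>Two exchanged signed cycles\<close>

lemma odd_bij_funpow: "odd_bij g \<Longrightarrow> odd_bij (g ^^ k)"
  by (induction k) (auto simp: odd_bij_comp, simp add: odd_bij_def)

lemma funpow_in: "g ` X = X \<Longrightarrow> a \<in> X \<Longrightarrow> (g ^^ k) a \<in> X"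
  by (induction k) auto

lemma funpow_commute_on:
  assumes "\<And>a. a \<in> X \<Longrightarrow> y (g a) = g (y a)" "g ` X = X" "a \<in> X"
  shows "y ((g ^^ k) a) = (g ^^ k) (y a)"
proof (induction k)
  case (Suc k)
  show ?case using Suc assms(1)[OF funpow_in[OF assms(2,3), of k]] by simp
qed simp

lemma funpow_add_apply: "(f ^^ (i + j)) x = (f ^^ i) ((f ^^ j) x)"
  by (simp add: funpow_add)

lemma odd_sign: "odd_bij g \<Longrightarrow> s = 1 \<or> s = - 1 \<Longrightarrow> g (s * a) = s * g a"
  using odd_bijD(3) by auto

lemma symmetric_sign: "symmetric X \<Longrightarrow> s = 1 \<or> s = - 1 \<Longrightarrow> a \<in> X \<Longrightarrow> s * a \<in> X"
  using symmetricD(3) by auto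

lemma odd_perms_sign: "w \<in> odd_perms X \<Longrightarrow> s = 1 \<or> s = - 1 \<Longrightarrow> w (s * a) = s * w a"
  using odd_permsD(2) by auto

definition signed_orbit :: "(int \<Rightarrow> int) \<Rightarrow> int \<Rightarrow> int set" where
  "signed_orbit g q = {a. \<exists>s k. (s = 1 \<or> s = - 1) \<and> a = s * (g ^^ k) q}"

lemma signed_orbitI: "s = 1 \<or> s = - 1 \<Longrightarrow> s * (g ^^ k) q \<in> signed_orbit g q"
  unfolding signed_orbit_def by blast

lemma signed_orbitE:
  assumes "a \<in> signed_orbit g q"
  obtains s k where "s = 1 \<or> s = - 1" "a = s * (g ^^ k) q"
  using assms unfolding signed_orbit_def by blast

lemma signed_orbit_self: "q \<in> signed_orbit g q"
  using signed_orbitI[where s = 1 and g = g and k = 0 and q = q] by simp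

lemma signed_orbit_props:
  assumes X: "symmetric X" and g: "odd_bij g" "g ` X = X" and q: "q \<in> X"
  shows "signed_orbit g q \<subseteq> X" "symmetric (signed_orbit g q)" "g ` signed_orbit g q = signed_orbit g q"
proof -
  show sub: "signed_orbit g q \<subseteq> X"
    using funpow_in[OF g(2) q] symmetric_sign[OF X] unfolding signed_orbit_def by blast
  have neg: "- a \<in> signed_orbit g q" if a: "a \<in> signed_orbit g q" for a
  proof -
    obtain s k where s: "s = 1 \<or> s = - 1" "a = s * (g ^^ k) q" using a by (rule signed_orbitE)
    then show ?thesis using signed_orbitI[where s = "- s" and g = g and k = k and q = q] by auto
  qed
  show sym: "symmetric (signed_orbit g q)"
    unfolding symmetric_def using neg sub symmetricD(1,2)[OF X] finite_subset by blast
  have "g a \<in> signed_orbit g q" if a: "a \<in> signed_orbit g q" for a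
  proof -
    obtain s k where s: "s = 1 \<or> s = - 1" "a = s * (g ^^ k) q" using a by (rule signed_orbitE)
    then show ?thesis using signed_orbitI[where s = s and g = g and k = "Suc k" and q = q] odd_sign[OF g(1) s(1)] by simp
  qed
  then show "g ` signed_orbit g q = signed_orbit g q"
    using endo_inj_surj[OF symmetricD(1)[OF sym] _ odd_bij_inj_on[OF g(1)]] by blast
qed

lemma symmetric_Un: "symmetric A \<Longrightarrow> symmetric B \<Longrightarrow> symmetric (A \<union> B)"
  unfolding symmetric_def by auto

lemma symmetric_Diff: "symmetric A \<Longrightarrow> symmetric B \<Longrightarrow> symmetric (A - B)"
  unfolding symmetric_def by auto

lemma image_Diff_invariant:
  "odd_bij g \<Longrightarrow> g ` X = X \<Longrightarrow> g ` U = U \<Longrightarrow> g ` (X - U) = X - U"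
  using image_set_diff[OF odd_bijD(2)] by metis

text \<open>A common point puts some power of \<open>g\<close> applied to \<open>r\<close> into the
  orbit of \<open>q\<close>; powers of \<open>g\<close> permute that orbit, and injectivity then
  pulls \<open>r\<close> itself into it.\<close>

lemma signed_orbit_disjoint:
  assumes X: "symmetric X" and g: "odd_bij g" "g ` X = X" and q: "q \<in> X"
    and r: "r \<notin> signed_orbit g q"
  shows "signed_orbit g q \<inter> signed_orbit g r = {}"
proof (rule ccontr)
  note A = signed_orbit_props[OF X g q]
  assume "\<not> ?thesis"
  then obtain c where c: "c \<in> signed_orbit g q" "c \<in> signed_orbit g r" by blast
  from c(2) obtain s k where s: "s = 1 \<or> s = - 1" "c = s * (g ^^ k) r" by (rule signed_orbitE)
  then have "(g ^^ k) r = s * c" by auto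
  then have k: "(g ^^ k) r \<in> signed_orbit g q" using symmetric_sign[OF A(2) s(1) c(1)] by simp
  have "(g ^^ k) ` signed_orbit g q = signed_orbit g q"
  proof (induction k)
    case (Suc k)
    have "(g ^^ Suc k) ` signed_orbit g q = g ` (g ^^ k) ` signed_orbit g q" by (simp add: image_comp)
    then show ?case using Suc A(3) by simp
  qed simp
  with k obtain a where "a \<in> signed_orbit g q" "(g ^^ k) r = (g ^^ k) a" by (metis imageE)
  then have "r \<in> signed_orbit g q" using odd_bijD(4)[OF odd_bij_funpow[OF g(1)]] by metis
  with r show False ..
qed

text \<open>The inverse map cuts a permutation down to \<open>U\<close> and to \<open>V\<close>. By
  finiteness, mapping \<open>U\<close> into itself already forces an injective map to preserve both
  parts.\<close>

lemma bij_betw_glue: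
  assumes U: "symmetric U" and V: "symmetric V" and d: "U \<inter> V = {}"
  shows "bij_betw (\<lambda>(u, v). u \<circ> v) (odd_perms U \<times> odd_perms V) {y \<in> odd_perms (U \<union> V). y ` U \<subseteq> U}"
    and "\<And>u v a. u \<in> odd_perms U \<Longrightarrow> v \<in> odd_perms V \<Longrightarrow> a \<in> U \<Longrightarrow> (u \<circ> v) a = u a"
    and "\<And>u v a. u \<in> odd_perms U \<Longrightarrow> v \<in> odd_perms V \<Longrightarrow> a \<in> V \<Longrightarrow> (u \<circ> v) a = v a"
proof -
  show onU: "(u \<circ> v) a = u a" if "u \<in> odd_perms U" "v \<in> odd_perms V" "a \<in> U" for u v a
  proof -
    have "a \<notin> V" using that(3) d by blast
    then show ?thesis using odd_permsD(6)[OF that(2)] by simp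
  qed
  show onV: "(u \<circ> v) a = v a" if "u \<in> odd_perms U" "v \<in> odd_perms V" "a \<in> V" for u v a
  proof -
    have "v a \<notin> U" using odd_permsD(5)[OF that(2,3)] d by blast
    then show ?thesis using odd_permsD(6)[OF that(1)] by simp
  qed
  define res where "res S y = (\<lambda>a. if a \<in> S then y a else a)" for S :: "int set" and y :: "int \<Rightarrow> int"
  show "bij_betw (\<lambda>(u, v). u \<circ> v) (odd_perms U \<times> odd_perms V) {y \<in> odd_perms (U \<union> V). y ` U \<subseteq> U}"
  proof (rule bij_betw_byWitness[where f' = "\<lambda>y. (res U y, res V y)"])
    show "\<forall>uv\<in>odd_perms U \<times> odd_perms V. (res U (case uv of (u, v) \<Rightarrow> u \<circ> v), res V (case uv of (u, v) \<Rightarrow> u \<circ> v)) = uv"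
      using onU onV by (auto simp: res_def fun_eq_iff intro: odd_permsD(6)[symmetric])
    show "\<forall>y\<in>{y \<in> odd_perms (U \<union> V). y ` U \<subseteq> U}. (case (res U y, res V y) of (u, v) \<Rightarrow> u \<circ> v) = y"
    proof
      fix y assume "y \<in> {y \<in> odd_perms (U \<union> V). y ` U \<subseteq> U}"
      then have y: "y \<in> odd_perms (U \<union> V)" "y ` U \<subseteq> U" by auto
      have yU: "y ` U = U" using endo_inj_surj[OF symmetricD(1)[OF U] y(2)] odd_bij_inj_on[OF odd_permsD(3)[OF y(1)]] by blast
      have "(res U y \<circ> res V y) a = y a" for a
      proof -
        have "y a \<notin> U" if "a \<in> V"
        proof
          assume "y a \<in> U"
          then obtain c where "c \<in> U" "y a = y c" using yU by (metis imageE)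
          then have "a \<in> U" using odd_bijD(4)[OF odd_permsD(3)[OF y(1)], of a c] by simp
          then show False using that d by blast
        qed
        then show ?thesis using odd_permsD(6)[OF y(1), of a] unfolding res_def by auto
      qed
      then show "(case (res U y, res V y) of (u, v) \<Rightarrow> u \<circ> v) = y" by auto
    qed
    show "(\<lambda>(u, v). u \<circ> v) ` (odd_perms U \<times> odd_perms V) \<subseteq> {y \<in> odd_perms (U \<union> V). y ` U \<subseteq> U}"
    proof (clarify, intro conjI subsetI)
      fix u v assume u: "u \<in> odd_perms U" and v: "v \<in> odd_perms V"
      have "u permutes U \<union> V" "v permutes U \<union> V"
        using permutes_subset[OF odd_permsD(1)[OF u]] permutes_subset[OF odd_permsD(1)[OF v]] by auto
      then show "u \<circ> v \<in> odd_perms (U \<union> V)"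
        unfolding odd_perms_def using permutes_compose odd_permsD(2)[OF u] odd_permsD(2)[OF v] by auto
      show "a \<in> U" if "a \<in> (u \<circ> v) ` U" for a
        using that onU[OF u v] odd_permsD(5)[OF u] by auto
    qed
    show "(\<lambda>y. (res U y, res V y)) ` {y \<in> odd_perms (U \<union> V). y ` U \<subseteq> U} \<subseteq> odd_perms U \<times> odd_perms V"
    proof (clarify, intro conjI SigmaI)
      fix y assume y: "y \<in> odd_perms (U \<union> V)" "y ` U \<subseteq> U"
      have yU: "y ` U = U" using endo_inj_surj[OF symmetricD(1)[OF U] y(2)] odd_bij_inj_on[OF odd_permsD(3)[OF y(1)]] by blast
      have inj: "inj y" using odd_bijD(2)[OF odd_permsD(3)[OF y(1)]] .
      have yV: "y ` V = V"
      proof -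
        have "y ` ((U \<union> V) - U) = (U \<union> V) - U" using image_set_diff[OF inj, of "U \<union> V" U] odd_permsD(4)[OF y(1)] yU by simp
        moreover have "(U \<union> V) - U = V" using d by auto
        ultimately show ?thesis by simp
      qed
      have "res S y \<in> odd_perms S" if S: "symmetric S" "y ` S = S" for S
      proof (rule odd_permsI[OF S(1)])
        show "inj_on (res S y) S" using inj unfolding res_def inj_on_def by auto
      qed (use S symmetricD(3)[OF S(1)] odd_permsD(2)[OF y(1)] in \<open>auto simp: res_def\<close>)
      then show "res U y \<in> odd_perms U" "res V y \<in> odd_perms V" using U V yU yV by auto
    qed
  qed
qed

text \<open>Distributivity for glued permutations: if both membership and summand factorize, so does
  the sum. It carries both sides of the induction over signed cycles.\<close>

lemma sum_glue:
  fixes f :: "(int \<Rightarrow> int) \<Rightarrow> complex"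
  assumes U: "symmetric U" and V: "symmetric V" and d: "U \<inter> V = {}"
    and S: "S \<subseteq> {y \<in> odd_perms (U \<union> V). y ` U \<subseteq> U}" "S1 \<subseteq> odd_perms U" "S2 \<subseteq> odd_perms V"
    and mem: "\<And>u v. u \<in> odd_perms U \<Longrightarrow> v \<in> odd_perms V \<Longrightarrow> u \<circ> v \<in> S \<longleftrightarrow> u \<in> S1 \<and> v \<in> S2"
    and f: "\<And>u v. u \<in> S1 \<Longrightarrow> v \<in> S2 \<Longrightarrow> f (u \<circ> v) = f1 u * f2 v"
  shows "sum f S = sum f1 S1 * sum f2 S2"
proof -
  note b = bij_betw_glue(1)[OF U V d]
  have bij: "bij_betw (\<lambda>(u, v). u \<circ> v) (S1 \<times> S2) S"
  proof (rule bij_betw_subset[OF b])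
    show "S1 \<times> S2 \<subseteq> odd_perms U \<times> odd_perms V" using S by auto
    show "(\<lambda>(u, v). u \<circ> v) ` (S1 \<times> S2) = S"
    proof (intro equalityI subsetI)
      fix y assume y: "y \<in> S"
      then have "y \<in> (\<lambda>(u, v). u \<circ> v) ` (odd_perms U \<times> odd_perms V)" using b S unfolding bij_betw_def by blast
      then obtain u v where "u \<in> odd_perms U" "v \<in> odd_perms V" "y = u \<circ> v" by auto
      then show "y \<in> (\<lambda>(u, v). u \<circ> v) ` (S1 \<times> S2)" using mem y by force
    next
      fix y assume "y \<in> (\<lambda>(u, v). u \<circ> v) ` (S1 \<times> S2)"
      then obtain u v where uv: "u \<in> S1" "v \<in> S2" "y = u \<circ> v" by auto
      then show "y \<in> S" using mem[of u v] S(2,3) by blast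
    qed
  qed
  have "sum f S = (\<Sum>uv\<in>S1 \<times> S2. f (case uv of (u, v) \<Rightarrow> u \<circ> v))"
    by (rule sum.reindex_bij_betw[OF bij, symmetric])
  also have "\<dots> = (\<Sum>(u, v)\<in>S1 \<times> S2. f1 u * f2 v)"
    using f by (intro sum.cong refl) auto
  also have "\<dots> = sum f1 S1 * sum f2 S2" by (simp add: sum_product sum.cartesian_product)
  finally show ?thesis .
qed

section \<open>Counting sign changes, and the two sets of permutations to be compared\<close>

definition sgnc :: "int \<Rightarrow> int \<Rightarrow> complex" where
  "sgnc \<eta> a = (if a < 0 then of_int \<eta> else 1)"

text \<open>The factor \<eta> once for every positive element with negative image. For \<eta> = -1
  on the letters this is the sign character of B_n with kernel D_n, and for \<eta> = 1 it is
  constantly 1; one definition lets both cases run through the same induction.\<close>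

definition theta :: "int \<Rightarrow> int set \<Rightarrow> (int \<Rightarrow> int) \<Rightarrow> complex" where
  "theta \<eta> A x = (\<Prod>a\<in>{a \<in> A. 0 < a}. sgnc \<eta> (x a))"

lemma theta_Un:
  assumes "symmetric U" "symmetric V" "U \<inter> V = {}"
  shows "theta \<eta> (U \<union> V) x = theta \<eta> U x * theta \<eta> V x"
proof -
  have "{a \<in> U \<union> V. 0 < a} = {a \<in> U. 0 < a} \<union> {a \<in> V. 0 < a}" by auto
  then show ?thesis unfolding theta_def using assms symmetricD(1)
    by (simp add: prod.union_disjoint disjoint_iff)
qed

lemma theta_cong: "(\<And>a. a \<in> A \<Longrightarrow> x a = y a) \<Longrightarrow> theta \<eta> A x = theta \<eta> A y"
  unfolding theta_def by (intro prod.cong) auto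

text \<open>The absolute value of \<open>h\<close> matches the positive halves of \<open>A\<close>
  and \<open>B\<close>, and oddness of \<open>f\<close> gives a sign change exactly where
  \<open>h a\<close> is negative. \<open>A\<close> and \<open>B\<close> may differ, as they do for a
  square root that exchanges two orbits.\<close>

lemma theta_comp:
  assumes \<eta>: "\<eta> = 1 \<or> \<eta> = - 1" and A: "symmetric A"
    and h: "inj_on h A" "\<And>a. a \<in> A \<Longrightarrow> h (- a) = - h a" "h ` A = B"
    and f: "\<And>b. b \<in> B \<Longrightarrow> f (- b) = - f b" "\<And>b. b \<in> B \<Longrightarrow> b \<noteq> 0 \<and> f b \<noteq> 0"
  shows "theta \<eta> A (f \<circ> h) = theta \<eta> A h * theta \<eta> B f"
proof -
  let ?P = "{a \<in> A. 0 < a}"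
  have hB: "h a \<in> B" if "a \<in> A" for a using h(3) that by auto
  have bij: "bij_betw (\<lambda>a. \<bar>h a\<bar>) ?P {b \<in> B. 0 < b}"
    unfolding bij_betw_def
  proof
    show "inj_on (\<lambda>a. \<bar>h a\<bar>) ?P"
    proof (rule inj_onI)
      fix a c assume a: "a \<in> ?P" and c: "c \<in> ?P" and e: "\<bar>h a\<bar> = \<bar>h c\<bar>"
      then have "h a = h c \<or> h a = h (- c)" using h(2)[of c] by auto
      then have "a = c \<or> a = - c" using a c symmetricD(3)[OF A, of c] h(1) unfolding inj_on_def by auto
      then show "a = c" using a c by auto
    qed
    show "(\<lambda>a. \<bar>h a\<bar>) ` ?P = {b \<in> B. 0 < b}"
    proof (intro equalityI subsetI)
      fix b assume "b \<in> (\<lambda>a. \<bar>h a\<bar>) ` ?P"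
      then obtain a where a: "a \<in> A" "0 < a" "b = \<bar>h a\<bar>" by auto
      have "h (- a) \<in> B" "h a \<in> B" using hB symmetricD(3)[OF A] a by auto
      then show "b \<in> {b \<in> B. 0 < b}" using a h(2)[OF a(1)] f(2)[of "h a"] by (auto simp: abs_if)
    next
      fix b assume "b \<in> {b \<in> B. 0 < b}"
      then obtain a where a: "a \<in> A" "b = h a" "0 < b" using h(3) by auto
      then have "\<bar>a\<bar> \<in> ?P" using symmetricD(3,4)[OF A a(1)] by (auto simp: abs_if)
      moreover have "\<bar>h \<bar>a\<bar>\<bar> = b" using a h(2)[OF a(1)] by (auto simp: abs_if)
      ultimately show "b \<in> (\<lambda>a. \<bar>h a\<bar>) ` ?P" by (intro image_eqI[of b _ "\<bar>a\<bar>"]) auto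
    qed
  qed
  have "sgnc \<eta> (f (h a)) = sgnc \<eta> (h a) * sgnc \<eta> (f \<bar>h a\<bar>)" if a: "a \<in> A" for a
  proof -
    have n: "h a \<in> B" "h a \<noteq> 0" "f (h a) \<noteq> 0" using hB[OF a] f(2) by auto
    show ?thesis
    proof (cases "h a < 0")
      case True
      have "f \<bar>h a\<bar> = - f (h a)" using True f(1)[OF n(1)] by simp
      then show ?thesis using True n \<eta> unfolding sgnc_def by auto
    qed (auto simp: sgnc_def)
  qed
  then have "theta \<eta> A (f \<circ> h) = (\<Prod>a\<in>?P. sgnc \<eta> (h a) * sgnc \<eta> (f \<bar>h a\<bar>))"
    unfolding theta_def by (intro prod.cong refl) auto
  also have "\<dots> = (\<Prod>a\<in>?P. sgnc \<eta> (h a)) * (\<Prod>a\<in>?P. sgnc \<eta> (f \<bar>h a\<bar>))"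
    by (rule prod.distrib)
  also have "(\<Prod>a\<in>?P. sgnc \<eta> (f \<bar>h a\<bar>)) = theta \<eta> B f"
    unfolding theta_def by (rule prod.reindex_bij_betw[OF bij])
  finally show ?thesis unfolding theta_def .
qed

lemma sgnc_uminus: "\<eta> = 1 \<or> \<eta> = - 1 \<Longrightarrow> a \<noteq> 0 \<Longrightarrow> sgnc \<eta> (- a) = of_int \<eta> * sgnc \<eta> a"
  unfolding sgnc_def by auto

lemma sgnc_nonzero: "\<eta> = 1 \<or> \<eta> = - 1 \<Longrightarrow> sgnc \<eta> a \<noteq> 0"
  unfolding sgnc_def by auto

definition square_roots :: "int set \<Rightarrow> (int \<Rightarrow> int) \<Rightarrow> (int \<Rightarrow> int) set" where
  "square_roots X g = {x \<in> odd_perms X. \<forall>a\<in>X. x (x a) = g a}"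

definition commuting_unit_squares :: "int \<Rightarrow> int set \<Rightarrow> (int \<Rightarrow> int) \<Rightarrow> (int \<Rightarrow> int) set" where
  "commuting_unit_squares \<eta> X g = {y \<in> odd_perms X. unit_square \<eta> X y \<and> commutes_on X g y}"

lemma square_rootsD:
  assumes "x \<in> square_roots X g"
  shows "x \<in> odd_perms X" "a \<in> X \<Longrightarrow> x (x a) = g a" "a \<in> X \<Longrightarrow> x (g a) = g (x a)"
proof -
  show 1: "x \<in> odd_perms X" and 2: "\<And>a. a \<in> X \<Longrightarrow> x (x a) = g a" using assms unfolding square_roots_def by auto
  show "a \<in> X \<Longrightarrow> x (g a) = g (x a)" using 2[of a] 2[of "x a"] odd_permsD(5)[OF 1, of a] by metis
qed

lemma square_roots_glue:
  assumes U: "symmetric U" and V: "symmetric V" and d: "U \<inter> V = {}"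
    and u: "u \<in> odd_perms U" and v: "v \<in> odd_perms V"
  shows "u \<circ> v \<in> square_roots (U \<union> V) g \<longleftrightarrow> u \<in> square_roots U g \<and> v \<in> square_roots V g"
proof -
  note gl = bij_betw_glue[OF U V d]
  have "u \<circ> v \<in> odd_perms (U \<union> V)" using gl(1) u v unfolding bij_betw_def by auto
  moreover have "(u \<circ> v) ((u \<circ> v) a) = u (u a)" if "a \<in> U" for a
    using gl(2)[OF u v] that odd_permsD(5)[OF u that] by metis
  moreover have "(u \<circ> v) ((u \<circ> v) a) = v (v a)" if "a \<in> V" for a
    using gl(3)[OF u v] that odd_permsD(5)[OF v that] by metis
  ultimately show ?thesis unfolding square_roots_def using u v by auto
qed

lemma commuting_unit_squares_glue:
  assumes U: "symmetric U" and V: "symmetric V" and d: "U \<inter> V = {}"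
    and g: "odd_bij g" "g ` U = U" "g ` V = V"
    and u: "u \<in> odd_perms U" and v: "v \<in> odd_perms V"
  shows "u \<circ> v \<in> commuting_unit_squares \<eta> (U \<union> V) g \<longleftrightarrow>
    u \<in> commuting_unit_squares \<eta> U g \<and> v \<in> commuting_unit_squares \<eta> V g"
proof -
  note gl = bij_betw_glue[OF U V d]
  have uv: "u \<circ> v \<in> odd_perms (U \<union> V)" using gl(1) u v unfolding bij_betw_def by auto
  have restr: "unit_square \<eta> S y \<and> commutes_on S g y \<longleftrightarrow> (\<eta> = 1 \<or> \<eta> = - 1) \<and> (\<forall>a\<in>S. y (y a) = \<eta> * a \<and> y (g a) = g (y a))"
    if "symmetric S" "g ` S = S" "y \<in> odd_perms S" for S y
    using that odd_permsD(2,5)[OF that(3)] g(1) unfolding unit_square_def commutes_on_def by auto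
  have gUV: "g ` (U \<union> V) = U \<union> V" using g by auto
  have 1: "(u \<circ> v) ((u \<circ> v) a) = u (u a)" "(u \<circ> v) a = u a" if "a \<in> U" for a
    using gl(2)[OF u v] that odd_permsD(5)[OF u that] by metis+
  have 2: "(u \<circ> v) ((u \<circ> v) a) = v (v a)" "(u \<circ> v) a = v a" if "a \<in> V" for a
    using gl(3)[OF u v] that odd_permsD(5)[OF v that] by metis+
  have 3: "(u \<circ> v) (g a) = u (g a)" if "a \<in> U" for a using gl(2)[OF u v] that g by blast
  have 4: "(u \<circ> v) (g a) = v (g a)" if "a \<in> V" for a using gl(3)[OF u v] that g by blast
  define Q where "Q S y \<longleftrightarrow> (\<forall>a\<in>S. y (y a) = \<eta> * a \<and> y (g a) = g (y a))" for S y
  have "Q (U \<union> V) (u \<circ> v) \<longleftrightarrow> Q U (u \<circ> v) \<and> Q V (u \<circ> v)" unfolding Q_def by (rule ball_Un)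
  moreover have "Q U (u \<circ> v) \<longleftrightarrow> Q U u" unfolding Q_def using 1 3 by (intro ball_cong refl) simp
  moreover have "Q V (u \<circ> v) \<longleftrightarrow> Q V v" unfolding Q_def using 2 4 by (intro ball_cong refl) simp
  ultimately show ?thesis unfolding commuting_unit_squares_def
    using restr[OF symmetric_Un[OF U V] gUV uv] restr[OF U g(2) u] restr[OF V g(3) v] uv u v
    unfolding Q_def[symmetric] by blast
qed

text \<open>The case split of the induction: with \<open>A\<close> the signed orbit of
  \<open>q\<close>, a permutation either keeps \<open>q\<close> in \<open>A\<close> or sends it to a
  definite point \<open>r\<close> outside.\<close>

lemma sum_by_value:
  fixes f :: "(int \<Rightarrow> int) \<Rightarrow> complex"
  assumes "finite S" "finite X" "A \<subseteq> X" "\<And>y. y \<in> S \<Longrightarrow> y q \<in> X"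
  shows "sum f S = sum f {y \<in> S. y q \<in> A} + (\<Sum>r\<in>X - A. sum f {y \<in> S. y q = r})"
proof -
  have "sum f S = sum f {y \<in> S. y q \<in> A} + sum f {y \<in> S. y q \<notin> A}"
    using assms(1) by (subst sum.union_disjoint[symmetric]) (auto intro: sum.cong)
  also have "sum f {y \<in> S. y q \<notin> A} = (\<Sum>r\<in>X - A. sum f {y \<in> {y \<in> S. y q \<notin> A}. y q = r})"
    using assms by (intro sum.group[symmetric]) auto
  also have "\<dots> = (\<Sum>r\<in>X - A. sum f {y \<in> S. y q = r})"
    by (intro sum.cong refl) auto
  finally show ?thesis .
qed

context quartic_root
begin

lemma weight_glue:
  assumes U: "symmetric U" and V: "symmetric V" and d: "U \<inter> V = {}"
    and u: "u \<in> commuting_unit_squares \<eta> U g" and v: "v \<in> commuting_unit_squares \<eta> V g"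
  shows "weight (U \<union> V) (u \<circ> v) g = weight U u g * weight V v g"
proof -
  have u': "u \<in> odd_perms U" "unit_square \<eta> U u" "commutes_on U g u"
    and v': "v \<in> odd_perms V" "unit_square \<eta> V v" "commutes_on V g v"
    using u v unfolding commuting_unit_squares_def by auto
  note gl = bij_betw_glue(2,3)[OF U V d u'(1) v'(1)]
  have U1: "unit_square \<eta> U (u \<circ> v)" "commutes_on U g (u \<circ> v)"
    using u'(2,3) gl(1) symmetricD(3)[OF U] commutes_onD(4)[OF u'(3)] unfolding unit_square_def commutes_on_def by (auto simp del: o_apply)
  have V1: "unit_square \<eta> V (u \<circ> v)" "commutes_on V g (u \<circ> v)"
    using v'(2,3) gl(2) symmetricD(3)[OF V] commutes_onD(4)[OF v'(3)] unfolding unit_square_def commutes_on_def by (auto simp del: o_apply)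
  show ?thesis
    unfolding weight_split[OF U1(1) V1(1) d U1(2) V1(2)]
    using weight_cong[OF u'(2,3), of "u \<circ> v"] weight_cong[OF v'(2,3), of "u \<circ> v"] gl by simp
qed

text \<open>The square root \<open>x\<close> corresponds to the \<open>y\<close> that is \<open>x\<close> on the first of the two exchanged
  cycles of \<open>g\<close> and \<open>\<eta> g\<^sup>-\<^sup>1 x\<close> on the second. Both weights equal the sign of \<open>g\<close> on one cycle.\<close>

lemma exchanged_orbits:
  assumes \<eta>: "\<eta> = 1 \<or> \<eta> = - 1" and X: "symmetric X" and g: "odd_bij g" "g ` X = X"
    and q: "q \<in> X" and r: "r \<in> X" "r \<notin> signed_orbit g q"
  defines "A \<equiv> signed_orbit g q" and "A' \<equiv> signed_orbit g r"
  shows "(\<Sum>y\<in>{y \<in> commuting_unit_squares \<eta> (A \<union> A') g. y q = r}. weight (A \<union> A') y g) =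
    (\<Sum>x\<in>{x \<in> square_roots (A \<union> A') g. x q = r}. theta \<eta> (A \<union> A') x)"
proof -
  let ?U = "A \<union> A'"
  note A = signed_orbit_props[OF X g q, folded A_def] and A' = signed_orbit_props[OF X g r(1), folded A'_def]
  have d: "A \<inter> A' = {}" unfolding A_def A'_def by (rule signed_orbit_disjoint[OF X g q r(2)])
  have U: "symmetric ?U" using A(2) A'(2) by (rule symmetric_Un)
  have gU: "g ` ?U = ?U" using A(3) A'(3) by auto
  have qA: "q \<in> A" and rA: "r \<in> A'" unfolding A_def A'_def by (rule signed_orbit_self)+
  define Y where "Y = {y \<in> commuting_unit_squares \<eta> ?U g. y q = r}"
  define R where "R = {x \<in> square_roots ?U g. x q = r}"
  have maps: "y a \<in> A'" if y: "y \<in> odd_perms ?U" "\<And>a. a \<in> ?U \<Longrightarrow> y (g a) = g (y a)" "y q = r" and a: "a \<in> A" for y a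
  proof -
    obtain s k where s: "s = 1 \<or> s = - 1" "a = s * (g ^^ k) q" using a unfolding A_def by (rule signed_orbitE)
    have "y a = s * (g ^^ k) (y q)" unfolding s(2) odd_perms_sign[OF y(1) s(1)]
      using funpow_commute_on[of ?U y g q k, OF y(2) gU] qA by simp
    then show ?thesis unfolding y(3) A'_def using signed_orbitI[OF s(1)] by simp
  qed
  have bk: "y a \<in> A" if y: "y \<in> odd_perms ?U" "\<And>a. a \<in> ?U \<Longrightarrow> y (g a) = g (y a)" "y r \<in> A" and a: "a \<in> A'" for y a
  proof -
    obtain s k where s: "s = 1 \<or> s = - 1" "a = s * (g ^^ k) r" using a unfolding A'_def by (rule signed_orbitE)
    have "y a = s * (g ^^ k) (y r)" unfolding s(2) odd_perms_sign[OF y(1) s(1)]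
      using funpow_commute_on[of ?U y g r k, OF y(2) gU] rA by simp
    then show ?thesis using symmetric_sign[OF A(2) s(1) funpow_in[OF A(3) y(3)]] by simp
  qed
  have YD: "y \<in> odd_perms ?U" "unit_square \<eta> ?U y" "commutes_on ?U g y" "y q = r"
    "\<And>a. a \<in> ?U \<Longrightarrow> y (g a) = g (y a)" "\<And>a. a \<in> A \<Longrightarrow> y a \<in> A'" "\<And>a. a \<in> A' \<Longrightarrow> y a \<in> A" if "y \<in> Y" for y
  proof -
    show y: "y \<in> odd_perms ?U" "unit_square \<eta> ?U y" "commutes_on ?U g y" "y q = r"
      using that unfolding Y_def commuting_unit_squares_def by auto
    show c: "\<And>a. a \<in> ?U \<Longrightarrow> y (g a) = g (y a)" using commutes_onD(3)[OF y(3)] .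
    show "\<And>a. a \<in> A \<Longrightarrow> y a \<in> A'" using maps[OF y(1) c y(4)] .
    have "y r = \<eta> * q" using unit_squareD(5)[OF y(2), of q] qA y(4) by simp
    then have "y r \<in> A" using symmetric_sign[OF A(2) \<eta> qA] by simp
    then show "\<And>a. a \<in> A' \<Longrightarrow> y a \<in> A" using bk[OF y(1) c] by blast
  qed
  have RD: "x \<in> odd_perms ?U" "x q = r" "\<And>a. a \<in> ?U \<Longrightarrow> x (x a) = g a"
    "\<And>a. a \<in> ?U \<Longrightarrow> x (g a) = g (x a)" "\<And>a. a \<in> A \<Longrightarrow> x a \<in> A'" "\<And>a. a \<in> A' \<Longrightarrow> x a \<in> A" if "x \<in> R" for x
  proof -
    have x': "x \<in> square_roots ?U g" using that unfolding R_def by auto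
    show x: "x \<in> odd_perms ?U" "x q = r" "\<And>a. a \<in> ?U \<Longrightarrow> x (x a) = g a"
      using square_rootsD[OF x'] that unfolding R_def by auto
    show c: "\<And>a. a \<in> ?U \<Longrightarrow> x (g a) = g (x a)" using square_rootsD(3)[OF x'] .
    show "\<And>a. a \<in> A \<Longrightarrow> x a \<in> A'" using maps[OF x(1) c x(2)] .
    have "x r = g q" using x(2) x(3)[of q] qA by simp
    then have "x r \<in> A" using A(3) qA by auto
    then show "\<And>a. a \<in> A' \<Longrightarrow> x a \<in> A" using bk[OF x(1) c] by blast
  qed
  define h where "h = inv_into UNIV g"
  have hg: "h (g a) = a" for a unfolding h_def using odd_bijD(2)[OF g(1)] by simp
  have gh: "g (h a) = a" for a unfolding h_def using odd_bijD(1)[OF g(1)] by (simp add: bij_is_surj surj_f_inv_f)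
  have hneg: "h (- a) = - h a" for a using hg[of "- h a"] odd_bijD(3)[OF g(1)] gh by simp
  have hA: "h a \<in> A" if "a \<in> A" for a using that A(3) hg by (metis imageE)
  have hA': "h a \<in> A'" if "a \<in> A'" for a using that A'(3) hg by (metis imageE)
  have gA: "g a \<in> A" if "a \<in> A" for a using that A(3) by auto
  have \<eta>2: "\<eta> * (\<eta> * a) = a" for a using \<eta> by auto
  have \<eta>A: "\<eta> * a \<in> A" if "a \<in> A" for a using symmetric_sign[OF A(2) \<eta> that] .
  \<comment> \<open>A square root that agrees with \<open>y\<close> on \<open>A\<close> must act on
    \<open>A'\<close> as \<open>g\<close> after the inverse of \<open>y\<close>, and this inverse is
    \<open>\<eta> * y a\<close>.\<close>
  define toR where "toR y = (\<lambda>a. if a \<in> A then y a else if a \<in> A' then \<eta> * g (y a) else a)" for y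
  define toY where "toY x = (\<lambda>a. if a \<in> A then x a else if a \<in> A' then \<eta> * h (x a) else a)" for x
  have notA: "a \<notin> A" if "a \<in> A'" for a using d that by auto
  have negA: "- a \<in> A \<longleftrightarrow> a \<in> A" for a using symmetricD(3)[OF A(2), of a] symmetricD(3)[OF A(2), of "- a"] by auto
  have negA': "- a \<in> A' \<longleftrightarrow> a \<in> A'" for a using symmetricD(3)[OF A'(2), of a] symmetricD(3)[OF A'(2), of "- a"] by auto
  have toR: "toR y \<in> R" if y: "y \<in> Y" for y
  proof -
    note Y = YD[OF y]
    have yneg: "y (- a) = - y a" and y_eta: "y (\<eta> * a) = \<eta> * y a" for a
      using odd_permsD(2)[OF Y(1)] odd_perms_sign[OF Y(1) \<eta>] by auto
    have yy: "y (y a) = \<eta> * a" if "a \<in> ?U" for a using unit_squareD(5)[OF Y(2) that] .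
    have sq: "toR y (toR y a) = g a" if "a \<in> ?U" for a
    proof (cases "a \<in> A")
      case True
      then have "toR y (toR y a) = \<eta> * g (y (y a))" using Y(6) notA unfolding toR_def by simp
      then show ?thesis using yy[OF that] odd_sign[OF g(1) \<eta>] \<eta>2 by simp
    next
      case False
      then have a: "a \<in> A'" using that by simp
      have ga: "g (y a) \<in> A" using gA Y(7)[OF a] .
      have "toR y (toR y a) = y (\<eta> * g (y a))" using a False \<eta>A[OF ga] unfolding toR_def by simp
      also have "\<dots> = \<eta> * g (y (y a))" using y_eta Y(5)[of "y a"] Y(7)[OF a] by simp
      finally show ?thesis using yy[OF that] odd_sign[OF g(1) \<eta>] \<eta>2 by simp
    qed
    have "toR y \<in> odd_perms ?U"
    proof (rule odd_permsI[OF U])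
      show "toR y a \<in> ?U" if "a \<in> ?U" for a
        using that Y(6,7) gA \<eta>A unfolding toR_def by auto
      show "toR y (- a) = - toR y a" if "a \<in> ?U" for a
        using that yneg odd_bijD(3)[OF g(1)] negA negA' unfolding toR_def by auto
      show "inj_on (toR y) ?U" by (rule inj_on_inverseI[where g = "\<lambda>b. h (toR y b)"]) (simp add: sq hg)
    qed (auto simp: toR_def)
    then show ?thesis unfolding R_def square_roots_def using sq Y(4) qA by (auto simp: toR_def)
  qed
  have toY: "toY x \<in> Y" if x: "x \<in> R" for x
  proof -
    note R = RD[OF x]
    have xneg: "x (- a) = - x a" and x_eta: "x (\<eta> * a) = \<eta> * x a" for a
      using odd_permsD(2)[OF R(1)] odd_perms_sign[OF R(1) \<eta>] by auto
    have h_eta: "h (\<eta> * a) = \<eta> * h a" for a using \<eta> hneg by auto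
    have xh: "x (h a) = h (x a)" if "a \<in> ?U" for a
    proof -
      have "h a \<in> ?U" using that hA hA' by auto
      then have "x (g (h a)) = g (x (h a))" by (rule R(4))
      then show ?thesis using gh hg by metis
    qed
    have sq: "toY x (toY x a) = \<eta> * a" if "a \<in> ?U" for a
    proof (cases "a \<in> A")
      case True
      then show ?thesis using R(5)[OF True] notA R(3)[OF that] hg unfolding toY_def by simp
    next
      case False
      then have a: "a \<in> A'" using that by simp
      have ha: "h (x a) \<in> A" using hA R(6)[OF a] .
      have "toY x (toY x a) = x (\<eta> * h (x a))" using a False \<eta>A[OF ha] unfolding toY_def by simp
      also have "\<dots> = \<eta> * h (x (x a))" using x_eta xh[of "x a"] R(6)[OF a] by simp
      finally show ?thesis using R(3)[OF that] hg by simp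
    qed
    have perm: "toY x \<in> odd_perms ?U"
    proof (rule odd_permsI[OF U])
      show "toY x a \<in> ?U" if "a \<in> ?U" for a
        using that R(5,6) hA \<eta>A unfolding toY_def by auto
      show "toY x (- a) = - toY x a" if "a \<in> ?U" for a
        using that xneg hneg negA negA' unfolding toY_def by auto
      show "inj_on (toY x) ?U" by (rule inj_on_inverseI[where g = "\<lambda>b. \<eta> * toY x b"]) (simp add: sq \<eta>2)
    qed (auto simp: toY_def)
    have comm: "toY x (g a) = g (toY x a)" if "a \<in> ?U" for a
    proof (cases "a \<in> A")
      case True
      then show ?thesis using gA R(4)[OF that] unfolding toY_def by simp
    next
      case False
      then have "a \<in> A'" "g a \<in> A'" "g a \<notin> A" using that A'(3) notA by auto
      then show ?thesis using False R(4)[OF that] odd_sign[OF g(1) \<eta>] hg gh unfolding toY_def by simp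
    qed
    show ?thesis unfolding Y_def commuting_unit_squares_def unit_square_def commutes_on_def
      using perm comm sq \<eta> U g(1) gU odd_permsD(2,5)[OF perm] R(2) qA by (auto simp: toY_def)
  qed
  have "bij_betw toR Y R"
  proof (rule bij_betw_byWitness[where f' = toY])
    show "\<forall>y\<in>Y. toY (toR y) = y"
    proof (intro ballI ext)
      fix y a assume y: "y \<in> Y"
      have "h (\<eta> * g (y a)) = \<eta> * y a" using \<eta> hneg hg by auto
      then show "toY (toR y) a = y a"
        using \<eta>2 odd_permsD(6)[OF YD(1)[OF y], of a] unfolding toY_def toR_def by auto
    qed
    show "\<forall>x\<in>R. toR (toY x) = x"
    proof (intro ballI ext)
      fix x a assume x: "x \<in> R"
      have "g (\<eta> * h (x a)) = \<eta> * x a" using odd_sign[OF g(1) \<eta>] gh by simp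
      then show "toR (toY x) a = x a"
        using \<eta>2 odd_permsD(6)[OF RD(1)[OF x], of a] unfolding toY_def toR_def by auto
    qed
  qed (use toR toY in auto)
  then have card: "card Y = card R" by (rule bij_betw_same_card)
  have "weight ?U y g = theta \<eta> A g" if y: "y \<in> Y" for y
  proof -
    note Y = YD[OF y]
    \<comment> \<open>The common value of \<open>kap y\<close>: since \<open>y\<close> exchanges two
      disjoint symmetric supports, all its signed cycles have length 2.\<close>
    define K where "K = (if \<eta> = 1 then - 1 else \<iota>)"
    have K: "K \<noteq> 0" "K * K * of_int \<eta> = 1" unfolding K_def using \<eta> iota by auto
    \<comment> \<open>The sign on \<open>A\<close>, continued to \<open>A'\<close> along
      \<open>y\<close>, where \<open>\<eta> * y a\<close> is the preimage of \<open>a\<close>. With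
      the positive elements of \<open>A\<close> as base points, the weight becomes the sign count of
      \<open>g\<close> on \<open>A\<close>.\<close>
    define p where "p a = (if a \<in> A then sgnc \<eta> a else K * sgnc \<eta> (\<eta> * y a))" for a
    have pot: "potential y ?U p" unfolding potential_def
    proof
      fix a assume a: "a \<in> ?U"
      have ne: "y a \<noteq> a" "y a \<noteq> - a"
        using a Y(6,7) d symmetricD(3)[OF A(2), of a] symmetricD(3)[OF A'(2), of a] by (metis Un_iff disjoint_iff)+
      have yy: "y (y a) = \<eta> * a" using unit_squareD(5)[OF Y(2) a] .
      have a0: "a \<noteq> 0" "y a \<noteq> 0" using a symmetricD(4)[OF U] unit_squareD(3)[OF Y(2) a] by auto
      have mu: "mu y a = of_int \<eta>" unfolding mu_def yy using ne \<eta> a0 by auto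
      have kap: "kap y a = K" unfolding kap_def yy K_def using ne \<eta> a0 by auto
      have yneg: "y (- a) = - y a" using odd_permsD(2)[OF Y(1)] .
      have nz: "\<eta> * y a \<noteq> 0" using \<eta> a0 by auto
      show "p a \<noteq> 0 \<and> p (- a) = mu y a * p a \<and> p (y a) = kap y a * p a"
      proof (cases "a \<in> A")
        case True
        then have "y a \<notin> A" "- a \<in> A" using Y(6) notA symmetricD(3)[OF A(2)] by auto
        moreover have "sgnc \<eta> (\<eta> * (\<eta> * a)) = sgnc \<eta> a" unfolding \<eta>2 ..
        ultimately show ?thesis unfolding mu kap using True yy sgnc_uminus[OF \<eta> a0(1)] sgnc_nonzero[OF \<eta>] K
          by (simp add: p_def)
      next
        case False
        then have "a \<in> A'" using a by simp
        then have ya: "y a \<in> A" "- a \<notin> A" using Y(7) notA symmetricD(3)[OF A'(2)] by auto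
        have "sgnc \<eta> (\<eta> * y a) = of_int \<eta> * sgnc \<eta> (y a)" using \<eta> sgnc_uminus[OF \<eta> a0(2)] by auto
        moreover have "sgnc \<eta> (\<eta> * - y a) = of_int \<eta> * sgnc \<eta> (\<eta> * y a)" using sgnc_uminus[OF \<eta> nz] by simp
        moreover have "\<eta> \<noteq> 0" using \<eta> by auto
        ultimately show ?thesis unfolding mu kap using False ya sgnc_nonzero[OF \<eta>] K yneg
          by (simp add: p_def mult.assoc[symmetric])
      qed
    qed
    have tv: "transversal y ?U {a \<in> A. 0 < a}" unfolding transversal_def
    proof (intro conjI)
      show "inj_on (cyc y) {a \<in> A. 0 < a}"
      proof (rule inj_onI)
        fix a c assume a: "a \<in> {a \<in> A. 0 < a}" and c: "c \<in> {a \<in> A. 0 < a}" and e: "cyc y a = cyc y c"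
        have "a \<in> cyc y c" using e unfolding cyc_def by auto
        moreover have "y c \<notin> A" "- y c \<notin> A" using Y(6)[of c] c notA symmetricD(3)[OF A'(2)] by auto
        ultimately show "a = c" using a c unfolding cyc_def by auto
      qed
      show "cyc y ` {a \<in> A. 0 < a} = cyc y ` ?U"
      proof (intro equalityI image_subsetI)
        fix c assume c: "c \<in> ?U"
        have *: "cyc y a \<in> cyc y ` {a \<in> A. 0 < a}" if "a \<in> A" for a
        proof -
          have "\<bar>a\<bar> \<in> {a \<in> A. 0 < a}" using symmetricD(3,4)[OF A(2) that] that by (auto simp: abs_if)
          moreover have "cyc y \<bar>a\<bar> = cyc y a" using cyc_eqs(1)[OF Y(2), of a] that by (auto simp: abs_if)
          ultimately show ?thesis by (metis imageI)
        qed
        show "cyc y c \<in> cyc y ` {a \<in> A. 0 < a}"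
        proof (cases "c \<in> A")
          case False
          then have "y c \<in> A" using c Y(7) by auto
          from *[OF this] show ?thesis using cyc_eqs(2)[OF Y(2) c] by simp
        qed (rule *)
      qed auto
    qed auto
    show ?thesis unfolding weight_eq[OF Y(2,3) tv pot] theta_def
      using gA by (intro prod.cong refl) (auto simp: p_def sgnc_def)
  qed
  moreover have "theta \<eta> ?U x = theta \<eta> A g" if x: "x \<in> R" for x
  proof -
    note R = RD[OF x]
    have "x ` A = A'"
    proof (intro equalityI subsetI)
      fix c assume c: "c \<in> A'"
      have "x (x (h c)) = c" using R(3)[of "h c"] hA'[OF c] gh by simp
      then show "c \<in> x ` A" using R(6)[OF hA'[OF c]] by (metis imageI)
    qed (use R(5) in auto)
    \<comment> \<open>\<open>x\<close> takes \<open>A\<close> onto \<open>A'\<close> and back, with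
      composite \<open>g\<close>, so its sign counts on the two parts multiply to that of
      \<open>g\<close> on one of them.\<close>
    then have "theta \<eta> A (x \<circ> x) = theta \<eta> A x * theta \<eta> A' x"
      using symmetricD(4)[OF A'(2)] symmetricD(4)[OF A(2)] R(6)
      by (intro theta_comp[OF \<eta> A(2) odd_bij_inj_on[OF odd_permsD(3)[OF R(1)]]] odd_permsD(2)[OF R(1)]) auto
    moreover have "theta \<eta> A (x \<circ> x) = theta \<eta> A g" using R(3) by (intro theta_cong) auto
    ultimately show ?thesis using theta_Un[OF A(2) A'(2) d] by simp
  qed
  ultimately show ?thesis unfolding Y_def[symmetric] R_def[symmetric] using card by simp
qed

end

section \<open>A single signed cycle\<close>

text \<open>Here \<open>A\<close> is the support of one signed cycle of \<open>g\<close>, \<open>l\<close> its length and \<open>\<epsilon>\<close> its class.\<close>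

locale single_orbit =
  fixes g :: "int \<Rightarrow> int" and A :: "int set" and q :: int and l :: nat and \<epsilon> :: int
  assumes A: "symmetric A" and g: "odd_bij g" "g ` A = A" and q: "q \<in> A" and A_eq: "A = signed_orbit g q"
    and l0: "0 < l" and eps: "\<epsilon> = 1 \<or> \<epsilon> = - 1" and period: "(g ^^ l) q = \<epsilon> * q"
    and minimal: "\<And>j. 0 < j \<Longrightarrow> j < l \<Longrightarrow> (g ^^ j) q \<noteq> q \<and> (g ^^ j) q \<noteq> - q"

text \<open>Finiteness makes two powers of \<open>g\<close> agree at \<open>q\<close>. The least
  positive exponent that leads back to \<open>q\<close> or \<open>- q\<close> is the length, and
  which of the two is reached decides the class.\<close>

lemma ex_single_orbit:
  assumes X: "symmetric X" and g: "odd_bij g" "g ` X = X" and q: "q \<in> X"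
  obtains l \<epsilon> where "single_orbit g (signed_orbit g q) q l \<epsilon>"
proof -
  note A = signed_orbit_props[OF X g q]
  let ?P = "\<lambda>l. 0 < l \<and> ((g ^^ l) q = q \<or> (g ^^ l) q = - q)"
  have "\<not> inj (\<lambda>k. (g ^^ k) q)"
  proof
    assume "inj (\<lambda>k. (g ^^ k) q)"
    then have "infinite (range (\<lambda>k. (g ^^ k) q))" using finite_imageD infinite_UNIV_nat by blast
    moreover have "range (\<lambda>k. (g ^^ k) q) \<subseteq> X" using funpow_in[OF g(2) q] by auto
    ultimately show False using symmetricD(1)[OF X] finite_subset by blast
  qed
  then obtain i j where "i \<noteq> j" "(g ^^ i) q = (g ^^ j) q" unfolding inj_on_def by auto
  then obtain i j where ij: "i < j" "(g ^^ i) q = (g ^^ j) q" by (metis linorder_neqE_nat)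
  then have "(g ^^ i) ((g ^^ (j - i)) q) = (g ^^ i) q" using funpow_add_apply[of i "j - i" g q] by simp
  then have "(g ^^ (j - i)) q = q" using odd_bijD(4)[OF odd_bij_funpow[OF g(1)]] by blast
  then have "?P (j - i)" using ij by simp
  then have P: "?P (LEAST l. ?P l)" by (rule LeastI)
  define l where "l = (LEAST l. ?P l)"
  define \<epsilon> :: int where "\<epsilon> = (if (g ^^ l) q = q then 1 else - 1)"
  have "(g ^^ l) q = q \<or> (g ^^ l) q = - q" using P unfolding l_def by blast
  then have "\<epsilon> = 1 \<or> \<epsilon> = - 1" "(g ^^ l) q = \<epsilon> * q" unfolding \<epsilon>_def by auto
  moreover have "(g ^^ j) q \<noteq> q \<and> (g ^^ j) q \<noteq> - q" if "0 < j" "j < l" for j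
    using not_less_Least[of j ?P] that unfolding l_def by auto
  ultimately have "single_orbit g (signed_orbit g q) q l \<epsilon>"
    using A g P signed_orbit_self[of q g] unfolding l_def by unfold_locales auto
  with that show thesis .
qed

context single_orbit
begin

lemma q0: "q \<noteq> 0" "q \<noteq> - q" "- q \<noteq> q"
  using symmetricD(4)[OF A q] by auto

lemma period_mult: "(g ^^ (l * m)) q = \<epsilon> ^ m * q"
proof (induction m)
  case (Suc m)
  have e: "\<epsilon> ^ m = 1 \<or> \<epsilon> ^ m = - 1" using eps by (cases "even m") auto
  have "(g ^^ (l * Suc m)) q = (g ^^ l) ((g ^^ (l * m)) q)" using funpow_add_apply[of l "l * m" g q] by simp
  also have "\<dots> = \<epsilon> ^ m * (g ^^ l) q" unfolding Suc using odd_sign[OF odd_bij_funpow[OF g(1)] e] by simp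
  finally show ?case unfolding period by (simp add: algebra_simps)
qed simp

lemma reduce: "\<exists>s. (s = 1 \<or> s = - 1) \<and> (g ^^ m) q = s * (g ^^ (m mod l)) q"
proof -
  have e: "\<epsilon> ^ (m div l) = 1 \<or> \<epsilon> ^ (m div l) = - 1" using eps by (cases "even (m div l)") auto
  have "(g ^^ m) q = (g ^^ (m mod l)) ((g ^^ (l * (m div l))) q)"
    using funpow_add_apply[of "m mod l" "l * (m div l)" g q] by simp
  also have "\<dots> = \<epsilon> ^ (m div l) * (g ^^ (m mod l)) q"
    unfolding period_mult using odd_sign[OF odd_bij_funpow[OF g(1)] e] .
  finally show ?thesis using e by blast
qed

lemma return_iff: "(g ^^ m) q = q \<or> (g ^^ m) q = - q \<longleftrightarrow> l dvd m"
proof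
  assume a: "(g ^^ m) q = q \<or> (g ^^ m) q = - q"
  obtain s where "s = 1 \<or> s = - 1" "(g ^^ m) q = s * (g ^^ (m mod l)) q" using reduce by blast
  then have "(g ^^ (m mod l)) q = q \<or> (g ^^ (m mod l)) q = - q" using a by auto
  then have "\<not> 0 < m mod l" using minimal[of "m mod l"] l0 by auto
  then show "l dvd m" by auto
next
  assume "l dvd m"
  then obtain k where "m = l * k" by auto
  then show "(g ^^ m) q = q \<or> (g ^^ m) q = - q" using period_mult[of k] eps by (cases "even k") auto
qed

text \<open>Together with \<open>covers\<close> this gives coordinates on \<open>A\<close>, a sign
  and an exponent below \<open>l\<close>. A coincidence would bring \<open>q\<close> back up to sign
  after fewer than \<open>l\<close> steps.\<close>

lemma unique:
  assumes "s = 1 \<or> s = - 1" "s' = 1 \<or> s' = - 1" "j < l" "k < l" "s * (g ^^ j) q = s' * (g ^^ k) q"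
  shows "s = s' \<and> j = k"
proof -
  have main: "j = k" if "j \<le> k" "k < l" "s = 1 \<or> s = - 1" "s' = 1 \<or> s' = - 1" "s * (g ^^ j) q = s' * (g ^^ k) q" for j k s s'
  proof -
    have "(g ^^ k) q = (g ^^ j) ((g ^^ (k - j)) q)" using that(1) funpow_add_apply[of j "k - j" g q] by simp
    then have "(g ^^ j) (s * q) = (g ^^ j) (s' * (g ^^ (k - j)) q)"
      using that odd_sign[OF odd_bij_funpow[OF g(1)]] by simp
    then have "s * q = s' * (g ^^ (k - j)) q" using odd_bijD(4)[OF odd_bij_funpow[OF g(1)]] by blast
    then have "(g ^^ (k - j)) q = q \<or> (g ^^ (k - j)) q = - q" using that(3,4) by auto
    then have "l dvd k - j" using return_iff by blast
    then show ?thesis using that(1,2) by (auto dest: dvd_imp_le)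
  qed
  have jk: "j = k"
  proof (cases "j \<le> k")
    case False
    then show ?thesis using main[of k j s' s] assms by auto
  qed (use main[of j k s s'] assms in auto)
  have "(g ^^ k) q \<noteq> 0" using symmetricD(4)[OF A funpow_in[OF g(2) q]] .
  then show ?thesis using assms jk by auto
qed

lemma covers:
  assumes "a \<in> A"
  obtains s k where "s = 1 \<or> s = - 1" "k < l" "a = s * (g ^^ k) q"
proof -
  obtain s m where s: "s = 1 \<or> s = - 1" "a = s * (g ^^ m) q" using assms unfolding A_eq by (rule signed_orbitE)
  obtain s' where "s' = 1 \<or> s' = - 1" "(g ^^ m) q = s' * (g ^^ (m mod l)) q" using reduce by blast
  then have "a = (s * s') * (g ^^ (m mod l)) q" "s * s' = 1 \<or> s * s' = - 1" using s by auto
  with that[of "s * s'" "m mod l"] l0 show thesis by simp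
qed

text \<open>Every odd permutation of \<open>A\<close> commuting with \<open>g\<close> has this form,
  because it is determined by its value at \<open>q\<close>.\<close>

definition zz :: "int \<Rightarrow> nat \<Rightarrow> int \<Rightarrow> int" where
  "zz s k = (\<lambda>a. if a \<in> A then s * (g ^^ k) a else a)"

lemma zz_in: "s = 1 \<or> s = - 1 \<Longrightarrow> zz s k \<in> odd_perms A"
proof (rule odd_permsI[OF A])
  assume s: "s = 1 \<or> s = - 1"
  show "inj_on (zz s k) A" using s odd_bijD(4)[OF odd_bij_funpow[OF g(1)]] unfolding zz_def inj_on_def by auto
  show "zz s k a \<in> A" if "a \<in> A" for a
    using that symmetric_sign[OF A s funpow_in[OF g(2)]] unfolding zz_def by auto
  show "zz s k (- a) = - zz s k a" if "a \<in> A" for a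
    using that symmetricD(3)[OF A] odd_bijD(3)[OF odd_bij_funpow[OF g(1)]] unfolding zz_def by auto
qed (auto simp: zz_def)

lemma gA: "a \<in> A \<Longrightarrow> g a \<in> A"
  using g(2) by auto

lemma zz_comm: "s = 1 \<or> s = - 1 \<Longrightarrow> a \<in> A \<Longrightarrow> zz s k (g a) = g (zz s k a)"
  using gA odd_sign[OF g(1)] unfolding zz_def by (simp add: funpow_swap1)

lemma zz_q: "zz s k q = s * (g ^^ k) q"
  using q unfolding zz_def by simp

lemma commuting_determined:
  assumes y: "y \<in> odd_perms A" "\<And>a. a \<in> A \<Longrightarrow> y (g a) = g (y a)"
    and y': "y' \<in> odd_perms A" "\<And>a. a \<in> A \<Longrightarrow> y' (g a) = g (y' a)" and e: "y q = y' q"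
  shows "y = y'"
proof
  fix a
  show "y a = y' a"
  proof (cases "a \<in> A")
    case True
    then obtain s k where s: "s = 1 \<or> s = - 1" "a = s * (g ^^ k) q" by (rule covers)
    then show ?thesis
      using odd_perms_sign[OF y(1) s(1)] odd_perms_sign[OF y'(1) s(1)] e
        funpow_commute_on[of A y g q k, OF y(2) g(2) q] funpow_commute_on[of A y' g q k, OF y'(2) g(2) q] by simp
  next
    case False
    then show ?thesis using odd_permsD(6)[OF y(1)] odd_permsD(6)[OF y'(1)] by simp
  qed
qed

lemma value_extends:
  assumes y: "y \<in> odd_perms A" "\<And>a. a \<in> A \<Longrightarrow> y (g a) = g (y a)" and h: "odd_bij h"
    "\<And>a. a \<in> A \<Longrightarrow> h (g a) = g (h a)" and e: "y (y q) = h q" and a: "a \<in> A"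
  shows "y (y a) = h a"
proof -
  obtain s k where s: "s = 1 \<or> s = - 1" "a = s * (g ^^ k) q" using a by (rule covers)
  have "y (y a) = s * (g ^^ k) (y (y q))"
    using s odd_perms_sign[OF y(1) s(1)] funpow_commute_on[of A y g q k, OF y(2) g(2) q]
      funpow_commute_on[of A y g "y q" k, OF y(2) g(2) odd_permsD(5)[OF y(1) q]] by simp
  also have "\<dots> = h a" unfolding e s(2) odd_sign[OF h(1) s(1)] using funpow_commute_on[of A h g q k, OF h(2) g(2) q] by simp
  finally show ?thesis .
qed

text \<open>The sign disappears in the square, so the condition concerns the exponent alone and
  every admissible \<open>k\<close> occurs with both signs. Multiplication by \<eta> and
  \<open>g\<close> itself are the two choices of \<open>h\<close> for the two sides of the
  count.\<close>

lemma bij_commuting: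
  assumes h: "odd_bij h" "\<And>a. a \<in> A \<Longrightarrow> h (g a) = g (h a)"
  shows "bij_betw (\<lambda>(s, k). zz s k) ({1, - 1} \<times> {k. k < l \<and> (g ^^ (2 * k)) q = h q})
    {y \<in> odd_perms A. (\<forall>a\<in>A. y (g a) = g (y a)) \<and> (\<forall>a\<in>A. y (y a) = h a)}"
  unfolding bij_betw_def
proof (intro conjI)
  have zzz: "zz s k (zz s k q) = (g ^^ (2 * k)) q" if "s = 1 \<or> s = - 1" for s k
  proof -
    have "zz s k (zz s k q) = s * (g ^^ k) (s * (g ^^ k) q)"
      using symmetric_sign[OF A that funpow_in[OF g(2) q]] q unfolding zz_def by simp
    also have "\<dots> = (g ^^ k) ((g ^^ k) q)" using odd_sign[OF odd_bij_funpow[OF g(1)] that] that by auto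
    finally show ?thesis using funpow_add_apply[of k k g q] by (simp add: mult_2)
  qed
  show "inj_on (\<lambda>(s, k). zz s k) ({1, - 1} \<times> {k. k < l \<and> (g ^^ (2 * k)) q = h q})"
  proof (rule inj_onI, clarify)
    fix s k s' k' assume a: "s \<in> {1, - 1}" "s' \<in> {1, - 1 :: int}" "k < l" "k' < l" "zz s k = zz s' k'"
    then have "s * (g ^^ k) q = s' * (g ^^ k') q" using zz_q by metis
    then show "s = s' \<and> k = k'" using unique[of s s' k k'] a(1-4) by simp
  qed
  show "(\<lambda>(s, k). zz s k) ` ({1, - 1} \<times> {k. k < l \<and> (g ^^ (2 * k)) q = h q}) =
    {y \<in> odd_perms A. (\<forall>a\<in>A. y (g a) = g (y a)) \<and> (\<forall>a\<in>A. y (y a) = h a)}" (is "?L = ?R")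
  proof (intro equalityI subsetI)
    fix y assume "y \<in> ?L"
    then obtain s k where sk: "s = 1 \<or> s = - 1" "k < l" "(g ^^ (2 * k)) q = h q" "y = zz s k" by auto
    then show "y \<in> ?R"
      using zz_in[OF sk(1)] zz_comm[OF sk(1)] value_extends[OF zz_in[OF sk(1)] zz_comm[OF sk(1)] h] zzz[OF sk(1)] by auto
  next
    fix y assume "y \<in> ?R"
    then have y: "y \<in> odd_perms A" "\<And>a. a \<in> A \<Longrightarrow> y (g a) = g (y a)" "\<And>a. a \<in> A \<Longrightarrow> y (y a) = h a" by auto
    have "y q \<in> A" using odd_permsD(5)[OF y(1) q] .
    then obtain s k where sk: "s = 1 \<or> s = - 1" "k < l" "y q = s * (g ^^ k) q" by (rule covers)
    then have yz: "y = zz s k" using commuting_determined[OF y(1,2) zz_in zz_comm] zz_q by auto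
    have "(g ^^ (2 * k)) q = h q" using zzz[OF sk(1), of k] y(3)[OF q] yz by simp
    then show "y \<in> ?L" using sk yz by (intro image_eqI[of _ _ "(s, k)"]) auto
  qed
qed

text \<open>\<open>l\<close> divides \<open>2 * k\<close>, which is less than \<open>2 * l\<close>,
  so only 0 and \<open>l\<close> remain; the sign picked up is 1 or \<open>\<epsilon>\<close>
  accordingly.\<close>

lemma return_cases:
  assumes "k < l" "(g ^^ (2 * k)) q = \<eta> * q" "\<eta> = 1 \<or> \<eta> = - 1"
  shows "k = 0 \<and> \<eta> = 1 \<or> 2 * k = l \<and> \<eta> = \<epsilon>"
proof -
  have "l dvd 2 * k" using assms return_iff by fastforce
  then obtain m where m: "2 * k = l * m" by auto
  have "m < 2"
  proof (rule ccontr)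
    assume "\<not> m < 2"
    then have "l * 2 \<le> l * m" using mult_le_mono2[of 2 m l] by simp
    then show False using m assms(1) by linarith
  qed
  then have "m = 0 \<or> m = 1" by auto
  then show ?thesis
  proof
    assume "m = 0"
    then show ?thesis using m assms q0 by auto
  next
    assume "m = 1"
    then have "2 * k = l" using m by simp
    then have "\<eta> * q = \<epsilon> * q" using assms(2) period by metis
    then show ?thesis using \<open>2 * k = l\<close> q0 by auto
  qed
qed

lemma unit_indices:
  assumes "\<eta> = 1 \<or> \<eta> = - 1"
  shows "{k. k < l \<and> (g ^^ (2 * k)) q = \<eta> * q} =
    (if \<eta> = 1 then {0} else {}) \<union> (if even l \<and> \<eta> = \<epsilon> then {l div 2} else {})"
proof (intro equalityI subsetI)
  fix k assume k: "k \<in> {k. k < l \<and> (g ^^ (2 * k)) q = \<eta> * q}"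
  then consider "k = 0" "\<eta> = 1" | "2 * k = l" "\<eta> = \<epsilon>" using return_cases[OF _ _ assms, of k] by blast
  then show "k \<in> (if \<eta> = 1 then {0} else {}) \<union> (if even l \<and> \<eta> = \<epsilon> then {l div 2} else {})"
    by cases auto
next
  fix k assume k: "k \<in> (if \<eta> = 1 then {0} else {}) \<union> (if even l \<and> \<eta> = \<epsilon> then {l div 2} else {})"
  then consider "k = 0" "\<eta> = 1" | "even l" "k = l div 2" "\<eta> = \<epsilon>" by (auto split: if_splits)
  then show "k \<in> {k. k < l \<and> (g ^^ (2 * k)) q = \<eta> * q}"
  proof cases
    case 2
    then have "2 * k = l" by simp
    then show ?thesis using 2 period l0 by simp
  qed (use l0 in simp)
qed

text \<open>Cancelling one \<open>g\<close> leaves the power \<open>2 * k - 1\<close> fixing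
  \<open>q\<close>. This exponent is a multiple of \<open>l\<close> below \<open>2 * l\<close>,
  hence equal to \<open>l\<close>, which forces odd length and class +1. The index
  \<open>k = 0\<close> is treated apart because of truncated subtraction; it occurs only for
  \<open>l = 1\<close>.\<close>

lemma root_indices:
  obtains "even l \<or> \<epsilon> = - 1" "{k. k < l \<and> (g ^^ (2 * k)) q = g q} = {}"
  | k where "odd l" "\<epsilon> = 1" "{k. k < l \<and> (g ^^ (2 * k)) q = g q} = {k}"
proof -
  have shift: "(g ^^ (2 * k)) q = g q \<longleftrightarrow> (g ^^ (2 * k - 1)) q = q" if "0 < k" for k
  proof -
    have "(g ^^ (2 * k)) q = g ((g ^^ (2 * k - 1)) q)" using that funpow_add_apply[of 1 "2 * k - 1" g q] by simp
    then show ?thesis using odd_bijD(4)[OF g(1)] by simp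
  qed
  have pos: "2 * k - 1 = l \<and> \<epsilon> = 1" if k: "0 < k" "k < l" "(g ^^ (2 * k)) q = g q" for k
  proof -
    have r: "(g ^^ (2 * k - 1)) q = q" using shift[OF k(1)] k(3) by simp
    then have "l dvd 2 * k - 1" using return_iff by blast
    then obtain m where m: "2 * k - 1 = l * m" by auto
    have "m \<noteq> 0" using m k by (intro notI) auto
    moreover have "m < 2"
    proof (rule ccontr)
      assume "\<not> m < 2"
      then have "l * 2 \<le> l * m" using mult_le_mono2[of 2 m l] by simp
      then show False using m k by linarith
    qed
    ultimately have "m = 1" by simp
    then have "2 * k - 1 = l" using m by simp
    moreover have "\<epsilon> * q = q" using r period calculation by simp
    ultimately show ?thesis using q0 by simp
  qed
  have zero: "l = 1 \<and> \<epsilon> = 1" if "q = g q"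
  proof -
    have "(g ^^ 1) q = q" using that by simp
    then have "l dvd 1" using return_iff by blast
    then have "l = 1" by simp
    then show ?thesis using period that q0 by auto
  qed
  show thesis
  proof (cases "odd l \<and> \<epsilon> = 1")
    case True
    show thesis
    proof (cases "l = 1")
      \<comment> \<open>For \<open>l = 1\<close> the index \<open>(l + 1) div 2\<close> is 1 and
        falls outside the range below \<open>l\<close>; the index 0 takes its place.\<close>
      case l1: True
      have "{k. k < l \<and> (g ^^ (2 * k)) q = g q} = {0}" using l1 True period by auto
      then show thesis using that(2) True by blast
    next
      case False
      have "{k. k < l \<and> (g ^^ (2 * k)) q = g q} = {(l + 1) div 2}"
      proof (intro equalityI subsetI)
        fix k assume k: "k \<in> {k. k < l \<and> (g ^^ (2 * k)) q = g q}"
        then have "k \<noteq> 0" using zero False by (intro notI) auto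
        then show "k \<in> {(l + 1) div 2}" using pos[of k] k by auto
      next
        fix k assume "k \<in> {(l + 1) div 2}"
        then have "2 * k = l + 1" "k < l" "0 < k" using True False l0 by (auto elim!: oddE)
        then show "k \<in> {k. k < l \<and> (g ^^ (2 * k)) q = g q}" using shift[of k] period True by simp
      qed
      then show thesis using that(2) True by blast
    qed
  next
    case False
    have "{k. k < l \<and> (g ^^ (2 * k)) q = g q} = {}"
    proof (rule ccontr)
      assume "\<not> ?thesis"
      then obtain k where k: "k < l" "(g ^^ (2 * k)) q = g q" by blast
      show False
      proof (cases "k = 0")
        case True
        then show False using k zero False by auto
      next
        case k0: False
        then have "2 * k - 1 = l" "\<epsilon> = 1" using pos[of k] k by auto
        moreover from this have "odd l" using k0 by presburger
        ultimately show False using False by simp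
      qed
    qed
    moreover have "even l \<or> \<epsilon> = - 1" using False eps by blast
    ultimately show thesis using that(1) by blast
  qed
qed

end

section \<open>Weights on the support of one signed cycle of \<open>g\<close>\<close>

locale single_orbit_weight = single_orbit + quartic_root
begin

text \<open>\<open>d\<close> is the first time at which \<open>q\<close> comes back to its own
  signed cycle of \<open>y\<close>. Since \<open>g\<close> permutes these cycles with period
  \<open>d\<close>, the first \<open>d\<close> points of its orbit form a set of base
  points.\<close>

lemma telescoping_transversal:
  assumes y: "unit_square \<eta> A y" and c: "commutes_on A g y"
    and d: "0 < d" "(g ^^ d) q \<in> cyc y q" "\<And>j. 0 < j \<Longrightarrow> j < d \<Longrightarrow> (g ^^ j) q \<notin> cyc y q"
  shows "transversal y A ((\<lambda>j. (g ^^ j) q) ` {..<d})" "inj_on (\<lambda>j. (g ^^ j) q) {..<d}"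
proof -
  have cp: "cyc y ((g ^^ k) a) = (g ^^ k) ` cyc y a" if "a \<in> A" for k a
  proof (induction k)
    case (Suc k)
    have "cyc y ((g ^^ Suc k) a) = g ` cyc y ((g ^^ k) a)" using cyc_commutes[OF c funpow_in[OF g(2) that]] by simp
    then show ?case unfolding Suc by (simp add: image_comp)
  qed simp
  have step: "cyc y ((g ^^ (k + d)) q) = cyc y ((g ^^ k) q)" for k
  proof -
    have "(g ^^ d) q \<in> A" by (rule funpow_in[OF g(2) q])
    then have "cyc y ((g ^^ (k + d)) q) = (g ^^ k) ` cyc y ((g ^^ d) q)"
      using cp funpow_add_apply[of k d g q] by simp
    also have "cyc y ((g ^^ d) q) = cyc y q" by (rule cyc_mem_eq[OF y q d(2)])
    finally show ?thesis using cp[OF q] by simp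
  qed
  have red: "cyc y ((g ^^ k) q) = cyc y ((g ^^ (k mod d)) q)" for k
  proof (induction k rule: less_induct)
    case (less k)
    show ?case
    proof (cases "k < d")
      case False
      then have "cyc y ((g ^^ k) q) = cyc y ((g ^^ (k - d)) q)" using step[of "k - d"] by simp
      also have "\<dots> = cyc y ((g ^^ ((k - d) mod d)) q)" using less False d(1) by simp
      finally show ?thesis using False by (simp add: le_mod_geq)
    qed simp
  qed
  have ne: "cyc y ((g ^^ i) q) \<noteq> cyc y ((g ^^ j) q)" if "i < j" "j < d" for i j
  proof
    assume "cyc y ((g ^^ i) q) = cyc y ((g ^^ j) q)"
    moreover have "(g ^^ j) q = (g ^^ i) ((g ^^ (j - i)) q)" using that funpow_add_apply[of i "j - i" g q] by simp
    ultimately have "(g ^^ i) ` cyc y q = (g ^^ i) ` cyc y ((g ^^ (j - i)) q)"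
      using cp[OF q] cp[OF funpow_in[OF g(2) q]] by metis
    then have "cyc y q = cyc y ((g ^^ (j - i)) q)"
      using odd_bijD(2)[OF odd_bij_funpow[OF g(1)]] by (simp add: inj_image_eq_iff)
    then have "(g ^^ (j - i)) q \<in> cyc y q" by (simp add: cyc_def)
    moreover have "0 < j - i" "j - i < d" using that by linarith+
    ultimately show False using d(3) by blast
  qed
  show inj: "inj_on (\<lambda>j. (g ^^ j) q) {..<d}"
    unfolding inj_on_def using ne by (metis lessThan_iff linorder_neqE_nat)
  show "transversal y A ((\<lambda>j. (g ^^ j) q) ` {..<d})" unfolding transversal_def
  proof (intro conjI)
    show "(\<lambda>j. (g ^^ j) q) ` {..<d} \<subseteq> A" using funpow_in[OF g(2) q] by auto
    then have "cyc y ` (\<lambda>j. (g ^^ j) q) ` {..<d} \<subseteq> cyc y ` A" by (rule image_mono)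
    moreover have "cyc y ` A \<subseteq> cyc y ` (\<lambda>j. (g ^^ j) q) ` {..<d}"
    proof (rule image_subsetI)
      fix a assume a: "a \<in> A"
      then obtain s k where s: "s = 1 \<or> s = - 1" "a = s * (g ^^ k) q" by (rule covers)
      have "cyc y a = cyc y ((g ^^ k) q)" using s cyc_eqs(1)[OF y funpow_in[OF g(2) q]] by auto
      then have "cyc y a = cyc y ((g ^^ (k mod d)) q)" using red by simp
      then show "cyc y a \<in> cyc y ` (\<lambda>j. (g ^^ j) q) ` {..<d}" using d(1) by auto
    qed
    ultimately show "cyc y ` (\<lambda>j. (g ^^ j) q) ` {..<d} = cyc y ` A" by (rule equalityI)
    show "inj_on (cyc y) ((\<lambda>j. (g ^^ j) q) ` {..<d})"
      using ne by (auto simp: inj_on_def) (metis linorder_neqE_nat)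
  qed
qed

text \<open>With these base points every denominator cancels the preceding numerator, and only the
  return to the first cycle of \<open>y\<close> is left.\<close>

lemma telescoping_weight:
  assumes y: "unit_square \<eta> A y" and c: "commutes_on A g y"
    and d: "0 < d" "(g ^^ d) q \<in> cyc y q" "\<And>j. 0 < j \<Longrightarrow> j < d \<Longrightarrow> (g ^^ j) q \<notin> cyc y q"
    and p: "potential y A p"
  shows "weight A y g = p ((g ^^ d) q) / p q"
proof -
  note T = telescoping_transversal[OF y c d]
  have nz: "p ((g ^^ j) q) \<noteq> 0" for j using potentialD(1)[OF p funpow_in[OF g(2) q]] .
  have tele: "(\<Prod>j<m. p ((g ^^ Suc j) q) / p ((g ^^ j) q)) = p ((g ^^ m) q) / p q" for m
    using nz nz[of 0] by (induction m) auto
  have "weight A y g = (\<Prod>a\<in>(\<lambda>j. (g ^^ j) q) ` {..<d}. p (g a) / p a)" by (rule weight_eq[OF y c T(1) p])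
  also have "\<dots> = (\<Prod>j<d. p ((g ^^ Suc j) q) / p ((g ^^ j) q))"
    using prod.reindex[OF T(2), of "\<lambda>a. p (g a) / p a"] by (simp only: o_def funpow.simps)
  finally show ?thesis using tele by simp
qed

text \<open>The signed cycle of \<open>y\<close> through \<open>q\<close> is just
  \<open>{q, - q}\<close>, so the first return takes \<open>l\<close> steps and ends at
  \<open>\<epsilon> * q\<close>.\<close>

lemma weight_sign:
  assumes y: "unit_square \<eta> A y" and c: "commutes_on A g y" and yq: "y q = q \<or> y q = - q"
  shows "weight A y g = (if \<epsilon> = 1 then 1 else mu y q)"
proof -
  obtain T p where p: "potential y A p" using ex_transversal_potential[OF y] by blast
  have cy: "cyc y q = {q, - q}" using yq unfolding cyc_def by auto
  have "weight A y g = p ((g ^^ l) q) / p q"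
    using telescoping_weight[OF y c l0 _ _ p] minimal period eps unfolding cy by auto
  then show ?thesis unfolding period using potentialD[OF p q] eps by auto
qed

text \<open>The first return takes only \<open>k\<close> steps and ends at \<open>s * y q\<close>.
  It picks up the multiplier of \<open>y\<close> and, for negative \<open>s\<close>, also that of
  negation.\<close>

lemma weight_half:
  assumes y: "unit_square \<eta> A y" and c: "commutes_on A g y"
    and k: "0 < k" "2 * k = l" and s: "s = 1 \<or> s = - 1" and yq: "y q = s * (g ^^ k) q"
  shows "weight A y g = (if \<eta> = 1 then - 1 else of_int s * \<iota>)"
proof -
  obtain T p where p: "potential y A p" using ex_transversal_potential[OF y] by blast
  have gk: "(g ^^ k) q = s * y q" using yq s by auto
  have not: "(g ^^ j) q \<notin> {q, - q}" if "0 < j" "j < l" for j using minimal[OF that] by auto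
  have "(g ^^ j) q \<notin> cyc y q" if j: "0 < j" "j < k" for j
  proof
    assume "(g ^^ j) q \<in> cyc y q"
    then have "(g ^^ j) q = y q \<or> (g ^^ j) q = - y q" using not[of j] j k unfolding cyc_def by auto
    then have "1 * (g ^^ j) q = s * (g ^^ k) q \<or> 1 * (g ^^ j) q = (- s) * (g ^^ k) q" using yq by simp
    then obtain s' where s': "s' = 1 \<or> s' = - 1" "1 * (g ^^ j) q = s' * (g ^^ k) q"
      using s by (metis minus_minus)
    then have "j = k" using unique[of 1 s' j k] j k by simp
    then show False using j by simp
  qed
  then have w: "weight A y g = p ((g ^^ k) q) / p q"
    using telescoping_weight[OF y c k(1) _ _ p] gk s unfolding cyc_def by auto
  have ne: "y q \<noteq> q" "y q \<noteq> - q" using not[of k] k gk s by auto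
  have yq0: "y q \<in> A" "y q \<noteq> 0" using unit_squareD(3,7)[OF y] q by auto
  have yy: "y (y q) = \<eta> * q" "y (y (y q)) = \<eta> * y q"
    using unit_squareD(5)[OF y q] unit_squareD(5)[OF y yq0(1)] by blast+
  have kap: "kap y q = (if \<eta> = 1 then - 1 else \<iota>)"
    unfolding kap_def yy using ne unit_squareD(1)[OF y] q0 by auto
  have mu: "mu y (y q) = of_int \<eta>"
    unfolding mu_def unfolding yy(2) unfolding yy(1) using ne unit_squareD(1)[OF y] q0 yq0 by auto
  have "p (s * y q) = (if \<eta> = 1 then - 1 else of_int s * \<iota>) * p q"
    using s potentialD(3)[OF p q] potentialD(2)[OF p yq0(1)] kap mu unit_squareD(1)[OF y] by auto
  then show ?thesis unfolding w gk using potentialD(1)[OF p q] by simp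
qed

end

section \<open>The weighted count of commuting involutions\<close>

lemma odd_bij_unit: "\<eta> = 1 \<or> \<eta> = - 1 \<Longrightarrow> odd_bij (\<lambda>a. \<eta> * a)"
  unfolding odd_bij_def by (auto intro!: bij_betw_byWitness[where f' = "\<lambda>a. \<eta> * a"])

lemma unit_square_uminus: "symmetric A \<Longrightarrow> unit_square 1 A uminus"
  unfolding unit_square_def symmetric_def by auto

lemma commutes_on_uminus: "odd_bij x \<Longrightarrow> x ` A = A \<Longrightarrow> commutes_on A x uminus"
  unfolding commutes_on_def by (auto simp: odd_bijD(3))

lemma mu_uminus: "mu uminus a = - 1"
  unfolding mu_def by simp

context quartic_root
begin

lemma potential_uminus:
  assumes "symmetric A" "\<And>a. a \<in> A \<Longrightarrow> p a \<noteq> 0" "\<And>a. a \<in> A \<Longrightarrow> p (- a) = - p a"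
  shows "potential uminus A p"
  unfolding potential_def mu_def kap_def using assms symmetricD[OF assms(1)] by auto

text \<open>Negation is itself an involution whose signed cycles all have length 1 and class -1,
  with \<open>mu\<close> equal to -1. The sign count is thus a weight and inherits the freedom in
  choosing base points.\<close>

lemma theta_weight:
  assumes A: "symmetric A" and x: "odd_bij x" "x ` A = A"
  shows "theta (- 1) A x = weight A uminus x"
proof -
  have T: "transversal uminus A {a \<in> A. 0 < a}" unfolding transversal_def
  proof (intro conjI)
    show "inj_on (cyc uminus) {a \<in> A. 0 < a}"
    proof (rule inj_onI)
      fix a c assume "a \<in> {a \<in> A. 0 < a}" "c \<in> {a \<in> A. 0 < a}" and e: "cyc uminus a = cyc uminus c"
      moreover have "a \<in> cyc uminus c" unfolding e[symmetric] by (simp add: cyc_def)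
      ultimately show "a = c" unfolding cyc_def by auto
    qed
    have "cyc uminus a \<in> cyc uminus ` {a \<in> A. 0 < a}" if "a \<in> A" for a
    proof -
      have "\<bar>a\<bar> \<in> {a \<in> A. 0 < a}" using symmetricD(3,4)[OF A that] that by (auto simp: abs_if)
      moreover have "cyc uminus a = cyc uminus \<bar>a\<bar>" unfolding cyc_def by (auto simp: abs_if)
      ultimately show ?thesis by (metis imageI)
    qed
    then show "cyc uminus ` {a \<in> A. 0 < a} = cyc uminus ` A" by auto
  qed auto
  have p: "potential uminus A (sgnc (- 1))"
    using A symmetricD(4)[OF A] by (intro potential_uminus) (auto simp: sgnc_def)
  show ?thesis unfolding weight_eq[OF unit_square_uminus[OF A] commutes_on_uminus[OF x] T p] theta_def
    by (intro prod.cong refl) (auto simp: sgnc_def)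
qed

end

lemma theta_one: "theta 1 A x = 1"
  unfolding theta_def sgnc_def by simp

lemma theta_values: "\<eta> = 1 \<or> \<eta> = - 1 \<Longrightarrow> theta \<eta> A x = 1 \<or> theta \<eta> A x = - 1"
proof -
  assume "\<eta> = 1 \<or> \<eta> = - 1"
  then have "(theta \<eta> A x)\<^sup>2 = 1"
    unfolding theta_def prod_power_distrib by (intro prod.neutral) (auto simp: sgnc_def)
  then show ?thesis by (simp add: power2_eq_1_iff)
qed

context single_orbit_weight
begin

lemma commuting_unit_squares_eq:
  assumes "\<eta> = 1 \<or> \<eta> = - 1"
  shows "commuting_unit_squares \<eta> A g =
    {y \<in> odd_perms A. (\<forall>a\<in>A. y (g a) = g (y a)) \<and> (\<forall>a\<in>A. y (y a) = \<eta> * a)}"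
  unfolding commuting_unit_squares_def unit_square_def commutes_on_def
  using A g assms odd_permsD(2,5) by auto

lemma square_roots_eq:
  "square_roots A g = {y \<in> odd_perms A. (\<forall>a\<in>A. y (g a) = g (y a)) \<and> (\<forall>a\<in>A. y (y a) = g a)}"
  using square_rootsD(3) unfolding square_roots_def by fastforce

lemma sum_over_indices:
  fixes f :: "(int \<Rightarrow> int) \<Rightarrow> complex"
  assumes "odd_bij h" "\<And>a. a \<in> A \<Longrightarrow> h (g a) = g (h a)"
  shows "sum f {y \<in> odd_perms A. (\<forall>a\<in>A. y (g a) = g (y a)) \<and> (\<forall>a\<in>A. y (y a) = h a)} =
    (\<Sum>k\<in>{k. k < l \<and> (g ^^ (2 * k)) q = h q}. f (zz 1 k) + f (zz (- 1) k))"
proof -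
  let ?K = "{k. k < l \<and> (g ^^ (2 * k)) q = h q}"
  have "sum f {y \<in> odd_perms A. (\<forall>a\<in>A. y (g a) = g (y a)) \<and> (\<forall>a\<in>A. y (y a) = h a)}
      = (\<Sum>sk\<in>{1, - 1} \<times> ?K. f (case sk of (s, k) \<Rightarrow> zz s k))"
    by (rule sum.reindex_bij_betw[OF bij_commuting[OF assms], symmetric])
  also have "\<dots> = (\<Sum>s\<in>{1, - 1}. \<Sum>k\<in>?K. f (zz s k))"
    by (simp add: sum.cartesian_product split_def)
  also have "\<dots> = (\<Sum>k\<in>?K. f (zz 1 k) + f (zz (- 1) k))" by (simp add: sum.distrib)
  finally show ?thesis .
qed

lemma commutes_zz: "s = 1 \<or> s = - 1 \<Longrightarrow> commutes_on A g (zz s k)"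
  unfolding commutes_on_def using g zz_comm by auto

lemma unit_square_zz:
  assumes \<eta>: "\<eta> = 1 \<or> \<eta> = - 1" and s: "s = 1 \<or> s = - 1" and k: "k \<in> {k. k < l \<and> (g ^^ (2 * k)) q = \<eta> * q}"
  shows "unit_square \<eta> A (zz s k)"
proof -
  have "zz s k \<in> (\<lambda>(s, k). zz s k) ` ({1, - 1} \<times> {k. k < l \<and> (g ^^ (2 * k)) q = \<eta> * q})"
    using s k by (intro image_eqI[of _ _ "(s, k)"]) auto
  then have "zz s k \<in> commuting_unit_squares \<eta> A g"
    unfolding commuting_unit_squares_eq[OF \<eta>]
    using bij_commuting[OF odd_bij_unit[OF \<eta>]] odd_sign[OF g(1) \<eta>] unfolding bij_betw_def by auto
  then show ?thesis unfolding commuting_unit_squares_def by simp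
qed

text \<open>The two elements differ by negation on \<open>A\<close>, whose sign count is -1 to the
  power \<open>l\<close>, the number of pairs of opposite points.\<close>

lemma theta_opposite:
  assumes "odd l"
  shows "theta (- 1) A (zz (- 1) k) = - theta (- 1) A (zz 1 k)"
proof -
  let ?n = "zz (- 1) 0"
  have n: "?n \<in> odd_perms A" by (rule zz_in) simp
  have z: "zz 1 k \<in> odd_perms A" by (rule zz_in) simp
  have "zz (- 1) k = ?n \<circ> zz 1 k"
    using odd_permsD(5)[OF z] unfolding zz_def by (auto simp: fun_eq_iff)
  then have "theta (- 1) A (zz (- 1) k) = theta (- 1) A (zz 1 k) * theta (- 1) A ?n"
    using theta_comp[of "- 1" A "zz 1 k" A ?n] A odd_bij_inj_on[OF odd_permsD(3)[OF z]] odd_permsD(2,4)[OF z]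
      odd_permsD(2,5)[OF n] symmetricD(4)[OF A] by simp
  moreover have "theta (- 1) A ?n = - 1"
  proof -
    note u = unit_square_uminus[OF A]
    obtain T0 p where p: "potential uminus A p" using ex_transversal_potential[OF u] by blast
    have cyc: "cyc uminus q = {q, - q}" unfolding cyc_def by auto
    note T = telescoping_transversal[OF u commutes_on_uminus[OF g] l0, unfolded cyc]
    have tr: "transversal uminus A ((\<lambda>j. (g ^^ j) q) ` {..<l})" and inj: "inj_on (\<lambda>j. (g ^^ j) q) {..<l}"
      using T minimal period eps by auto
    have "theta (- 1) A ?n = (\<Prod>a\<in>(\<lambda>j. (g ^^ j) q) ` {..<l}. p (?n a) / p a)"
      unfolding theta_weight[OF A odd_permsD(3,4)[OF n]]
      by (rule weight_eq[OF u commutes_on_uminus[OF odd_permsD(3,4)[OF n]] tr p])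
    also have "\<dots> = (\<Prod>a\<in>(\<lambda>j. (g ^^ j) q) ` {..<l}. - 1)"
    proof (rule prod.cong[OF refl])
      fix a assume "a \<in> (\<lambda>j. (g ^^ j) q) ` {..<l}"
      then have a: "a \<in> A" using tr unfolding transversal_def by auto
      then show "p (?n a) / p a = - 1" using potentialD(1,2)[OF p a] by (simp add: zz_def mu_uminus)
    qed
    also have "\<dots> = (- 1) ^ l" using card_image[OF inj] by simp
    finally show ?thesis using assms by simp
  qed
  ultimately show ?thesis by simp
qed

text \<open>For \<eta> = 1 the exponent 0 contributes 1 and \<open>\<epsilon>\<close>, and the
  exponent \<open>l div 2\<close>, present for even length and class +1, contributes -1 twice. The
  total is 2 for odd length and class +1 and 0 otherwise, as is the number of square roots. For
  \<eta> = -1 both sides vanish: the weights \<iota> and its negative cancel, and so do the sign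
  counts of opposite roots.\<close>

lemma single_orbit_sums:
  assumes \<eta>: "\<eta> = 1 \<or> \<eta> = - 1"
  shows "(\<Sum>y\<in>commuting_unit_squares \<eta> A g. weight A y g) = (\<Sum>x\<in>square_roots A g. theta \<eta> A x)"
proof -
  let ?K = "{k. k < l \<and> (g ^^ (2 * k)) q = \<eta> * q}"
  have lhs: "(\<Sum>y\<in>commuting_unit_squares \<eta> A g. weight A y g) =
      (\<Sum>k\<in>?K. weight A (zz 1 k) g + weight A (zz (- 1) k) g)"
    unfolding commuting_unit_squares_eq[OF \<eta>]
    using odd_sign[OF g(1) \<eta>] by (intro sum_over_indices odd_bij_unit[OF \<eta>]) simp
  have rhs: "(\<Sum>x\<in>square_roots A g. theta \<eta> A x) =
      (\<Sum>k\<in>{k. k < l \<and> (g ^^ (2 * k)) q = g q}. theta \<eta> A (zz 1 k) + theta \<eta> A (zz (- 1) k))"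
    unfolding square_roots_eq by (rule sum_over_indices[OF g(1)]) simp
  have w: "weight A (zz s k) g = (if \<eta> = 1 then - 1 else of_int s * \<iota>)"
    if k: "k \<in> ?K" "2 * k = l" and s: "s = 1 \<or> s = - 1" for s k
    by (rule weight_half[OF unit_square_zz[OF \<eta> s k(1)] commutes_zz[OF s] _ k(2) s zz_q]) (use k l0 in simp)
  have half_in: "l div 2 \<in> ?K" if "even l" "\<eta> = \<epsilon>" using unit_indices[OF \<eta>] that by auto
  show ?thesis
  proof (cases "\<eta> = 1")
    case True
    have zin: "0 \<in> ?K" using l0 True by simp
    have w0: "weight A (zz 1 0) g = 1" "weight A (zz (- 1) 0) g = of_int \<epsilon>"
    proof -
      have "mu (zz 1 0) q = 1" "mu (zz (- 1) 0) q = - 1"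
        unfolding mu_def using q q0 symmetricD(3)[OF A q] by (auto simp: zz_def)
      then show "weight A (zz 1 0) g = 1" "weight A (zz (- 1) 0) g = of_int \<epsilon>"
        using weight_sign[OF unit_square_zz[OF \<eta> _ zin] commutes_zz, of 1] 
          weight_sign[OF unit_square_zz[OF \<eta> _ zin] commutes_zz, of "- 1"] zz_q eps by auto
    qed
    have K: "?K = {0} \<union> (if even l \<and> \<epsilon> = 1 then {l div 2} else {})"
      using unit_indices[OF \<eta>] True by auto
    have "(\<Sum>k\<in>?K. weight A (zz 1 k) g + weight A (zz (- 1) k) g) =
        (if \<epsilon> = 1 \<and> odd l then 2 else 0)"
    proof (cases "even l \<and> \<epsilon> = 1")
      case c: True
      then have h: "2 * (l div 2) = l" "l div 2 \<noteq> 0" using l0 by (auto elim!: evenE)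
      have "weight A (zz 1 (l div 2)) g = - 1" "weight A (zz (- 1) (l div 2)) g = - 1"
        using w[OF half_in h(1)] c True by auto
      then show ?thesis unfolding K using c h w0 by simp
    next
      case c: False
      then show ?thesis unfolding K using w0 eps by auto
    qed
    moreover have "(\<Sum>x\<in>square_roots A g. theta \<eta> A x) = (if \<epsilon> = 1 \<and> odd l then 2 else 0)"
    proof (rule root_indices)
      assume a: "even l \<or> \<epsilon> = - 1" "{k. k < l \<and> (g ^^ (2 * k)) q = g q} = {}"
      show ?thesis unfolding rhs a(2) using a(1) by auto
    next
      fix k assume a: "odd l" "\<epsilon> = 1" "{k. k < l \<and> (g ^^ (2 * k)) q = g q} = {k}"
      show ?thesis unfolding rhs a(3) using a(1,2) True by (simp add: theta_one)
    qed
    ultimately show ?thesis unfolding lhs by simp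
  next
    case False
    then have \<eta>1: "\<eta> = - 1" using \<eta> by simp
    have z1: "(\<Sum>k\<in>?K. weight A (zz 1 k) g + weight A (zz (- 1) k) g) = 0"
    proof (rule sum.neutral, rule ballI)
      fix k assume k: "k \<in> ?K"
      then have "2 * k = l" using return_cases[of k \<eta>] \<eta>1 by auto
      then show "weight A (zz 1 k) g + weight A (zz (- 1) k) g = 0"
        using w[OF k, of 1] w[OF k, of "- 1"] False by simp
    qed
    have z2: "(\<Sum>k\<in>{k. k < l \<and> (g ^^ (2 * k)) q = g q}. theta (- 1) A (zz 1 k) + theta (- 1) A (zz (- 1) k)) = 0"
    proof (rule root_indices)
      fix k assume "odd l" "{k. k < l \<and> (g ^^ (2 * k)) q = g q} = {k}"
      then show ?thesis using theta_opposite by simp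
    next
      assume a: "{k. k < l \<and> (g ^^ (2 * k)) q = g q} = {}"
      show ?thesis unfolding a by simp
    qed
    show ?thesis unfolding lhs z1 rhs using z2 \<eta>1 by simp
  qed
qed

text \<open>The map sending each power of \<open>g\<close> at \<open>q\<close> to the inverse power
  reverses \<open>g\<close>. If its sign count is -1, the class must be -1; then \<open>g\<close>
  has sign count -1 too, and following the reversal by \<open>g\<close> repairs the parity while
  still reversing \<open>g\<close>.\<close>

lemma ex_reversal:
  obtains t where "t \<in> odd_perms A" "\<And>a. a \<in> A \<Longrightarrow> g (t (g a)) = t a" "theta (- 1) A t = 1"
proof -
  have gl: "(g ^^ (l + k)) q = \<epsilon> * (g ^^ k) q" for k
  proof -
    have "(g ^^ (l + k)) q = (g ^^ k) ((g ^^ l) q)" using funpow_add_apply[of k l g q] by (simp add: add.commute)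
    then show ?thesis unfolding period using odd_sign[OF odd_bij_funpow[OF g(1)] eps] by simp
  qed
  have ee: "\<epsilon> * (\<epsilon> * a) = a" for a using eps by auto
  \<comment> \<open>The exponent \<open>- k\<close> is represented by \<open>l - k\<close>, with
    \<open>\<epsilon>\<close> compensating for the added period; for \<open>k = 0\<close> the result
    is \<open>s * q\<close> again.\<close>
  define t where "t a = (if a \<in> A then
    (THE b. \<exists>s k. (s = 1 \<or> s = - 1) \<and> k < l \<and> a = s * (g ^^ k) q \<and> b = s * \<epsilon> * (g ^^ (l - k)) q) else a)" for a
  have t: "t (s * (g ^^ k) q) = s * \<epsilon> * (g ^^ (l - k)) q" if s: "s = 1 \<or> s = - 1" and k: "k < l" for s k
  proof -
    have "s * (g ^^ k) q \<in> A" using symmetric_sign[OF A s funpow_in[OF g(2) q]] .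
    moreover have "(THE b. \<exists>s' k'. (s' = 1 \<or> s' = - 1) \<and> k' < l \<and> s * (g ^^ k) q = s' * (g ^^ k') q \<and> b = s' * \<epsilon> * (g ^^ (l - k')) q)
      = s * \<epsilon> * (g ^^ (l - k)) q"
    proof (rule the_equality)
      show "\<exists>s' k'. (s' = 1 \<or> s' = - 1) \<and> k' < l \<and> s * (g ^^ k) q = s' * (g ^^ k') q \<and>
        s * \<epsilon> * (g ^^ (l - k)) q = s' * \<epsilon> * (g ^^ (l - k')) q" using s k by blast
      fix b assume "\<exists>s' k'. (s' = 1 \<or> s' = - 1) \<and> k' < l \<and> s * (g ^^ k) q = s' * (g ^^ k') q \<and> b = s' * \<epsilon> * (g ^^ (l - k')) q"
      then obtain s' k' where a: "s' = 1 \<or> s' = - 1" "k' < l" "s * (g ^^ k) q = s' * (g ^^ k') q" "b = s' * \<epsilon> * (g ^^ (l - k')) q"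
        by blast
      then have "s = s' \<and> k = k'" using unique[OF s a(1) k a(2,3)] by blast
      then show "b = s * \<epsilon> * (g ^^ (l - k)) q" using a(4) by simp
    qed
    ultimately show ?thesis unfolding t_def by simp
  qed
  have tq: "t (s * q) = s * q" if "s = 1 \<or> s = - 1" for s
    using t[OF that l0] period ee[of q] by (simp add: mult.assoc)
  have tt: "t (t a) = a" if a: "a \<in> A" for a
  proof -
    obtain s k where s: "s = 1 \<or> s = - 1" "k < l" "a = s * (g ^^ k) q" using a by (rule covers)
    show ?thesis
    proof (cases "k = 0")
      case True
      then show ?thesis using s tq[OF s(1)] by simp
    next
      case False
      have se: "s * \<epsilon> = 1 \<or> s * \<epsilon> = - 1" using s(1) eps by auto
      have "t (t a) = s * \<epsilon> * \<epsilon> * (g ^^ (l - (l - k))) q"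
        unfolding s(3) t[OF s(1,2)] using False s(2) by (subst t[OF se]) auto
      then show ?thesis using s ee by (simp add: mult.assoc)
    qed
  qed
  have tA: "t \<in> odd_perms A"
  proof (rule odd_permsI[OF A])
    show "t a \<in> A" if a: "a \<in> A" for a
    proof -
      obtain s k where s: "s = 1 \<or> s = - 1" "k < l" "a = s * (g ^^ k) q" using a by (rule covers)
      have "s * \<epsilon> = 1 \<or> s * \<epsilon> = - 1" using s(1) eps by auto
      then show ?thesis unfolding s(3) t[OF s(1,2)] using symmetric_sign[OF A _ funpow_in[OF g(2) q]] by blast
    qed
    show "t (- a) = - t a" if a: "a \<in> A" for a
    proof -
      obtain s k where s: "s = 1 \<or> s = - 1" "k < l" "a = s * (g ^^ k) q" using a by (rule covers)
      then have "- a = (- s) * (g ^^ k) q" "- s = 1 \<or> - s = - 1" by auto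
      then show ?thesis using t[OF _ s(2), of "- s"] t[OF s(1,2)] s(3) by simp
    qed
    show "inj_on t A" by (rule inj_on_inverseI[where g = t]) (rule tt)
  qed (auto simp: t_def)
  have tg: "g (t (g a)) = t a" if a: "a \<in> A" for a
  proof -
    obtain s k where s: "s = 1 \<or> s = - 1" "k < l" "a = s * (g ^^ k) q" using a by (rule covers)
    have se: "s * \<epsilon> = 1 \<or> s * \<epsilon> = - 1" using s(1) eps by auto
    have ga: "g a = s * (g ^^ Suc k) q" using s odd_sign[OF g(1) s(1)] by simp
    show ?thesis
    proof (cases "Suc k < l")
      case True
      have "g (t (g a)) = s * \<epsilon> * (g ^^ Suc (l - Suc k)) q"
        unfolding ga t[OF s(1) True] odd_sign[OF g(1) se] by simp
      also have "Suc (l - Suc k) = l - k" using True by simp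
      finally show ?thesis unfolding s(3) t[OF s(1,2)] .
    next
      case False
      then have k: "l = Suc k" using s(2) by simp
      have "g a = (s * \<epsilon>) * q" unfolding ga using period k by simp
      then have "g (t (g a)) = s * \<epsilon> * g q" using tq[OF se] odd_sign[OF g(1) se] by simp
      then show ?thesis unfolding s(3) t[OF s(1,2)] using k by simp
    qed
  qed
  show thesis
  proof (cases "theta (- 1) A t = 1")
    case True
    with that tA tg show thesis by blast
  next
    case False
    then have th: "theta (- 1) A t = - 1" using theta_values[of "- 1" A t] by simp
    note u = unit_square_uminus[OF A]
    have "\<epsilon> \<noteq> 1"
    proof
      assume e1: "\<epsilon> = 1"
      \<comment> \<open>For class +1 the powers of \<open>g\<close> at \<open>q\<close> fill one of
        two opposite halves of \<open>A\<close>. The reversal preserves this half, so with it as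
        base points and \<open>p\<close> constant on it every factor is 1.\<close>
      define S where "S = (\<lambda>j. (g ^^ j) q) ` {..<l}"
      define p :: "int \<Rightarrow> complex" where "p a = (if a \<in> S then 1 else - 1)" for a
      have S: "(- a \<in> S) = (a \<notin> S)" if a: "a \<in> A" for a
      proof -
        obtain s k where s: "s = 1 \<or> s = - 1" "k < l" "a = s * (g ^^ k) q" using a by (rule covers)
        have in_S: "s' * (g ^^ k) q \<in> S \<longleftrightarrow> s' = 1" if s': "s' = 1 \<or> s' = - 1" for s'
        proof
          assume "s' * (g ^^ k) q \<in> S"
          then obtain j where "j < l" "s' * (g ^^ k) q = 1 * (g ^^ j) q" unfolding S_def by auto
          then show "s' = 1" using unique[OF s' _ s(2), of 1 j] by simp
        qed (use s(2) in \<open>auto simp: S_def\<close>)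
        show ?thesis using in_S[OF s(1)] in_S[of "- s"] s by auto
      qed
      have p: "potential uminus A p" using S by (intro potential_uminus[OF A]) (auto simp: p_def)
      have cyc: "cyc uminus q = {q, - q}" unfolding cyc_def by auto
      have tr: "transversal uminus A S"
        unfolding S_def using telescoping_transversal(1)[OF u commutes_on_uminus[OF g] l0] minimal period eps cyc by auto
      have tS: "t a \<in> S" if aS: "a \<in> S" for a
      proof -
        obtain k where k: "k < l" "a = (g ^^ k) q" using aS unfolding S_def by auto
        show ?thesis
        proof (cases "k = 0")
          case True
          then show ?thesis using tq[of 1] k aS by simp
        next
          case False
          then show ?thesis using t[of 1 k] k e1 unfolding S_def by auto
        qed
      qed
      have "theta (- 1) A t = (\<Prod>a\<in>S. p (t a) / p a)"
        unfolding theta_weight[OF A odd_permsD(3,4)[OF tA]]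
        by (rule weight_eq[OF u commutes_on_uminus[OF odd_permsD(3,4)[OF tA]] tr p])
      also have "\<dots> = 1" using tS by (intro prod.neutral) (auto simp: p_def)
      finally show False using th by simp
    qed
    have "theta (- 1) A (zz 1 1) = theta (- 1) A g" by (rule theta_cong) (simp add: zz_def)
    also have "\<dots> = - 1"
      unfolding theta_weight[OF A g] using weight_sign[OF u commutes_on_uminus[OF g]] \<open>\<epsilon> \<noteq> 1\<close> mu_uminus by simp
    finally have thg: "theta (- 1) A (zz 1 1) = - 1" .
    have z: "zz 1 1 \<in> odd_perms A" by (rule zz_in) simp
    have c: "zz 1 1 \<circ> t \<in> odd_perms A"
      using z tA permutes_compose unfolding odd_perms_def by auto
    have zt: "(zz 1 1 \<circ> t) a = g (t a)" if "a \<in> A" for a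
      using odd_permsD(5)[OF tA that] by (simp add: zz_def)
    have "g ((zz 1 1 \<circ> t) (g a)) = (zz 1 1 \<circ> t) a" if a: "a \<in> A" for a
      unfolding zt[OF a] zt[OF gA[OF a]] tg[OF a] ..
    moreover have "theta (- 1) A (zz 1 1 \<circ> t) = 1"
      using theta_comp[of "- 1" A t A "zz 1 1"] A odd_bij_inj_on[OF odd_permsD(3)[OF tA]] odd_permsD(2,4)[OF tA]
        odd_permsD(2,5)[OF z] symmetricD(4)[OF A] th thg by simp
    ultimately show thesis using that[OF c] by blast
  qed
qed

end

section \<open>Induction over the signed cycles of \<open>g\<close>\<close>

context quartic_root
begin

text \<open>A fixed \<open>q\<close> with signed orbit \<open>A\<close> is followed on both sides.
  If its image stays in \<open>A\<close>, then \<open>A\<close> splits off; if its image is some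
  \<open>r\<close> outside, then \<open>A\<close> splits off together with the orbit of
  \<open>r\<close>. The split parts agree by \<open>single_orbit_sums\<close> and
  \<open>exchanged_orbits\<close>, the remainders by induction.\<close>

lemma weighted_count:
  assumes \<eta>: "\<eta> = 1 \<or> \<eta> = - 1" and "symmetric X" "odd_bij g" "g ` X = X"
  shows "(\<Sum>y\<in>commuting_unit_squares \<eta> X g. weight X y g) = (\<Sum>x\<in>square_roots X g. theta \<eta> X x)"
  using assms(2-)
proof (induction "card X" arbitrary: X rule: less_induct)
  case less
  note X = less.prems(1) and g = less.prems(2,3)
  show ?case
  proof (cases "X = {}")
    case True
    have "odd_perms {} = {id}" unfolding odd_perms_def by auto
    moreover have u: "unit_square \<eta> {} id" "commutes_on {} g id"
      using \<eta> g(1) unfolding unit_square_def symmetric_def commutes_on_def by auto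
    moreover have "weight {} id g = 1"
      using weight_eq[OF u, of "{}" "\<lambda>_. 1"] unfolding transversal_def potential_def by simp
    ultimately have "commuting_unit_squares \<eta> {} g = {id}" "square_roots {} g = {id}" "weight {} id g = 1"
      unfolding commuting_unit_squares_def square_roots_def by auto
    then show ?thesis unfolding True theta_def by simp
  next
    case False
    then obtain q where q: "q \<in> X" by blast
    define A where "A = signed_orbit g q"
    note A = signed_orbit_props[OF X g q, folded A_def]
    have qA: "q \<in> A" unfolding A_def by (rule signed_orbit_self)
    have IH: "(\<Sum>y\<in>commuting_unit_squares \<eta> (X - U) g. weight (X - U) y g) =
        (\<Sum>x\<in>square_roots (X - U) g. theta \<eta> (X - U) x)"
      if U: "symmetric U" "g ` U = U" "A \<subseteq> U" for U
    proof (rule less.hyps)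
      have "X - U \<subset> X" using U(3) qA q by blast
      then show "card (X - U) < card X" using psubset_card_mono[OF symmetricD(1)[OF X]] by blast
    qed (use symmetric_Diff[OF X U(1)] g image_Diff_invariant[OF g U(2)] in auto)
    define r_orb where "r_orb r = signed_orbit g r" for r
    \<comment> \<open>\<open>B\<close> is the set of values allowed at \<open>q\<close>:
      \<open>A\<close> itself or a single \<open>{r}\<close>. The disjunction about
      \<open>y (y q)\<close> lets one invariance hypothesis serve both unit squares and square
      roots.\<close>
    have split_Y: "sum (\<lambda>y. weight X y g) {y \<in> commuting_unit_squares \<eta> X g. y q \<in> B} =
        sum (\<lambda>y. weight U y g) {y \<in> commuting_unit_squares \<eta> U g. y q \<in> B} *
        sum (\<lambda>y. weight (X - U) y g) (commuting_unit_squares \<eta> (X - U) g)"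
      and split_R: "sum (theta \<eta> X) {x \<in> square_roots X g. x q \<in> B} =
        sum (theta \<eta> U) {x \<in> square_roots U g. x q \<in> B} * sum (theta \<eta> (X - U)) (square_roots (X - U) g)"
      if U: "symmetric U" "g ` U = U" "A \<subseteq> U" "U \<subseteq> X"
        and Y: "\<And>y. y \<in> odd_perms X \<Longrightarrow> (\<And>a. a \<in> X \<Longrightarrow> y (g a) = g (y a)) \<Longrightarrow>
          y (y q) = \<eta> * q \<or> y (y q) = g q \<Longrightarrow> y q \<in> B \<Longrightarrow> y ` U \<subseteq> U" for B U
    proof -
      have V: "symmetric (X - U)" by (rule symmetric_Diff[OF X U(1)])
      have gV: "g ` (X - U) = X - U" by (rule image_Diff_invariant[OF g U(2)])
      have UV: "U \<union> (X - U) = X" "U \<inter> (X - U) = {}" using U(4) by auto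
      note gl = bij_betw_glue(2,3)[OF U(1) V UV(2)]
      have qU: "q \<in> U" using U(3) qA by blast
      show "sum (\<lambda>y. weight X y g) {y \<in> commuting_unit_squares \<eta> X g. y q \<in> B} =
        sum (\<lambda>y. weight U y g) {y \<in> commuting_unit_squares \<eta> U g. y q \<in> B} *
        sum (\<lambda>y. weight (X - U) y g) (commuting_unit_squares \<eta> (X - U) g)"
      proof (rule sum_glue[OF U(1) V UV(2)], unfold UV(1))
        show "{y \<in> commuting_unit_squares \<eta> X g. y q \<in> B} \<subseteq> {y \<in> odd_perms X. y ` U \<subseteq> U}"
        proof
          fix y assume "y \<in> {y \<in> commuting_unit_squares \<eta> X g. y q \<in> B}"
          then have y: "y \<in> odd_perms X" "unit_square \<eta> X y" "commutes_on X g y" "y q \<in> B"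
            unfolding commuting_unit_squares_def by auto
          then show "y \<in> {y \<in> odd_perms X. y ` U \<subseteq> U}"
            using Y[OF y(1) commutes_onD(3)[OF y(3)] _ y(4)] unit_squareD(5)[OF y(2) q] by blast
        qed
        fix u v assume "u \<in> odd_perms U" "v \<in> odd_perms (X - U)"
        then show "u \<circ> v \<in> {y \<in> commuting_unit_squares \<eta> X g. y q \<in> B} \<longleftrightarrow>
          u \<in> {y \<in> commuting_unit_squares \<eta> U g. y q \<in> B} \<and> v \<in> commuting_unit_squares \<eta> (X - U) g"
          using commuting_unit_squares_glue[OF U(1) V UV(2) g(1) U(2) gV, of u v \<eta>] gl(1)[of u v q] qU UV(1) by auto
      next
        fix u v assume "u \<in> {y \<in> commuting_unit_squares \<eta> U g. y q \<in> B}" "v \<in> commuting_unit_squares \<eta> (X - U) g"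
        then show "weight X (u \<circ> v) g = weight U u g * weight (X - U) v g"
          using weight_glue[OF U(1) V UV(2), of u \<eta> g v] UV(1) by simp
      qed (auto simp: commuting_unit_squares_def)
      show "sum (theta \<eta> X) {x \<in> square_roots X g. x q \<in> B} =
        sum (theta \<eta> U) {x \<in> square_roots U g. x q \<in> B} * sum (theta \<eta> (X - U)) (square_roots (X - U) g)"
      proof (rule sum_glue[OF U(1) V UV(2)], unfold UV(1))
        show "{x \<in> square_roots X g. x q \<in> B} \<subseteq> {y \<in> odd_perms X. y ` U \<subseteq> U}"
        proof
          fix y assume "y \<in> {x \<in> square_roots X g. x q \<in> B}"
          then have y: "y \<in> square_roots X g" "y q \<in> B" by auto
          then show "y \<in> {y \<in> odd_perms X. y ` U \<subseteq> U}"
            using Y[OF square_rootsD(1,3)[OF y(1)] _ y(2)] square_rootsD(1)[OF y(1)] square_rootsD(2)[OF y(1) q] by blast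
        qed
        fix u v assume "u \<in> odd_perms U" "v \<in> odd_perms (X - U)"
        then show "u \<circ> v \<in> {x \<in> square_roots X g. x q \<in> B} \<longleftrightarrow>
          u \<in> {x \<in> square_roots U g. x q \<in> B} \<and> v \<in> square_roots (X - U) g"
          using square_roots_glue[OF U(1) V UV(2), of u v g] gl(1)[of u v q] qU UV(1) by auto
      next
        fix u v assume "u \<in> {x \<in> square_roots U g. x q \<in> B}" "v \<in> square_roots (X - U) g"
        then have uv: "u \<in> odd_perms U" "v \<in> odd_perms (X - U)" using square_rootsD(1) by auto
        have "theta \<eta> X (u \<circ> v) = theta \<eta> U (u \<circ> v) * theta \<eta> (X - U) (u \<circ> v)"
          using theta_Un[OF U(1) V UV(2)] UV(1) by simp
        also have "theta \<eta> U (u \<circ> v) = theta \<eta> U u" by (rule theta_cong) (rule gl(1)[OF uv])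
        also have "theta \<eta> (X - U) (u \<circ> v) = theta \<eta> (X - U) v" by (rule theta_cong) (rule gl(2)[OF uv])
        finally show "theta \<eta> X (u \<circ> v) = theta \<eta> U u * theta \<eta> (X - U) v" .
      qed (auto simp: square_roots_def)
    qed
    have orbit_image: "y ` signed_orbit g c \<subseteq> U"
      if "y \<in> odd_perms X" "\<And>a. a \<in> X \<Longrightarrow> y (g a) = g (y a)" "symmetric U" "g ` U = U" "c \<in> X" "y c \<in> U" for y U c
    proof
      fix b assume "b \<in> y ` signed_orbit g c"
      then obtain a where a: "a \<in> signed_orbit g c" "b = y a" by blast
      from a(1) obtain s k where s: "s = 1 \<or> s = - 1" "a = s * (g ^^ k) c" by (rule signed_orbitE)
      have "b = s * (g ^^ k) (y c)"
        unfolding a(2) s(2) odd_perms_sign[OF that(1) s(1)] using funpow_commute_on[of X y g c k, OF that(2) g(2) that(5)] by simp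
      then show "b \<in> U" using symmetric_sign[OF that(3) s(1) funpow_in[OF that(4,6)]] by simp
    qed
    have subX: "A \<subseteq> X" using A(1) .
    have finY: "finite (commuting_unit_squares \<eta> X g)" "finite (square_roots X g)"
      using finite_odd_perms[OF X] unfolding commuting_unit_squares_def square_roots_def by auto
    have inX: "y q \<in> X" if "y \<in> odd_perms X" for y using odd_permsD(5)[OF that q] .
    have self: "sum (\<lambda>y. weight X y g) {y \<in> commuting_unit_squares \<eta> X g. y q \<in> A} =
        sum (theta \<eta> X) {x \<in> square_roots X g. x q \<in> A}"
    proof -
      have inv: "y ` A \<subseteq> A" if "y \<in> odd_perms X" "\<And>a. a \<in> X \<Longrightarrow> y (g a) = g (y a)" "y q \<in> A" for y
        using orbit_image[OF that(1,2) A(2,3) q that(3)] unfolding A_def .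
      obtain l \<epsilon> where so: "single_orbit g A q l \<epsilon>" unfolding A_def by (rule ex_single_orbit[OF X g q])
      interpret S: single_orbit g A q l \<epsilon> by (rule so)
      interpret S: single_orbit_weight g A q l \<epsilon> \<iota> by unfold_locales
      have "{y \<in> commuting_unit_squares \<eta> A g. y q \<in> A} = commuting_unit_squares \<eta> A g"
        "{x \<in> square_roots A g. x q \<in> A} = square_roots A g"
        using odd_permsD(5)[OF _ qA] unfolding commuting_unit_squares_def square_roots_def by auto
      then show ?thesis
        using split_Y[OF A(2,3) order.refl A(1), of A] split_R[OF A(2,3) order.refl A(1), of A] inv
          IH[OF A(2,3) order.refl] S.single_orbit_sums[OF \<eta>] by simp
    qed
    have other: "sum (\<lambda>y. weight X y g) {y \<in> commuting_unit_squares \<eta> X g. y q = r} =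
        sum (theta \<eta> X) {x \<in> square_roots X g. x q = r}" if r: "r \<in> X - A" for r
    proof -
      have rX: "r \<in> X" and rA: "r \<notin> signed_orbit g q" using r unfolding A_def by auto
      note A' = signed_orbit_props[OF X g rX]
      let ?U = "A \<union> signed_orbit g r"
      have U: "symmetric ?U" "g ` ?U = ?U" "A \<subseteq> ?U" "?U \<subseteq> X"
        using symmetric_Un[OF A(2) A'(2)] A A' by auto
      have inv: "y ` ?U \<subseteq> ?U"
        if y: "y \<in> odd_perms X" "\<And>a. a \<in> X \<Longrightarrow> y (g a) = g (y a)" "y (y q) = \<eta> * q \<or> y (y q) = g q" "y q \<in> {r}" for y
      proof -
        have "y q \<in> ?U" using y(4) signed_orbit_self[of r g] by simp
        then have 1: "y ` A \<subseteq> ?U" using orbit_image[OF y(1,2) U(1,2) q] unfolding A_def by blast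
        \<comment> \<open>With \<open>r = y q\<close>, the value \<open>y r\<close> is
          \<open>\<eta> * q\<close> or \<open>g q\<close>, so the second orbit is sent back to the
          first.\<close>
        have "y r \<in> A" using y(3,4) symmetric_sign[OF A(2) \<eta> qA] A(3) qA by auto
        then have "y ` signed_orbit g r \<subseteq> ?U" using orbit_image[OF y(1,2) U(1,2) rX] by blast
        with 1 show ?thesis by blast
      qed
      show ?thesis
        using split_Y[OF U inv, of "{r}"] split_R[OF U inv, of "{r}"] IH[OF U(1-3)]
          exchanged_orbits[OF \<eta> X g q rX rA, folded A_def] by simp
    qed
    have "sum (\<lambda>y. weight X y g) (commuting_unit_squares \<eta> X g) =
        sum (\<lambda>y. weight X y g) {y \<in> commuting_unit_squares \<eta> X g. y q \<in> A} +
        (\<Sum>r\<in>X - A. sum (\<lambda>y. weight X y g) {y \<in> commuting_unit_squares \<eta> X g. y q = r})"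
      by (rule sum_by_value[OF finY(1) symmetricD(1)[OF X] subX]) (use inX in \<open>auto simp: commuting_unit_squares_def\<close>)
    also have "\<dots> = sum (theta \<eta> X) {x \<in> square_roots X g. x q \<in> A} +
        (\<Sum>r\<in>X - A. sum (theta \<eta> X) {x \<in> square_roots X g. x q = r})"
      using self other by simp
    also have "\<dots> = sum (theta \<eta> X) (square_roots X g)"
      by (rule sum_by_value[OF finY(2) symmetricD(1)[OF X] subX, symmetric]) (use inX in \<open>auto simp: square_roots_def\<close>)
    finally show ?thesis .
  qed
qed

text \<open>Reversals of the separate signed cycles glue together. Having each of them even makes
  the whole even, so that elements of D_n are conjugate to their inverses inside D_n itself.\<close>

lemma ex_even_reversal:
  assumes "symmetric X" "odd_bij g" "g ` X = X"
  shows "\<exists>t\<in>odd_perms X. (\<forall>a\<in>X. g (t (g a)) = t a) \<and> theta (- 1) X t = 1"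
  using assms
proof (induction "card X" arbitrary: X rule: less_induct)
  case less
  note X = less.prems(1) and g = less.prems(2,3)
  show ?case
  proof (cases "X = {}")
    case True
    then show ?thesis by (intro bexI[of _ id]) (auto simp: theta_def odd_perms_def)
  next
    case False
    then obtain q where q: "q \<in> X" by blast
    define A where "A = signed_orbit g q"
    note A = signed_orbit_props[OF X g q, folded A_def]
    have qA: "q \<in> A" unfolding A_def by (rule signed_orbit_self)
    have V: "symmetric (X - A)" by (rule symmetric_Diff[OF X A(2)])
    have gV: "g ` (X - A) = X - A" by (rule image_Diff_invariant[OF g A(3)])
    have UV: "A \<union> (X - A) = X" "A \<inter> (X - A) = {}" using A(1) by auto
    have "X - A \<subset> X" using qA q by blast
    then have "card (X - A) < card X" using psubset_card_mono[OF symmetricD(1)[OF X]] by blast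
    from less.hyps[OF this V g(1) gV] obtain v where v: "v \<in> odd_perms (X - A)"
      "\<And>a. a \<in> X - A \<Longrightarrow> g (v (g a)) = v a" "theta (- 1) (X - A) v = 1" by blast
    obtain l \<epsilon> where so: "single_orbit g A q l \<epsilon>" unfolding A_def by (rule ex_single_orbit[OF X g q])
    interpret S: single_orbit g A q l \<epsilon> by (rule so)
    interpret S: single_orbit_weight g A q l \<epsilon> \<iota> by unfold_locales
    obtain u where u: "u \<in> odd_perms A" "\<And>a. a \<in> A \<Longrightarrow> g (u (g a)) = u a" "theta (- 1) A u = 1"
      by (rule S.ex_reversal) blast
    note gl = bij_betw_glue[OF A(2) V UV(2), unfolded UV(1)]
    have "u \<circ> v \<in> odd_perms X" using gl(1) u(1) v(1) unfolding bij_betw_def by auto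
    moreover have "g ((u \<circ> v) (g a)) = (u \<circ> v) a" if "a \<in> X" for a
    proof (cases "a \<in> A")
      case True
      then have "g a \<in> A" using A(3) by blast
      then show ?thesis using gl(2)[OF u(1) v(1)] u(2) True by simp
    next
      case False
      then have a: "a \<in> X - A" using that by simp
      then have "g a \<in> X - A" using gV by blast
      then show ?thesis using gl(3)[OF u(1) v(1)] v(2) a by simp
    qed
    moreover have "theta (- 1) X (u \<circ> v) = 1"
    proof -
      have "theta (- 1) X (u \<circ> v) = theta (- 1) A (u \<circ> v) * theta (- 1) (X - A) (u \<circ> v)"
        using theta_Un[OF A(2) V UV(2)] UV(1) by simp
      also have "theta (- 1) A (u \<circ> v) = theta (- 1) A u" by (rule theta_cong) (rule gl(2)[OF u(1) v(1)])
      also have "theta (- 1) (X - A) (u \<circ> v) = theta (- 1) (X - A) v" by (rule theta_cong) (rule gl(3)[OF u(1) v(1)])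
      finally show ?thesis unfolding u(3) v(3) by (simp only: mult_1)
    qed
    ultimately show ?thesis by blast
  qed
qed

end

section \<open>The characters \<open>\<omega>\<close>\<close>

lemma symmetric_letters: "symmetric (letters n)"
  unfolding symmetric_def letters_def by auto

lemma carrier_B_group: "carrier (B_group n) = odd_perms (letters n)"
proof -
  have "w (- i) = - w i" if "w permutes letters n" "\<forall>i\<in>letters n. w (- i) = - w i" for w i
  proof (cases "i \<in> letters n")
    case False
    then have "- i \<notin> letters n" unfolding letters_def by auto
    then show ?thesis using False that(1) by (simp add: permutes_not_in)
  qed (use that in auto)
  then show ?thesis unfolding B_group_def odd_perms_def by auto
qed

lemma mult_B_group [simp]: "g \<otimes>\<^bsub>B_group n\<^esub> h = g \<circ> h"
  by (simp add: B_group_def)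

lemma one_B_group [simp]: "\<one>\<^bsub>B_group n\<^esub> = id"
  by (simp add: B_group_def)

lemma odd_perms_comp: "g \<in> odd_perms X \<Longrightarrow> h \<in> odd_perms X \<Longrightarrow> g \<circ> h \<in> odd_perms X"
  unfolding odd_perms_def using permutes_compose by auto

lemma group_B_group: "group (B_group n)"
proof (rule groupI)
  fix g assume "g \<in> carrier (B_group n)"
  then have g: "g \<in> odd_perms (letters n)" by (simp add: carrier_B_group)
  let ?h = "inv_into UNIV g"
  have p: "g permutes letters n" using odd_permsD(1)[OF g] .
  have hg: "?h (g a) = a" and gh: "g (?h a) = a" for a
    using permutes_inverses[OF p] by auto
  have "?h (- a) = - ?h a" for a
    using hg[of "- ?h a"] gh odd_permsD(2)[OF g] by simp
  then have "?h \<in> odd_perms (letters n)" unfolding odd_perms_def using permutes_inv[OF p] by simp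
  moreover have "?h \<circ> g = id" using hg by auto
  ultimately show "\<exists>h\<in>carrier (B_group n). h \<otimes>\<^bsub>B_group n\<^esub> g = \<one>\<^bsub>B_group n\<^esub>"
    by (auto simp: carrier_B_group)
qed (auto simp: carrier_B_group odd_perms_comp, auto simp: odd_perms_def comp_assoc permutes_id)

section \<open>Values of faithful characters of the cyclic groups of order 1, 2 and 4\<close>

lemma integer_mod_character_power:
  assumes chi: "faithful_linear_character (integer_mod_group i) \<chi>" and i: "i \<ge> 1"
  shows "\<chi> (int t mod int i) = \<chi> (1 mod int i) ^ t" "\<chi> 0 = 1"
proof -
  have hom: "\<chi> \<in> hom (integer_mod_group i) complex_units"
    using chi unfolding faithful_linear_character_def linear_character_def by simp
  have c: "x mod int i \<in> carrier (integer_mod_group i)" for x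
    using i by (simp add: carrier_integer_mod_group)
  have m: "\<chi> ((x mod int i + y mod int i) mod int i) = \<chi> (x mod int i) * \<chi> (y mod int i)" for x y
    using hom_mult[OF hom c c, of x y] by (simp add: complex_units_def)
  have nz: "\<chi> (x mod int i) \<noteq> 0" for x
    using hom_in_carrier[OF hom c, of x] by (simp add: complex_units_def)
  show z: "\<chi> 0 = 1" using m[of 0 0] nz[of 0] by simp
  show "\<chi> (int t mod int i) = \<chi> (1 mod int i) ^ t"
  proof (induction t)
    case (Suc t)
    have "int (Suc t) mod int i = (int t mod int i + 1 mod int i) mod int i"
      by (simp add: mod_add_eq add.commute)
    then show ?case using m[of "int t" 1] Suc by simp
  qed (use z in simp)
qed

lemma integer_mod_2_character:
  assumes chi: "faithful_linear_character (integer_mod_group 2) \<chi>"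
  shows "\<chi> 1 = - 1"
proof -
  have "\<chi> 1 ^ 2 = 1" using integer_mod_character_power(1)[OF chi, of 2] integer_mod_character_power(2)[OF chi] by simp
  moreover have "inj_on \<chi> {0..<2}"
    using chi unfolding faithful_linear_character_def by (simp add: carrier_integer_mod_group)
  then have "\<chi> 1 \<noteq> \<chi> 0" using inj_onD[of \<chi> "{0..<2}" 1 0] by auto
  ultimately show ?thesis using integer_mod_character_power(2)[OF chi] by (simp add: power2_eq_1_iff)
qed

text \<open>The square in question is the value at 2, a square root of 1 that faithfulness separates
  from the value 1 at 0.\<close>

lemma integer_mod_4_character:
  assumes chi: "faithful_linear_character (integer_mod_group 4) \<chi>"
  shows "\<chi> 1 * \<chi> 1 = - 1"
proof -
  have 2: "\<chi> 2 = \<chi> 1 ^ 2" "\<chi> 0 = \<chi> 1 ^ 4"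
    using integer_mod_character_power(1)[OF chi, of 2] integer_mod_character_power(1)[OF chi, of 4] by simp_all
  have "(\<chi> 1 * \<chi> 1)\<^sup>2 = 1"
    using 2 integer_mod_character_power(2)[OF chi] by (simp add: power2_eq_square power4_eq_xxxx mult.assoc)
  moreover have "inj_on \<chi> {0..<4}"
    using chi unfolding faithful_linear_character_def by (simp add: carrier_integer_mod_group)
  then have "\<chi> 2 \<noteq> \<chi> 0" using inj_onD[of \<chi> "{0..<4}" 2 0] by auto
  then have "\<chi> 1 * \<chi> 1 \<noteq> 1"
    using 2 integer_mod_character_power(2)[OF chi] by (simp add: power2_eq_square)
  ultimately show ?thesis by (simp add: power2_eq_1_iff)
qed

text \<open>\<open>orbit x a\<close> starts at \<open>x a\<close>, so \<open>a\<close> itself enters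
  as \<open>x (x a)\<close> up to sign; these two steps and negation reach the whole cycle.\<close>

lemma orbit_unit_square:
  assumes x: "unit_square \<eta> X x" and a: "a \<in> X"
  shows "orbit x a \<union> uminus ` orbit x a = cyc x a"
proof -
  note xa = unit_squareD(3-7)[OF x a]
  have closed: "x c \<in> cyc x a" "- c \<in> cyc x a" if "c \<in> cyc x a" for c
    using that xa unit_squareD(1)[OF x] unit_squareD(4)[OF x, of "x a"] unfolding cyc_def by auto
  have sub: "orbit x a \<subseteq> cyc x a"
  proof
    fix c assume "c \<in> orbit x a"
    then show "c \<in> cyc x a" by induction (auto simp: cyc_def intro: closed(1), use closed(1) in \<open>auto simp: cyc_def\<close>)
  qed
  have "x a \<in> orbit x a" "x (x a) \<in> orbit x a" by (auto intro: orbit.intros)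
  then have "cyc x a \<subseteq> orbit x a \<union> uminus ` orbit x a"
    using xa(3) unit_squareD(1)[OF x] unfolding cyc_def by (auto simp: image_iff) (metis minus_minus)+
  with sub closed(2) show ?thesis by blast
qed

lemma signed_cycles_eq:
  "unit_square \<eta> (letters n) x \<Longrightarrow> signed_cycles n x = cyc x ` letters n"
  unfolding signed_cycles_def using orbit_unit_square by auto

context quartic_root
begin

lemma mu_kap_cyc:
  assumes x: "unit_square \<eta> X x" and inj: "inj_on x X" and a: "a \<in> X" and c: "c \<in> cyc x a"
  shows "mu x c = mu x a" "kap x c = kap x a"
proof -
  have neg: "mu x (- d) = mu x d" "kap x (- d) = kap x d" if "d \<in> X" for d
    using unit_squareD(3-7)[OF x that] unit_squareD(4)[OF x, of "x d"] unfolding mu_def kap_def by auto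
  have xa: "x a \<in> X" and a': "- a \<in> X" and xxa: "x (x a) \<in> X"
    using unit_squareD(3,6)[OF x a] unit_squareD(3)[OF x, of "x a"] by auto
  have e: "x (x a) = x a \<longleftrightarrow> x a = a" "x (x a) = - x a \<longleftrightarrow> x a = - a"
    "x (x (x a)) = - x a \<longleftrightarrow> x (x a) = - a" "x (x (x a)) = x a \<longleftrightarrow> x (x a) = a"
    using inj_on_eq_iff[OF inj xa a] inj_on_eq_iff[OF inj xa a'] inj_on_eq_iff[OF inj xxa a'] inj_on_eq_iff[OF inj xxa a]
    unfolding unit_squareD(4)[OF x a] by blast+
  have rot: "mu x (x a) = mu x a" "kap x (x a) = kap x a" unfolding mu_def kap_def e by simp_all
  show "mu x c = mu x a" "kap x c = kap x a"
    using c neg[OF a] neg[OF xa] rot unfolding cyc_def by auto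
qed

end

text \<open>\<open>\<iota>\<close> is tied to the given character of order 4. Among the values at
  generators of base factors for cycles of length at most 2, this is the one that faithfulness does
  not determine.\<close>

locale signed_involution = quartic_root +
  fixes n :: nat and \<eta> :: int and x :: "int \<Rightarrow> int" and b :: "int set \<Rightarrow> int"
    and \<kappa>pos \<kappa>neg :: "nat \<Rightarrow> int \<Rightarrow> complex"
  assumes x: "x \<in> odd_perms (letters n)" and sq: "unit_square \<eta> (letters n) x"
    and b: "\<And>Q. Q \<in> signed_cycles n x \<Longrightarrow> b Q \<in> Q"
    and kpos: "\<And>i. i \<ge> 1 \<Longrightarrow> faithful_linear_character (integer_mod_group i) (\<kappa>pos i)"
    and kneg: "\<And>i. i \<ge> 1 \<Longrightarrow> faithful_linear_character (integer_mod_group (2 * i)) (\<kappa>neg i)"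
    and iota_eq: "\<iota> = \<kappa>neg 2 1"
begin

abbreviation "X \<equiv> letters n"
abbreviation "Z \<equiv> centralizer (B_group n) x"

definition T :: "int set" where "T = b ` cyc x ` X"

lemma b_cyc: "Q \<in> cyc x ` X \<Longrightarrow> b Q \<in> Q"
  using b signed_cycles_eq[OF sq] by simp

lemma T_transversal: "transversal x X T"
  unfolding T_def by (rule transversal_choice(1)[OF sq b_cyc])

lemma b_props: "a \<in> X \<Longrightarrow> b (cyc x a) \<in> X \<and> cyc x (b (cyc x a)) = cyc x a \<and> b (cyc x a) \<in> T"
  using transversal_choice(2)[OF sq b_cyc] unfolding T_def by blast

lemma T_unique: "t \<in> T \<Longrightarrow> t' \<in> T \<Longrightarrow> t' \<in> cyc x t \<Longrightarrow> t' = t"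
  using T_transversal cyc_mem_eq[OF sq, of t t'] unfolding transversal_def by (metis inj_onD subsetD)

lemma T_X: "T \<subseteq> X" "finite T"
proof -
  show "T \<subseteq> X" using T_transversal unfolding transversal_def by simp
  then show "finite T" using symmetricD(1)[OF symmetric_letters] by (rule finite_subset)
qed

lemma x_inj: "inj_on x X"
  by (rule odd_bij_inj_on[OF odd_permsD(3)[OF x]])

lemma centralizer_eq: "Z = {z \<in> odd_perms X. commutes_on X z x}"
proof -
  have "z \<circ> x = x \<circ> z \<longleftrightarrow> commutes_on X z x" if z: "z \<in> odd_perms X" for z
  proof
    assume c: "commutes_on X z x"
    show "z \<circ> x = x \<circ> z"
    proof
      fix a
      show "(z \<circ> x) a = (x \<circ> z) a"
        using commutes_onD(3)[OF c, of a] odd_permsD(6)[OF z, of a] odd_permsD(6)[OF x, of a] by (cases "a \<in> X") auto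
    qed
  next
    assume "z \<circ> x = x \<circ> z"
    then show "commutes_on X z x" unfolding commutes_on_def using odd_permsD(3,4)[OF z] by (metis comp_apply)
  qed
  then show ?thesis unfolding centralizer_def carrier_B_group by auto
qed

text \<open>A general element of the base factor of \<open>Q\<close>, with exponents
  \<open>s\<close> of negation and \<open>t\<close> of the cycle, written pointwise to make it easy
  to compute with.\<close>

definition loc :: "int set \<Rightarrow> nat \<Rightarrow> nat \<Rightarrow> int \<Rightarrow> int" where
  "loc Q s t c = (if c \<in> Q then (- 1) ^ s * (x ^^ t) c else c)"

lemma cyc_closed:
  assumes "a \<in> X" "c \<in> cyc x a"
  shows "x c \<in> cyc x a" "- c \<in> cyc x a" "(x ^^ t) c \<in> cyc x a" "(- 1) ^ s * (x ^^ t) c \<in> cyc x a"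
proof -
  note xa = unit_squareD(3-7)[OF sq assms(1)]
  have 1: "x c \<in> cyc x a" "- c \<in> cyc x a" if "c \<in> cyc x a" for c
    using that xa unit_squareD(1)[OF sq] odd_permsD(2)[OF x] unfolding cyc_def by auto
  show "x c \<in> cyc x a" "- c \<in> cyc x a" using 1 assms(2) by auto
  show 2: "(x ^^ t) c \<in> cyc x a" using 1 assms(2) by (induction t) auto
  show "(- 1) ^ s * (x ^^ t) c \<in> cyc x a" using 1(2)[OF 2] 2 by (cases "even s") auto
qed

lemma sub_X: "Q \<in> cyc x ` X \<Longrightarrow> Q \<subseteq> X"
  using cyc_eqs(3)[OF sq] by blast

lemma loc_in:
  assumes a: "a \<in> X"
  shows "loc (cyc x a) s t \<in> Z"
proof -
  let ?L = "loc (cyc x a) s t"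
  have sgn: "(- 1) ^ s = (1 :: int) \<or> (- 1) ^ s = (- 1 :: int)" by (cases "even s") auto
  have ob: "odd_bij (x ^^ t)" by (rule odd_bij_funpow[OF odd_permsD(3)[OF x]])
  have closed_iff: "- c \<in> cyc x a \<longleftrightarrow> c \<in> cyc x a" for c
    using cyc_closed(2)[OF a, of c] cyc_closed(2)[OF a, of "- c"] by auto
  have x_iff: "x c \<in> cyc x a \<longleftrightarrow> c \<in> cyc x a" if c: "c \<in> X" for c
  proof
    assume "x c \<in> cyc x a"
    then have "x (x c) \<in> cyc x a" by (rule cyc_closed(1)[OF a])
    moreover have "x (x c) = c \<or> x (x c) = - c" using unit_squareD(5)[OF sq c] unit_squareD(1)[OF sq] by auto
    ultimately show "c \<in> cyc x a" using closed_iff by metis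
  qed (rule cyc_closed(1)[OF a])
  have L: "?L \<in> odd_perms X"
  proof (rule odd_permsI[OF symmetric_letters])
    show "?L c \<in> X" if "c \<in> X" for c
      using that cyc_closed(4)[OF a] sub_X[of "cyc x a"] a unfolding loc_def by auto
    show "?L c = c" if "c \<notin> X" for c using that sub_X[of "cyc x a"] a unfolding loc_def by auto
    show "?L (- c) = - ?L c" if "c \<in> X" for c unfolding loc_def using closed_iff odd_bijD(3)[OF ob] by simp
    show "inj_on ?L X"
    proof (rule inj_onI)
      fix c e assume "?L c = ?L e"
      then show "c = e" unfolding loc_def using cyc_closed(4)[OF a, of c s t] cyc_closed(4)[OF a, of e s t] odd_bijD(4)[OF ob]
        by (auto split: if_splits)
    qed
  qed
  have "x (?L c) = ?L (x c)" if "c \<in> X" for c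
    unfolding loc_def using x_iff[OF that] odd_perms_sign[OF x sgn] by (simp add: funpow_swap1)
  then have "commutes_on X ?L x" unfolding commutes_on_def using odd_permsD(3,4)[OF L] by auto
  then show ?thesis unfolding centralizer_eq using L by blast
qed

lemma restrict_powers:
  assumes a: "a \<in> X"
  defines "Q \<equiv> cyc x a"
  shows "(perm_restrict (w0 n) Q ^^ s) \<circ> (perm_restrict x Q ^^ t) = loc Q s t"
    "perm_restrict x Q ^^ t = loc Q 0 t"
proof -
  have 1: "(perm_restrict x Q ^^ t) c = (if c \<in> Q then (x ^^ t) c else c)" for c
  proof (induction t)
    case (Suc t)
    show ?case using Suc cyc_closed(3)[OF a, of c t] unfolding perm_restrict_def Q_def by auto
  qed simp
  have 2: "(perm_restrict (w0 n) Q ^^ s) c = (if c \<in> Q then (- 1) ^ s * c else c)" for c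
  proof (induction s)
    case (Suc s)
    have "(- 1) ^ s * c \<in> Q" "(- 1) ^ s * c \<in> X" if "c \<in> Q"
      using cyc_closed(4)[OF a, of c s 0] that sub_X[of Q] a unfolding Q_def by auto
    then show ?case using Suc unfolding perm_restrict_def w0_def by auto
  qed simp
  show "(perm_restrict (w0 n) Q ^^ s) \<circ> (perm_restrict x Q ^^ t) = loc Q s t"
    using cyc_closed(3)[OF a, folded Q_def] by (auto simp: fun_eq_iff 1 2 loc_def)
  show "perm_restrict x Q ^^ t = loc Q 0 t"
    by (auto simp: fun_eq_iff 1 loc_def)
qed

text \<open>Among the base points only the one in \<open>Q\<close> can be moved, so the product has
  a single nontrivial factor.\<close>

lemma weight_loc:
  assumes a: "a \<in> X"
  shows "weight X x (loc (cyc x a) s t) = mu x a ^ s * kap x a ^ t"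
proof -
  let ?Q = "cyc x a"
  obtain T0 p where p: "potential x X p" using ex_transversal_potential[OF sq] by blast
  define u where "u = b ?Q"
  have u: "u \<in> X" "cyc x u = ?Q" "u \<in> T" using b_props[OF a] unfolding u_def by auto
  have uQ: "u \<in> ?Q" using u(2) unfolding cyc_def by auto
  note inv = mu_kap_cyc[OF sq x_inj a]
  have c: "commutes_on X (loc ?Q s t) x" using loc_in[OF a] unfolding centralizer_eq by simp
  have pk: "p ((x ^^ t) u) = kap x a ^ t * p u" for t
  proof (induction t)
    case (Suc t)
    have "(x ^^ t) u \<in> ?Q" by (rule cyc_closed(3)[OF a uQ])
    then show ?case using potentialD(3)[OF p, of "(x ^^ t) u"] sub_X[of ?Q] a inv Suc by auto
  qed simp
  have pm: "p ((- 1) ^ s * c) = mu x a ^ s * p c" if "c \<in> ?Q" for c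
  proof (induction s)
    case (Suc s)
    have "(- 1) ^ s * c \<in> ?Q" using cyc_closed(4)[OF a that, of s 0] by simp
    then show ?case using potentialD(2)[OF p, of "(- 1) ^ s * c"] sub_X[of ?Q] a inv Suc by auto
  qed simp
  have "weight X x (loc ?Q s t) = (\<Prod>c\<in>T. p (loc ?Q s t c) / p c)" by (rule weight_eq[OF sq c T_transversal p])
  also have "\<dots> = (\<Prod>c\<in>T. if c = u then mu x a ^ s * kap x a ^ t else 1)"
  proof (rule prod.cong[OF refl])
    fix c assume cT: "c \<in> T"
    have cX: "c \<in> X" using cT T_X by auto
    show "p (loc ?Q s t c) / p c = (if c = u then mu x a ^ s * kap x a ^ t else 1)"
    proof (cases "c = u")
      case True
      then show ?thesis using uQ pm[OF cyc_closed(3)[OF a uQ]] pk potentialD(1)[OF p u(1)] unfolding loc_def by simp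
    next
      case False
      then have "c \<notin> ?Q" using T_unique[OF u(3) cT] u(2) by auto
      then show ?thesis using False potentialD(1)[OF p cX] unfolding loc_def by simp
    qed
  qed
  also have "\<dots> = mu x a ^ s * kap x a ^ t" using u(3) T_X(2) by (simp add: prod.delta)
  finally show ?thesis .
qed

lemma negative_cycle_iff:
  assumes a: "a \<in> X"
  shows "negative_cycle x (cyc x a) \<longleftrightarrow> mu x a = - 1"
proof
  assume "negative_cycle x (cyc x a)"
  then obtain c where c: "c \<in> cyc x a" "uminus ` orbit x c = orbit x c" unfolding negative_cycle_def by blast
  have cX: "c \<in> X" using c(1) sub_X a by blast
  note xc = unit_squareD(3-7)[OF sq cX]
  have "mu x c = - 1"
  proof (cases "\<eta> = 1")
    case True
    have "orbit x c \<subseteq> {c, x c}"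
    proof
      fix d assume "d \<in> orbit x c"
      then show "d \<in> {c, x c}" using xc(3) True by induction auto
    qed
    moreover have "x c \<in> orbit x c" by (rule orbit.base)
    moreover from this have "- x c \<in> orbit x c" using c(2) by blast
    ultimately have "- x c = c \<or> - x c = x c" by blast
    then have "x c = - c" using symmetricD(5)[OF symmetric_letters xc(1)] by auto
    then show ?thesis unfolding mu_def by simp
  next
    case False
    then show ?thesis using xc(3) unit_squareD(1)[OF sq] unfolding mu_def by simp
  qed
  then show "mu x a = - 1" using mu_kap_cyc(1)[OF sq x_inj a c(1)] by simp
next
  assume m: "mu x a = - 1"
  note xa = unit_squareD(3-7)[OF sq a]
  have xa2: "x a \<in> orbit x a" "x (x a) \<in> orbit x a" "x (x (x a)) \<in> orbit x a" "x (x (x (x a))) \<in> orbit x a"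
    by (auto intro: orbit.intros)
  have "cyc x a \<subseteq> orbit x a"
  proof (cases "x a = - a")
    case True
    then have "x (x a) = a" using xa(2) by simp
    then show ?thesis using xa2 True unfolding cyc_def by auto
  next
    case False
    then have e: "x (x a) = - a" using m unfolding mu_def by (auto split: if_splits)
    then have "x (x (x a)) = - x a" "x (x (x (x a))) = a" using xa(2) odd_permsD(2)[OF x] by simp_all
    then show ?thesis using xa2 e unfolding cyc_def by auto
  qed
  then have o: "orbit x a = cyc x a" using orbit_unit_square[OF sq a] by blast
  have "uminus ` cyc x a = cyc x a" unfolding cyc_def by auto
  then show "negative_cycle x (cyc x a)" unfolding negative_cycle_def o[symmetric]
    using o by (intro bexI[of _ a]) (auto simp: cyc_def)
qed

text \<open>The length is 1 or 2, so the base factor characters live on cyclic groups of order 1, 2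
  or 4; their generator values 1, -1 and \<open>\<iota>\<close> are those recorded by
  \<open>kap\<close>.\<close>

lemma character_values:
  assumes a: "a \<in> X"
  defines "l \<equiv> cycle_length (cyc x a)"
  shows "mu x a \<noteq> - 1 \<Longrightarrow> \<kappa>pos l (int t mod int l) = kap x a ^ t"
    and "mu x a = - 1 \<Longrightarrow> \<kappa>neg l (int t mod int (2 * l)) = kap x a ^ t"
proof -
  note xa = unit_squareD(3-7)[OF sq a]
  have a0: "a \<noteq> - a" "- a \<noteq> a" "x a \<noteq> - x a" "- x a \<noteq> x a" using symmetricD(5,6)[OF symmetric_letters] a xa(1) by auto
  have l1: "l = 1" if "x a = a \<or> x a = - a"
  proof -
    have "cyc x a = {a, - a}" using that unfolding cyc_def by auto
    then show ?thesis unfolding l_def cycle_length_def using a0 by simp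
  qed
  have l2: "l = 2" if "\<not> (x a = a \<or> x a = - a)"
  proof -
    have "card {a, - a, x a, - x a} = 4" using that a0 by (subst card_insert_disjoint; auto)+
    then show ?thesis unfolding l_def cycle_length_def cyc_def by simp
  qed
  show "\<kappa>pos l (int t mod int l) = kap x a ^ t" if m: "mu x a \<noteq> - 1"
  proof (cases "x a = a")
    case True
    then show ?thesis using l1 integer_mod_character_power(1)[OF kpos, of 1 t] integer_mod_character_power(2)[OF kpos, of 1]
      by (simp add: kap_def)
  next
    case False
    then have "x a \<noteq> - a" "x (x a) \<noteq> - a" using m unfolding mu_def by auto
    then have "x (x a) = a" using xa(3) unit_squareD(1)[OF sq] by auto
    then show ?thesis using l2 False \<open>x a \<noteq> - a\<close> integer_mod_character_power(1)[OF kpos, of 2 t] integer_mod_2_character[OF kpos]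
      by (simp add: kap_def)
  qed
  show "\<kappa>neg l (int t mod int (2 * l)) = kap x a ^ t" if m: "mu x a = - 1"
  proof (cases "x a = - a")
    case True
    have "x (x a) = a" "x a \<noteq> a" using True xa(2) a0 by simp_all
    then show ?thesis using l1 True integer_mod_character_power(1)[OF kneg, of 1 t] integer_mod_2_character[of "\<kappa>neg 1"] kneg[of 1]
      by (simp add: kap_def)
  next
    case False
    then have "x (x a) = - a" using m unfolding mu_def by (auto split: if_splits)
    moreover have ne: "x a \<noteq> a" using calculation a0 by auto
    ultimately have "kap x a = \<iota>" using a0 by (simp add: kap_def)
    then show ?thesis using l2 ne False integer_mod_character_power(1)[OF kneg, of 2 t] iota_eq by simp
  qed
qed

lemma centralizer_closed: "z \<in> Z \<Longrightarrow> z' \<in> Z \<Longrightarrow> z \<circ> z' \<in> Z"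
  unfolding centralizer_eq using odd_perms_comp commutes_on_comp by blast

text \<open>Multiplicativity is \<open>weight_comp\<close> and the values on base factors are
  \<open>weight_loc\<close>. On the complement, the potential that is 1 at all base points makes
  every factor of the weight equal to 1.\<close>

lemma is_omega_weight:
  "is_omega n \<kappa>pos \<kappa>neg x b (restrict (weight X x) Z)"
  unfolding is_omega_def
proof (intro conjI ballI impI allI)
  show "linear_character (B_group n\<lparr>carrier := Z\<rparr>) (restrict (weight X x) Z)"
    unfolding linear_character_def hom_def complex_units_def
    using centralizer_closed weight_nonzero[OF sq] weight_comp[OF sq]
    by (auto simp: centralizer_eq)
next
  fix Q s t assume Q: "Q \<in> signed_cycles n x" "\<not> negative_cycle x Q"
  then obtain a where a: "a \<in> X" "Q = cyc x a" unfolding signed_cycles_eq[OF sq] by blast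
  then have m: "mu x a \<noteq> - 1" using Q negative_cycle_iff by simp
  then have "mu x a = 1" unfolding mu_def by (auto split: if_splits)
  then show "restrict (weight X x) Z ((perm_restrict (w0 n) Q ^^ s) \<circ> (perm_restrict x Q ^^ t)) =
    \<kappa>pos (cycle_length Q) (int t mod int (cycle_length Q))"
    unfolding a(2) restrict_powers(1)[OF a(1)] character_values(1)[OF a(1) m] using loc_in[OF a(1)] weight_loc[OF a(1)] by simp
next
  fix Q t assume Q: "Q \<in> signed_cycles n x" "negative_cycle x Q"
  then obtain a where a: "a \<in> X" "Q = cyc x a" unfolding signed_cycles_eq[OF sq] by blast
  then have m: "mu x a = - 1" using Q negative_cycle_iff by simp
  then show "restrict (weight X x) Z (perm_restrict x Q ^^ t) =
    \<kappa>neg (cycle_length Q) (int t mod int (2 * cycle_length Q))"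
    unfolding a(2) restrict_powers(2)[OF a(1)] character_values(2)[OF a(1) m] using loc_in[OF a(1)] weight_loc[OF a(1)] by simp
next
  fix s assume "s \<in> wreath_complement n x b"
  then have s: "s \<in> Z" "s ` T = T" unfolding wreath_complement_def signed_cycles_eq[OF sq] T_def by auto
  then have c: "commutes_on X s x" unfolding centralizer_eq by simp
  have "weight X x s = (\<Prod>a\<in>T. base_potential x b (s a) / base_potential x b a)"
    by (rule weight_eq[OF sq c T_transversal base_potential(1)[OF sq b_cyc]])
  also have "\<dots> = 1"
    using s(2) base_potential(2)[OF sq b_cyc] unfolding T_def[symmetric] by (intro prod.neutral) auto
  finally show "restrict (weight X x) Z s = 1" using s(1) by simp
qed simp

text \<open>Base factors and complement generate the centralizer: composing with an element of one
  base factor repairs the image of one base point, and once all base points are permuted the element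
  lies in the complement.\<close>

lemma is_omega_unique:
  assumes "is_omega n \<kappa>pos \<kappa>neg x b \<omega>" "is_omega n \<kappa>pos \<kappa>neg x b \<omega>'"
  shows "\<omega> = \<omega>'"
proof -
  have hom: "f (z \<circ> z') = f z * f z'" "f z \<noteq> 0" if "is_omega n \<kappa>pos \<kappa>neg x b f" "z \<in> Z" "z' \<in> Z" for f z z'
    using that unfolding is_omega_def linear_character_def hom_def complex_units_def by auto
  have loc_eq: "\<omega> (loc (cyc x a) s k) = \<omega>' (loc (cyc x a) s k)" if a: "a \<in> X" for a s k
  proof -
    let ?Q = "cyc x a"
    have Q: "?Q \<in> signed_cycles n x" unfolding signed_cycles_eq[OF sq] using a by blast
    show ?thesis
    proof (cases "negative_cycle x ?Q")
      case False
      have "f (loc ?Q s k) = \<kappa>pos (cycle_length ?Q) (int k mod int (cycle_length ?Q))"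
        if "is_omega n \<kappa>pos \<kappa>neg x b f" for f
        using that Q False unfolding is_omega_def restrict_powers(1)[OF a, symmetric] by blast
      from this[OF assms(1)] this[OF assms(2)] show ?thesis by simp
    next
      case True
      then have m: "mu x a = - 1" using negative_cycle_iff[OF a] by simp
      \<comment> \<open>On a negative cycle values are prescribed only for powers of the cycle.
        Negation on \<open>Q\<close> is such a power, with exponent 1 or 2 according to the
        length.\<close>
      obtain m where m: "\<And>c. c \<in> ?Q \<Longrightarrow> (x ^^ m) c = - c"
      proof (cases "x a = - a")
        case True
        then have "x c = - c" if "c \<in> ?Q" for c using that odd_permsD(2)[OF x] unfolding cyc_def by auto
        then show thesis by (intro that[of 1]) simp
      next
        case False
        then have "x (x a) = - a" using m unfolding mu_def by (auto split: if_splits)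
        then have "x (x c) = - c" if "c \<in> ?Q" for c using that odd_permsD(2)[OF x] unfolding cyc_def by auto
        then show thesis by (intro that[of 2]) (simp add: numeral_2_eq_2)
      qed
      have pow: "(x ^^ (m * s)) c = (- 1) ^ s * c" if "c \<in> ?Q" for c
      proof (induction s)
        case (Suc s)
        have "(x ^^ (m * Suc s)) c = (x ^^ m) ((x ^^ (m * s)) c)" using funpow_add_apply[of m "m * s" x c] by simp
        also have "\<dots> = - ((- 1) ^ s * c)" unfolding Suc using m cyc_closed(4)[OF a that, of s 0] by simp
        finally show ?case by simp
      qed simp
      have "loc ?Q s k = loc ?Q 0 (m * s + k)"
        unfolding loc_def using pow[OF cyc_closed(3)[OF a]] by (auto simp: fun_eq_iff funpow_add)
      moreover have val: "f (loc ?Q 0 t) = \<kappa>neg (cycle_length ?Q) (int t mod int (2 * cycle_length ?Q))"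
        if "is_omega n \<kappa>pos \<kappa>neg x b f" for f t
        using that Q True unfolding is_omega_def restrict_powers(2)[OF a, symmetric] by blast
      ultimately show ?thesis using val[OF assms(1)] val[OF assms(2)] by simp
    qed
  qed
  have "\<omega> z = \<omega>' z" if "z \<in> Z" for z
    using that
  proof (induction "card {t \<in> T. z t \<notin> T}" arbitrary: z rule: less_induct)
    case less
    have zo: "z \<in> odd_perms X" and zc: "commutes_on X z x" using less.prems unfolding centralizer_eq by auto
    show ?case
    proof (cases "{t \<in> T. z t \<notin> T} = {}")
      case True
      then have "z ` T \<subseteq> T" by auto
      then have "z ` T = T" using endo_inj_surj[OF T_X(2)] odd_bij_inj_on[OF odd_permsD(3)[OF zo]] by blast
      then have "z \<in> wreath_complement n x b"
        unfolding wreath_complement_def signed_cycles_eq[OF sq] using less.prems unfolding T_def by blast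
      then show ?thesis using assms unfolding is_omega_def by simp
    next
      case False
      then obtain t0 where t0: "t0 \<in> T" "z t0 \<notin> T" by blast
      have tX: "t0 \<in> X" using t0 T_X by auto
      have zX: "z t0 \<in> X" using odd_permsD(5)[OF zo tX] .
      let ?Q = "cyc x t0"
      define b' where "b' = b (cyc x (z t0))"
      have b': "b' \<in> T" "b' \<in> cyc x (z t0)" using b_props[OF zX] b_cyc[of "cyc x (z t0)"] zX unfolding b'_def by auto
      have "\<exists>s k. b' = (- 1) ^ s * (x ^^ k) (z t0)"
      proof -
        consider "b' = z t0" | "b' = - z t0" | "b' = x (z t0)" | "b' = - x (z t0)" using b'(2) unfolding cyc_def by auto
        then show ?thesis
        proof cases
          case 1 then show ?thesis by (intro exI[of _ 0]) simp
        next
          case 2 then show ?thesis by (intro exI[of _ 1] exI[of _ 0]) simp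
        next
          case 3 then show ?thesis by (intro exI[of _ 0] exI[of _ 1]) simp
        next
          case 4 then show ?thesis by (intro exI[of _ 1] exI[of _ 1]) simp
        qed
      qed
      then obtain s k where sk: "b' = (- 1) ^ s * (x ^^ k) (z t0)" by blast
      \<comment> \<open>The exponents move \<open>z t0\<close> to the base point of its cycle. As
        \<open>z\<close> commutes with \<open>x\<close> and with negation, they can be applied
        before \<open>z\<close> on the cycle of \<open>t0\<close>, which leaves the images of the
        other base points unchanged.\<close>
      let ?L = "loc ?Q s k"
      have L: "?L \<in> Z" by (rule loc_in[OF tX])
      have zx: "(x ^^ k) (z t0) = z ((x ^^ k) t0)"
        using funpow_commute_on[of X z x t0 k] commutes_onD(3)[OF zc] odd_permsD(4)[OF x] tX by simp
      have sgn: "(- 1) ^ s = (1 :: int) \<or> (- 1) ^ s = (- 1 :: int)" by (cases "even s") auto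
      have zL: "(z \<circ> ?L) t0 = b'"
        unfolding sk zx using odd_perms_sign[OF zo sgn] by (simp add: loc_def cyc_def)
      have zL': "(z \<circ> ?L) t = z t" if "t \<in> T" "t \<noteq> t0" for t
        using T_unique[OF t0(1) that(1)] that(2) by (auto simp: loc_def)
      have "{t \<in> T. (z \<circ> ?L) t \<notin> T} \<subseteq> {t \<in> T. z t \<notin> T} - {t0}" using zL zL' b'(1) by (auto simp del: o_apply) metis
      then have "{t \<in> T. (z \<circ> ?L) t \<notin> T} \<subset> {t \<in> T. z t \<notin> T}" using t0 by blast
      then have "card {t \<in> T. (z \<circ> ?L) t \<notin> T} < card {t \<in> T. z t \<notin> T}" using T_X(2) by (intro psubset_card_mono) auto
      from less.hyps[OF this centralizer_closed[OF less.prems L]]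
      have "\<omega> z * \<omega> ?L = \<omega>' z * \<omega>' ?L"
        using hom(1)[OF assms(1) less.prems L] hom(1)[OF assms(2) less.prems L] by simp
      then show ?thesis using loc_eq[OF tX] hom(2)[OF assms(2) L L] by simp
    qed
  qed
  moreover have "\<omega> z = \<omega>' z" if "z \<notin> Z" for z
    using assms that unfolding is_omega_def extensional_def by auto
  ultimately show ?thesis by blast
qed

lemma omega_eq: "omega n \<kappa>pos \<kappa>neg x b = restrict (weight X x) Z"
  unfolding omega_def using is_omega_weight is_omega_unique by (intro the_equality) auto

end

section \<open>The double Gelfand model\<close>

text \<open>The elements conjugating \<open>x\<close> to a given \<open>y\<close> form a coset of
  the centralizer, so every conjugate is met equally often. The factor cancels the denominator of
  the induced character.\<close>

lemma (in group) class_sum: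
  fixes F :: "'a \<Rightarrow> complex"
  assumes fin: "finite (carrier G)" and x: "x \<in> carrier G"
  defines "C \<equiv> (\<lambda>g. g \<otimes> x \<otimes> inv g) ` carrier G"
  shows "(\<Sum>t\<in>carrier G. F (t \<otimes> x \<otimes> inv t)) = of_nat (card (centralizer G x)) * (\<Sum>y\<in>C. F y)"
proof -
  have fib: "card {t \<in> carrier G. t \<otimes> x \<otimes> inv t = y} = card (centralizer G x)" if "y \<in> C" for y
  proof -
    from that obtain s where s: "s \<in> carrier G" "y = s \<otimes> x \<otimes> inv s" unfolding C_def by blast
    have "bij_betw (\<lambda>z. s \<otimes> z) (centralizer G x) {t \<in> carrier G. t \<otimes> x \<otimes> inv t = y}"
    proof (rule bij_betw_subset[OF bij_betw_lmult[OF s(1)]])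
      show "centralizer G x \<subseteq> carrier G" unfolding centralizer_def by auto
      show "(\<lambda>z. s \<otimes> z) ` centralizer G x = {t \<in> carrier G. t \<otimes> x \<otimes> inv t = y}"
      proof (intro equalityI subsetI)
        fix t assume "t \<in> (\<lambda>z. s \<otimes> z) ` centralizer G x"
        then obtain z where z: "z \<in> carrier G" "z \<otimes> x = x \<otimes> z" "t = s \<otimes> z" unfolding centralizer_def by blast
        have "t \<otimes> x \<otimes> inv t = s \<otimes> (z \<otimes> x) \<otimes> inv z \<otimes> inv s"
          using z(1,3) s(1) x by (simp add: inv_mult_group m_assoc)
        also have "\<dots> = y" unfolding z(2) s(2) using z(1) s(1) x by (simp add: m_assoc)
        finally show "t \<in> {t \<in> carrier G. t \<otimes> x \<otimes> inv t = y}" using z s by simp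
      next
        fix t assume "t \<in> {t \<in> carrier G. t \<otimes> x \<otimes> inv t = y}"
        then have t: "t \<in> carrier G" "t \<otimes> x \<otimes> inv t = s \<otimes> x \<otimes> inv s" using s by auto
        define z where "z = inv s \<otimes> t"
        have z: "z \<in> carrier G" "s \<otimes> z = t" unfolding z_def using s t by (auto simp: mult_inv_left)
        have "inv s \<otimes> (t \<otimes> x \<otimes> inv t) \<otimes> t = inv s \<otimes> (s \<otimes> x \<otimes> inv s) \<otimes> t" unfolding t(2) ..
        then have "z \<otimes> x = x \<otimes> z"
          unfolding z_def using s(1) t(1) x by (simp add: m_assoc inv_mult_left)
        then show "t \<in> (\<lambda>z. s \<otimes> z) ` centralizer G x" using z unfolding centralizer_def by blast
      qed
    qed
    then show ?thesis by (simp add: bij_betw_same_card)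
  qed
  have "(\<Sum>t\<in>carrier G. F (t \<otimes> x \<otimes> inv t)) = (\<Sum>y\<in>C. \<Sum>t\<in>{t \<in> carrier G. t \<otimes> x \<otimes> inv t = y}. F (t \<otimes> x \<otimes> inv t))"
    using fin unfolding C_def by (intro sum.group[symmetric]) auto
  also have "\<dots> = (\<Sum>y\<in>C. of_nat (card (centralizer G x)) * F y)"
    using fib by (intro sum.cong refl) simp
  finally show ?thesis by (simp add: sum_distrib_left)
qed

lemma (in group) conjugacy_classes_partition:
  assumes "C \<in> conjugacy_classes G"
  shows "C \<subseteq> carrier G" "\<And>y. y \<in> C \<Longrightarrow> C = (\<lambda>g. g \<otimes> y \<otimes> inv g) ` carrier G"
    "\<And>C'. C' \<in> conjugacy_classes G \<Longrightarrow> C \<inter> C' \<noteq> {} \<Longrightarrow> C = C'"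
proof -
  have orb: "C = (\<lambda>g. g \<otimes> y \<otimes> inv g) ` carrier G" if C: "C \<in> conjugacy_classes G" and y: "y \<in> C" for C y
  proof -
    obtain x where x: "x \<in> carrier G" "C = (\<lambda>g. g \<otimes> x \<otimes> inv g) ` carrier G"
      using C unfolding conjugacy_classes_def by blast
    obtain s where s: "s \<in> carrier G" "y = s \<otimes> x \<otimes> inv s" using y x by blast
    have e: "g \<otimes> y \<otimes> inv g = (g \<otimes> s) \<otimes> x \<otimes> inv (g \<otimes> s)" if "g \<in> carrier G" for g
      unfolding s(2) using that s(1) x(1) by (simp add: inv_mult_group m_assoc)
    have "(\<lambda>g. g \<otimes> y \<otimes> inv g) ` carrier G = (\<lambda>g. g \<otimes> x \<otimes> inv g) ` (\<lambda>g. g \<otimes> s) ` carrier G"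
      unfolding image_image using e by (intro image_cong) auto
    also have "(\<lambda>g. g \<otimes> s) ` carrier G = carrier G" using bij_betw_rmult[OF s(1)] unfolding bij_betw_def by simp
    finally show ?thesis using x(2) by simp
  qed
  show "C \<subseteq> carrier G" using assms unfolding conjugacy_classes_def by auto
  show "\<And>y. y \<in> C \<Longrightarrow> C = (\<lambda>g. g \<otimes> y \<otimes> inv g) ` carrier G" using orb[OF assms] .
  show "\<And>C'. C' \<in> conjugacy_classes G \<Longrightarrow> C \<inter> C' \<noteq> {} \<Longrightarrow> C = C'" using orb assms by blast
qed

section \<open>The group D_n as the kernel of the sign count\<close>

lemma positive_letters: "{a \<in> letters n. 0 < a} = {1..int n}"
  unfolding letters_def by auto

lemma theta_letters: "theta (- 1) (letters n) w = (- 1) ^ card {i \<in> {1..int n}. w i < 0}"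
proof -
  have "theta (- 1) (letters n) w = (\<Prod>i\<in>{1..int n}. if w i < 0 then - 1 else 1)"
    unfolding theta_def positive_letters sgnc_def by (intro prod.cong refl) auto
  also have "\<dots> = (\<Prod>i\<in>{i \<in> {1..int n}. w i < 0}. - 1)"
    by (rule prod.inter_filter[symmetric]) simp
  finally show ?thesis by simp
qed

lemma carrier_D_group:
  "carrier (D_group n) = {w \<in> odd_perms (letters n). theta (- 1) (letters n) w = 1}"
proof -
  have ev: "(- 1) ^ k = (1 :: complex) \<longleftrightarrow> even k" for k by (cases "even k") auto
  show ?thesis unfolding theta_letters ev D_group_def by (simp add: carrier_B_group)
qed

lemma mult_D_group [simp]: "g \<otimes>\<^bsub>D_group n\<^esub> h = g \<circ> h" and one_D_group [simp]: "\<one>\<^bsub>D_group n\<^esub> = id"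
  by (simp_all add: D_group_def B_group_def)

lemma theta_hom:
  assumes "g \<in> odd_perms (letters n)" "h \<in> odd_perms (letters n)"
  shows "theta (- 1) (letters n) (g \<circ> h) = theta (- 1) (letters n) g * theta (- 1) (letters n) h"
proof -
  have "theta (- 1) (letters n) (g \<circ> h) = theta (- 1) (letters n) h * theta (- 1) (letters n) g"
  proof (rule theta_comp)
    show "a \<noteq> 0 \<and> g a \<noteq> 0" if "a \<in> letters n" for a
      using symmetricD(4)[OF symmetric_letters] that odd_permsD(5)[OF assms(1) that] by blast
  qed (use symmetric_letters odd_bij_inj_on[OF odd_permsD(3)[OF assms(2)]] odd_permsD(2,4)[OF assms(2)]
      odd_permsD(2)[OF assms(1)] in auto)
  then show ?thesis by (simp add: mult.commute)
qed

lemma theta_id: "theta \<eta> A id = 1"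
  unfolding theta_def sgnc_def by (intro prod.neutral) auto

lemma group_D_group: "group (D_group n)"
proof (rule groupI)
  fix g assume "g \<in> carrier (D_group n)"
  then have g: "g \<in> odd_perms (letters n)" "theta (- 1) (letters n) g = 1" by (auto simp: carrier_D_group)
  then obtain h where h: "h \<in> odd_perms (letters n)" "h \<circ> g = id"
    using group.l_inv_ex[OF group_B_group, of g n] by (auto simp: carrier_B_group)
  then have "theta (- 1) (letters n) h = 1" using theta_hom[OF h(1) g(1)] g(2) theta_id by simp
  then show "\<exists>h\<in>carrier (D_group n). h \<otimes>\<^bsub>D_group n\<^esub> g = \<one>\<^bsub>D_group n\<^esub>"
    using h by (auto simp: carrier_D_group)
next
  have "id \<in> odd_perms (letters n)" unfolding odd_perms_def by (simp add: permutes_id)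
  then show "\<one>\<^bsub>D_group n\<^esub> \<in> carrier (D_group n)" by (simp add: carrier_D_group theta_id)
qed (auto simp: carrier_D_group odd_perms_comp theta_hom comp_assoc)

text \<open>A conjugate of \<open>g\<close> by the inverse of \<open>t\<close> centralizes
  \<open>x\<close> exactly if \<open>g\<close> commutes with the conjugate of \<open>x\<close> by
  \<open>t\<close>, and transport by \<open>t\<close> identifies the two weights.\<close>

lemma (in signed_involution) psi_eq:
  assumes g: "g \<in> odd_perms X"
  defines "C \<equiv> (\<lambda>t. t \<otimes>\<^bsub>B_group n\<^esub> x \<otimes>\<^bsub>B_group n\<^esub> inv\<^bsub>B_group n\<^esub> t) ` carrier (B_group n)"
  shows "psi n \<kappa>pos \<kappa>neg x b g = (\<Sum>y\<in>C. if commutes_on X g y then weight X y g else 0)"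
proof -
  interpret B: group "B_group n" by (rule group_B_group)
  let ?inv = "\<lambda>t. inv\<^bsub>B_group n\<^esub> t"
  have fin: "finite (carrier (B_group n))" unfolding carrier_B_group by (rule finite_odd_perms[OF symmetric_letters])
  have xB: "x \<in> carrier (B_group n)" using x by (simp add: carrier_B_group)
  define F where "F y = (if commutes_on X g y then weight X y g else 0)" for y
  have tm: "(?inv t \<circ> g \<circ> t \<in> Z \<longleftrightarrow> commutes_on X g (t \<circ> x \<circ> ?inv t)) \<and>
      (?inv t \<circ> g \<circ> t \<in> Z \<longrightarrow> weight X x (?inv t \<circ> g \<circ> t) = weight X (t \<circ> x \<circ> ?inv t) g)"
    if t: "t \<in> carrier (B_group n)" for t
  proof -
    have tp: "t \<in> odd_perms X" "?inv t \<in> odd_perms X" using t B.inv_closed[OF t] by (auto simp: carrier_B_group)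
    have it: "?inv t \<circ> t = id" "t \<circ> ?inv t = id" using B.l_inv[OF t] B.r_inv[OF t] by auto
    have it': "?inv t (t a) = a" "t (?inv t a) = a" for a using it by (metis comp_apply id_apply)+
    have gt: "?inv t \<circ> g \<circ> t \<in> odd_perms X" using tp g odd_perms_comp by blast
    have xt: "t \<circ> x \<circ> ?inv t \<in> odd_perms X" using tp x odd_perms_comp by blast
    have "?inv t \<circ> g \<circ> t \<in> Z \<longleftrightarrow> (\<forall>a. ?inv t (g (t (x a))) = x (?inv t (g (t a))))"
      unfolding centralizer_def carrier_B_group using gt by (auto simp: fun_eq_iff)
    also have "\<dots> \<longleftrightarrow> (\<forall>a. g (t (x a)) = t (x (?inv t (g (t a)))))" using it' by metis
    also have "\<dots> \<longleftrightarrow> (\<forall>a. t (x (?inv t (g a))) = g (t (x (?inv t a))))" using it' by metis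
    also have "\<dots> \<longleftrightarrow> commutes_on X g (t \<circ> x \<circ> ?inv t)"
    proof -
      have "t (x (?inv t (g a))) = g (t (x (?inv t a)))" if "a \<notin> X" for a
        using that odd_permsD(6)[OF xt, of a] odd_permsD(6)[OF xt, of "g a"] odd_permsD(6)[OF g, of a] by simp
      then show ?thesis unfolding commutes_on_def using odd_permsD(3,4)[OF g] by auto
    qed
    finally have iff: "?inv t \<circ> g \<circ> t \<in> Z \<longleftrightarrow> commutes_on X g (t \<circ> x \<circ> ?inv t)" .
    moreover have "weight X x (?inv t \<circ> g \<circ> t) = weight X (t \<circ> x \<circ> ?inv t) g" if "?inv t \<circ> g \<circ> t \<in> Z"
    proof -
      have c: "commutes_on X (?inv t \<circ> g \<circ> t) x" using that unfolding centralizer_eq by simp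
      show ?thesis
        by (rule weight_transport(3)[OF sq c odd_permsD(3,4)[OF tp(1)] _ odd_permsD(3)[OF g], symmetric]) (simp_all add: it')
    qed
    ultimately show ?thesis by blast
  qed
  have sumF: "(\<Sum>t | t \<in> carrier (B_group n) \<and> ?inv t \<circ> g \<circ> t \<in> Z. weight X x (?inv t \<circ> g \<circ> t))
      = (\<Sum>t\<in>carrier (B_group n). F (t \<circ> x \<circ> ?inv t))"
  proof -
    have "(\<Sum>t | t \<in> carrier (B_group n) \<and> ?inv t \<circ> g \<circ> t \<in> Z. weight X x (?inv t \<circ> g \<circ> t))
      = (\<Sum>t\<in>carrier (B_group n). if ?inv t \<circ> g \<circ> t \<in> Z then weight X x (?inv t \<circ> g \<circ> t) else 0)"
      by (rule sum.inter_filter[OF fin])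
    also have "\<dots> = (\<Sum>t\<in>carrier (B_group n). F (t \<circ> x \<circ> ?inv t))"
    proof (rule sum.cong[OF refl])
      fix t assume t: "t \<in> carrier (B_group n)"
      show "(if ?inv t \<circ> g \<circ> t \<in> Z then weight X x (?inv t \<circ> g \<circ> t) else 0) = F (t \<circ> x \<circ> ?inv t)"
        using tm[OF t] unfolding F_def by simp
    qed
    finally show ?thesis .
  qed
  have "\<one>\<^bsub>B_group n\<^esub> \<in> Z" unfolding centralizer_def using B.one_closed by simp
  moreover have "finite Z" by (rule finite_subset[OF _ fin]) (auto simp: centralizer_def)
  ultimately have Zpos: "card Z > 0" using card_gt_0_iff by blast
  have "psi n \<kappa>pos \<kappa>neg x b g =
      (\<Sum>t | t \<in> carrier (B_group n) \<and> ?inv t \<circ> g \<circ> t \<in> Z. weight X x (?inv t \<circ> g \<circ> t)) / of_nat (card Z)"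
    unfolding psi_def induced_character_def omega_eq by (simp add: restrict_def)
  also have "\<dots> = (\<Sum>y\<in>C. F y)"
    unfolding sumF using B.class_sum[OF fin xB, of F] Zpos unfolding C_def by simp
  finally show ?thesis unfolding F_def .
qed

theorem theorem7p3:
  fixes n :: nat
    and \<kappa>pos \<kappa>neg :: "nat \<Rightarrow> int \<Rightarrow> complex"
    and rep :: "(int \<Rightarrow> int) set \<Rightarrow> int \<Rightarrow> int"
    and b :: "(int \<Rightarrow> int) set \<Rightarrow> int set \<Rightarrow> int"
  assumes "n \<ge> 1"
    and "\<And>i. i \<ge> 1 \<Longrightarrow> faithful_linear_character (integer_mod_group i) (\<kappa>pos i)"
    and "\<And>i. i \<ge> 1 \<Longrightarrow> faithful_linear_character (integer_mod_group (2 * i)) (\<kappa>neg i)"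
    and "\<And>C. C \<in> conjugacy_classes (B_group n) \<Longrightarrow> rep C \<in> C"
    and "\<And>C Q. C \<in> conjugacy_classes (B_group n) \<Longrightarrow> Q \<in> signed_cycles n (rep C) \<Longrightarrow> b C Q \<in> Q"
  shows "double_gelfand_model (D_group n)
    (\<lambda>w. \<Sum>C | C \<in> conjugacy_classes (B_group n) \<and>
               (class_square (B_group n) C = {\<one>\<^bsub>B_group n\<^esub>} \<or> class_square (B_group n) C = {w0 n}).
       restrict (psi n \<kappa>pos \<kappa>neg (rep C) (b C)) (carrier (D_group n)) w)"
proof -
  let ?X = "letters n"
  interpret B: group "B_group n" by (rule group_B_group)
  interpret D: group "D_group n" by (rule group_D_group)
  define \<iota> where "\<iota> = \<kappa>neg 2 1"
  interpret quartic_root \<iota>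
    using integer_mod_4_character[of "\<kappa>neg 2"] assms(3)[of 2] unfolding \<iota>_def by unfold_locales simp
  have X: "symmetric ?X" by (rule symmetric_letters)
  have finB: "finite (carrier (B_group n))" unfolding carrier_B_group by (rule finite_odd_perms[OF X])
  have DB: "carrier (D_group n) \<subseteq> odd_perms ?X" unfolding carrier_D_group by auto
  have finD: "finite (carrier (D_group n))" using DB finite_odd_perms[OF X] finite_subset by blast
  define CC where "CC = {C \<in> conjugacy_classes (B_group n).
    class_square (B_group n) C = {\<one>\<^bsub>B_group n\<^esub>} \<or> class_square (B_group n) C = {w0 n}}"
  \<comment> \<open>The two solution sets of squaring to 1 and to \<open>w0 n\<close>. Their union
    is the union of the classes in the theorem, so the sum over classes becomes a sum over
    elements.\<close>
  define U where "U \<eta> = {y \<in> odd_perms ?X. unit_square \<eta> ?X y}" for \<eta>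
  have U_iff: "y \<in> U 1 \<longleftrightarrow> y \<circ> y = id" "y \<in> U (- 1) \<longleftrightarrow> y \<circ> y = w0 n" if y: "y \<in> odd_perms ?X" for y
  proof -
    have "y \<in> U \<eta> \<longleftrightarrow> (\<forall>a\<in>?X. y (y a) = \<eta> * a)" if "\<eta> = 1 \<or> \<eta> = - 1" for \<eta>
      unfolding U_def unit_square_def using y odd_permsD(2,5)[OF y] X that by auto
    then have U1: "y \<in> U 1 \<longleftrightarrow> (\<forall>a\<in>?X. y (y a) = a)" "y \<in> U (- 1) \<longleftrightarrow> (\<forall>a\<in>?X. y (y a) = - a)" by auto
    have out: "y (y a) = a" if "a \<notin> ?X" for a using odd_permsD(6)[OF y that] by simp
    have "y \<circ> y = id \<longleftrightarrow> (\<forall>a. y (y a) = a)" "y \<circ> y = w0 n \<longleftrightarrow> (\<forall>a. y (y a) = (if a \<in> ?X then - a else a))"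
      unfolding fun_eq_iff w0_def by simp_all
    then show "y \<in> U 1 \<longleftrightarrow> y \<circ> y = id" "y \<in> U (- 1) \<longleftrightarrow> y \<circ> y = w0 n"
      unfolding U1 using out by (metis, metis)
  qed
  have U_disj: "U 1 \<inter> U (- 1) = {}"
  proof -
    \<comment> \<open>Here \<open>n \<ge> 1\<close> enters: with no letters at all the two squares
      would coincide.\<close>
    have "1 \<in> ?X" using assms(1) unfolding letters_def by auto
    then show ?thesis unfolding U_def unit_square_def by fastforce
  qed
  have CC_sub: "C \<in> CC \<Longrightarrow> y \<in> C \<Longrightarrow> y \<in> U 1 \<union> U (- 1)" for C y
  proof -
    assume C: "C \<in> CC" and y: "y \<in> C"
    have yB: "y \<in> odd_perms ?X" using B.conjugacy_classes_partition(1)[of C] C y unfolding CC_def carrier_B_group by blast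
    have "y \<circ> y \<in> class_square (B_group n) C" unfolding class_square_def using y by auto
    then have "y \<circ> y = id \<or> y \<circ> y = w0 n" using C unfolding CC_def by auto
    then show ?thesis using U_iff[OF yB] by auto
  qed
  have w0_central: "t \<circ> w0 n = w0 n \<circ> t" if "t \<in> odd_perms ?X" for t
    unfolding w0_def using odd_permsD(2,5,6)[OF that] by (auto simp: fun_eq_iff)
  have Union: "\<Union>CC = U 1 \<union> U (- 1)"
  proof (intro equalityI subsetI)
    fix y assume y: "y \<in> U 1 \<union> U (- 1)"
    then have yB: "y \<in> odd_perms ?X" unfolding U_def by auto
    then have yc: "y \<in> carrier (B_group n)" by (simp add: carrier_B_group)
    define C where "C = (\<lambda>g. g \<otimes>\<^bsub>B_group n\<^esub> y \<otimes>\<^bsub>B_group n\<^esub> inv\<^bsub>B_group n\<^esub> g) ` carrier (B_group n)"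
    have C: "C \<in> conjugacy_classes (B_group n)" unfolding C_def conjugacy_classes_def using yc by blast
    have yC: "y \<in> C" unfolding C_def using yc B.one_closed B.inv_one by (intro image_eqI[of _ _ "\<one>\<^bsub>B_group n\<^esub>"]) auto
    \<comment> \<open>The identity and \<open>w0 n\<close> are central, so conjugating
      \<open>y\<close> does not change its square.\<close>
    have "c \<circ> c = y \<circ> y" if c: "c \<in> C" for c
    proof -
      obtain t where t: "t \<in> carrier (B_group n)" "c = t \<otimes>\<^bsub>B_group n\<^esub> y \<otimes>\<^bsub>B_group n\<^esub> inv\<^bsub>B_group n\<^esub> t"
        using c unfolding C_def by blast
      let ?i = "inv\<^bsub>B_group n\<^esub> t"
      have it: "?i \<circ> t = id" "t \<circ> ?i = id" using B.l_inv[OF t(1)] B.r_inv[OF t(1)] by auto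
      have "c \<circ> c = t \<circ> y \<circ> (?i \<circ> t) \<circ> y \<circ> ?i" unfolding t(2) by (simp add: comp_assoc)
      then have cc: "c \<circ> c = t \<circ> (y \<circ> y) \<circ> ?i" unfolding it by (simp add: comp_assoc)
      have "t \<circ> (y \<circ> y) = (y \<circ> y) \<circ> t"
        using y U_iff[OF yB] w0_central[of t] t(1) by (auto simp: carrier_B_group)
      then have "c \<circ> c = (y \<circ> y) \<circ> (t \<circ> ?i)" unfolding cc by (simp only: comp_assoc)
      then show ?thesis unfolding it by simp
    qed
    then have "class_square (B_group n) C = (\<lambda>_. y \<circ> y) ` C"
      unfolding class_square_def by (intro image_cong) auto
    also have "\<dots> = {y \<circ> y}" using yC by blast
    finally have "class_square (B_group n) C = {y \<circ> y}" .
    then have "C \<in> CC" unfolding CC_def using C y U_iff[OF yB] by auto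
    then show "y \<in> \<Union>CC" using yC by blast
  qed (use CC_sub in blast)
  define \<phi> where "\<phi> w = (\<Sum>C\<in>CC. restrict (psi n \<kappa>pos \<kappa>neg (rep C) (b C)) (carrier (D_group n)) w)" for w
  define F where "F g y = (if commutes_on ?X g y then weight ?X y g else 0)" for g y
  have psi: "psi n \<kappa>pos \<kappa>neg (rep C) (b C) g = (\<Sum>y\<in>C. F g y)" if C: "C \<in> CC" and g: "g \<in> odd_perms ?X" for C g
  proof -
    have Cc: "C \<in> conjugacy_classes (B_group n)" using C unfolding CC_def by simp
    have r: "rep C \<in> C" by (rule assms(4)[OF Cc])
    obtain \<eta> where \<eta>: "rep C \<in> U \<eta>" using CC_sub[OF C r] by blast
    interpret S: signed_involution \<iota> n \<eta> "rep C" "b C" \<kappa>pos \<kappa>neg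
      using \<eta> assms(2,3) assms(5)[OF Cc] unfolding U_def by unfold_locales (auto simp: \<iota>_def)
    show ?thesis unfolding F_def S.psi_eq[OF g] B.conjugacy_classes_partition(2)[OF Cc r, symmetric] ..
  qed
  have finU: "finite (U \<eta>)" for \<eta> unfolding U_def using finite_odd_perms[OF X] by simp
  have \<phi>_eq: "\<phi> g = (\<Sum>y\<in>U 1 \<union> U (- 1). F g y)" if g: "g \<in> carrier (D_group n)" for g
  proof -
    have gX: "g \<in> odd_perms ?X" using g DB by blast
    have "\<phi> g = (\<Sum>C\<in>CC. \<Sum>y\<in>C. F g y)" unfolding \<phi>_def using g psi[OF _ gX] by simp
    also have "\<dots> = (\<Sum>y\<in>\<Union>CC. F g y)"
    proof (rule sum.Union_disjoint[symmetric, unfolded o_def])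
      show "\<forall>C\<in>CC. finite C" using CC_sub finU finite_subset[of _ "U 1 \<union> U (- 1)"] by blast
      show "\<forall>C\<in>CC. \<forall>C'\<in>CC. C \<noteq> C' \<longrightarrow> C \<inter> C' = {}"
        using B.conjugacy_classes_partition(3) unfolding CC_def by blast
    qed
    finally show ?thesis unfolding Union .
  qed
  have count: "\<phi> g = of_nat 2 * of_nat (card {x \<in> carrier (D_group n). x \<otimes>\<^bsub>D_group n\<^esub> x = g})"
    if g: "g \<in> carrier (D_group n)" for g
  proof -
    have gX: "g \<in> odd_perms ?X" using g DB by blast
    have sumU: "(\<Sum>y\<in>U \<eta>. F g y) = (\<Sum>x\<in>square_roots ?X g. theta \<eta> ?X x)" if \<eta>: "\<eta> = 1 \<or> \<eta> = - 1" for \<eta>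
    proof -
      have "(\<Sum>y\<in>U \<eta>. F g y) = (\<Sum>y\<in>{y \<in> U \<eta>. commutes_on ?X g y}. weight ?X y g)"
        unfolding F_def by (rule sum.inter_filter[OF finU, symmetric])
      also have "{y \<in> U \<eta>. commutes_on ?X g y} = commuting_unit_squares \<eta> ?X g"
        unfolding U_def commuting_unit_squares_def by auto
      finally show ?thesis using weighted_count[OF \<eta> X odd_permsD(3,4)[OF gX]] by simp
    qed
    have fin: "finite (square_roots ?X g)" using finite_odd_perms[OF X] unfolding square_roots_def by simp
    have "\<phi> g = (\<Sum>x\<in>square_roots ?X g. theta 1 ?X x) + (\<Sum>x\<in>square_roots ?X g. theta (- 1) ?X x)"
      unfolding \<phi>_eq[OF g] sum.union_disjoint[OF finU finU U_disj] using sumU by simp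
    \<comment> \<open>The two terms add up to 2 at a root in D_n and cancel at a root
      outside.\<close>
    also have "\<dots> = (\<Sum>x\<in>square_roots ?X g. if theta (- 1) ?X x = 1 then 2 else 0)"
      unfolding sum.distrib[symmetric] theta_one using theta_values[of "- 1" ?X] by (intro sum.cong refl) fastforce
    also have "\<dots> = (\<Sum>x\<in>{x \<in> square_roots ?X g. theta (- 1) ?X x = 1}. 2)"
      by (rule sum.inter_filter[OF fin, symmetric])
    also have "{x \<in> square_roots ?X g. theta (- 1) ?X x = 1} = {x \<in> carrier (D_group n). x \<otimes>\<^bsub>D_group n\<^esub> x = g}"
    proof -
      have "(\<forall>a\<in>?X. x (x a) = g a) \<longleftrightarrow> x \<circ> x = g" if x: "x \<in> odd_perms ?X" for x
        using odd_permsD(6)[OF x] odd_permsD(6)[OF gX] by (auto simp: fun_eq_iff)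
      then show ?thesis unfolding square_roots_def carrier_D_group by auto
    qed
    finally show ?thesis by simp
  qed
  have nonneg: "\<exists>z\<ge>0. (\<Sum>g\<in>carrier (D_group n). \<phi> g * tr (\<rho> g)) = of_real z"
    if irr: "irreducible_representation (D_group n) d \<rho>" for d \<rho>
  proof -
    \<comment> \<open>Nonnegativity holds for each \<open>y\<close> separately, since its weight is
      a linear character of the centralizer of \<open>y\<close> in D_n. Restrictions of induced
      characters need not be decomposed.\<close>
    have each: "\<exists>z\<ge>0. (\<Sum>g\<in>carrier (D_group n). F g y * tr (\<rho> g)) = of_real z" if y: "y \<in> U 1 \<union> U (- 1)" for y
    proof -
      obtain \<eta> where sq: "unit_square \<eta> ?X y" and yX: "y \<in> odd_perms ?X" using y unfolding U_def by blast
      let ?K = "{g \<in> carrier (D_group n). commutes_on ?X g y}"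
      have "id \<in> ?K" using D.one_closed unfolding commutes_on_def odd_bij_def by auto
      then have ne: "?K \<noteq> {}" by blast
      obtain z where z: "z \<ge> 0" "(\<Sum>g\<in>?K. weight ?X y g * tr (\<rho> g)) = of_real z"
      proof (rule D.linear_character_sum_nonneg[OF irreducibleD(1)[OF irr] finD _ ne])
        show "g \<otimes>\<^bsub>D_group n\<^esub> h \<in> ?K" if "g \<in> ?K" "h \<in> ?K" for g h
          using that D.m_closed[of g h] commutes_on_comp[of ?X g y h] by simp
        show "weight ?X y (g \<otimes>\<^bsub>D_group n\<^esub> h) = weight ?X y g * weight ?X y h" if "g \<in> ?K" "h \<in> ?K" for g h
          using that weight_comp[OF sq, of g h] by simp
      qed auto
      have "(\<Sum>g\<in>carrier (D_group n). F g y * tr (\<rho> g)) =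
          (\<Sum>g\<in>carrier (D_group n). if commutes_on ?X g y then weight ?X y g * tr (\<rho> g) else 0)"
        unfolding F_def by (intro sum.cong refl) simp
      also have "\<dots> = (\<Sum>g\<in>?K. weight ?X y g * tr (\<rho> g))" by (rule sum.inter_filter[OF finD, symmetric])
      finally show ?thesis using z by auto
    qed
    then obtain z where z: "\<And>y. y \<in> U 1 \<union> U (- 1) \<Longrightarrow> 0 \<le> z y \<and>
        (\<Sum>g\<in>carrier (D_group n). F g y * tr (\<rho> g)) = of_real (z y)" by metis
    have "(\<Sum>g\<in>carrier (D_group n). \<phi> g * tr (\<rho> g)) =
        (\<Sum>g\<in>carrier (D_group n). \<Sum>y\<in>U 1 \<union> U (- 1). F g y * tr (\<rho> g))"
      by (intro sum.cong refl) (simp add: \<phi>_eq sum_distrib_right)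
    also have "\<dots> = (\<Sum>y\<in>U 1 \<union> U (- 1). of_real (z y))"
      using z by (subst sum.swap) (intro sum.cong refl, simp)
    also have "\<dots> = of_real (\<Sum>y\<in>U 1 \<union> U (- 1). z y)" by simp
    finally show ?thesis using z by (intro exI[of _ "\<Sum>y\<in>U 1 \<union> U (- 1). z y"]) (auto intro!: sum_nonneg)
  qed
  have ambivalent: "\<exists>h\<in>carrier (D_group n). inv\<^bsub>D_group n\<^esub> g = h \<otimes>\<^bsub>D_group n\<^esub> g \<otimes>\<^bsub>D_group n\<^esub> inv\<^bsub>D_group n\<^esub> h"
    if g: "g \<in> carrier (D_group n)" for g
  proof -
    have gX: "g \<in> odd_perms ?X" using g DB by blast
    \<comment> \<open>The relation says that \<open>t\<close> conjugates \<open>g\<close> to its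
      inverse, and the sign count 1 places \<open>t\<close> in D_n.\<close>
    obtain t where t: "t \<in> odd_perms ?X" "\<And>a. a \<in> ?X \<Longrightarrow> g (t (g a)) = t a" "theta (- 1) ?X t = 1"
      using ex_even_reversal[OF X odd_permsD(3,4)[OF gX]] by blast
    have tD: "t \<in> carrier (D_group n)" using t by (simp add: carrier_D_group)
    have "g (t (g a)) = t a" for a
      using t(2)[of a] odd_permsD(6)[OF gX, of a] odd_permsD(6)[OF t(1), of a] by (cases "a \<in> ?X") auto
    then have "g \<otimes>\<^bsub>D_group n\<^esub> (t \<otimes>\<^bsub>D_group n\<^esub> g) = t" by auto
    then have "t \<otimes>\<^bsub>D_group n\<^esub> g = inv\<^bsub>D_group n\<^esub> g \<otimes>\<^bsub>D_group n\<^esub> t"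
      using D.inv_mult_left[OF g, of "t \<otimes>\<^bsub>D_group n\<^esub> g"] tD g D.m_closed by metis
    then have "t \<otimes>\<^bsub>D_group n\<^esub> g \<otimes>\<^bsub>D_group n\<^esub> inv\<^bsub>D_group n\<^esub> t =
        inv\<^bsub>D_group n\<^esub> g \<otimes>\<^bsub>D_group n\<^esub> (t \<otimes>\<^bsub>D_group n\<^esub> inv\<^bsub>D_group n\<^esub> t)"
      using D.m_assoc[OF D.inv_closed[OF g] tD D.inv_closed[OF tD]] by metis
    then have "inv\<^bsub>D_group n\<^esub> g = t \<otimes>\<^bsub>D_group n\<^esub> g \<otimes>\<^bsub>D_group n\<^esub> inv\<^bsub>D_group n\<^esub> t"
      using D.r_inv[OF tD] D.r_one[OF D.inv_closed[OF g]] by metis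
    then show ?thesis using tD by blast
  qed
  have "has_multiplicities (D_group n) \<phi> (\<lambda>_. 2)"
    using D.multiple_of_square_root_count[OF finD ambivalent nonneg count pos2] .
  then show ?thesis unfolding double_gelfand_model_def \<phi>_def CC_def by auto
qed

end
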